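(* Let $\beta$ be Diophantine. There is $\eta=\eta(\beta)>1$ such that the following holds. Let $\delta>0$ and let $D\in\mathcal{C}_\delta^\omega(\mathbb{T},M_2(\mathbb{C}))$ be such that $d(x)=\det D(x)$ does not vanish identically. Then there exist $\gamma=\gamma(D)>0$ and constants $0<c,C<\infty$ such that for every $0<\kappa<1$, for every approximant $p/q$ of $\beta$, i.e. $\left|\beta-\frac pq\right|<\frac1{q^2}$ with $(p,q)=1$, with $q$ sufficiently large, and for every $n\in\mathbb{N}$ with $n>(C\kappa^{-2}q)^\eta$, one has, uniformly over all $\tilde D\in\mathcal{C}_\delta^\omega(\mathbb{T},M_2(\mathbb{C}))$ with $\|\tilde D-D\|_\delta<\gamma$, $$\mu\left\{x\in\mathbb{T}:\left|\frac1n\log\|\tilde D_n(x)\|-L_n(\beta,\tilde D)\right|>\kappa\right\}<e^{-c\kappa q}.$$ Here "$q$ sufficiently large" means $q\ge q_0$ for a threshold $q_0$ which may depend on $\beta$, $D$ and $\kappa$, but not on $n$ or $\tilde D$; the constants $c,C$ do not depend on $\kappa$, $q$, $n$ or $\tilde D$.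
   Context: $\mathbb{T}=\mathbb{R}/\mathbb{Z}$ carries its Haar probability measure $\mu$. For $\delta>0$, $\mathcal{C}_\delta^\omega(\mathbb{T},M_2(\mathbb{C}))$ denotes the analytic (1-periodic) $M_2(\mathbb{C})$-valued functions on $\mathbb{T}$ that extend analytically to a neighborhood of the strip $\{|\mathrm{Im}\, z|\le\delta\}$, with norm $\|D\|_\delta:=\sup_{|\mathrm{Im}\, z|\le\delta}\|D(z)\|$, where $\|\cdot\|$ is the usual matrix norm. $\beta$ is Diophantine if there exist $b(\beta)>0$ and $1<r(\beta)<\infty$ such that $|\sin(2\pi j\beta)|>\dfrac{b(\beta)}{|j|^{r(\beta)}}$ for all $j\in\mathbb{Z}\setminus\{0\}$. For $n\in\mathbb{N}$, the iterates are $D_n(x):=D(x+(n-1)\beta)\cdots D(x)$, similarly $\tilde D_n(x):=\tilde D(x+(n-1)\beta)\cdots\tilde D(x)$, and $L_n(\beta,D):=\frac1n\int_{\mathbb{T}}\log\|D_n(x)\|\,d\mu(x)$. *)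

theory Defs
  imports "HOL-Analysis.Analysis"
begin

definition diophantine :: "real \<Rightarrow> bool" where
  "diophantine \<beta> \<longleftrightarrow>
     (\<exists>b r. b > 0 \<and> r > 1 \<and>
        (\<forall>j::int. j \<noteq> 0 \<longrightarrow> \<bar>sin (2 * pi * of_int j * \<beta>)\<bar> > b / \<bar>of_int j\<bar> powr r))"

text \<open>
  The torus \<open>\<real>/\<int>\<close> with its Haar probability measure is represented by the fundamental
  domain \<open>[0,1)\<close> with Lebesgue measure; functions on the torus are \<open>1\<close>-periodic functions.
\<close>

definition torus_measure :: "real measure" where
  "torus_measure = restrict_space lborel {0..<1}"

definition strip :: "real \<Rightarrow> complex set" where
  "strip \<delta> = {z. \<bar>Im z\<bar> \<le> \<delta>}"

definition mnorm :: "complex^2^2 \<Rightarrow> real" where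
  "mnorm A = onorm ((*v) A)"

text \<open>
  An element of \<open>C\<^sub>\<delta>\<^sup>\<omega>(\<real>/\<int>, M\<^sub>2(\<complex>))\<close> is identified with its (unique) analytic extension to the
  closed strip; the values off the strip play no role. \<open>f analytic_on S\<close> means that \<open>f\<close> is
  holomorphic on a neighbourhood of \<open>S\<close>.
\<close>

definition analytic_cocycles :: "real \<Rightarrow> (complex \<Rightarrow> complex^2^2) set" where
  "analytic_cocycles \<delta> =
     {D. (\<forall>i j. (\<lambda>z. D z $ i $ j) analytic_on strip \<delta>) \<and>
         (\<forall>z\<in>strip \<delta>. D (z + 1) = D z)}"

definition strip_norm :: "real \<Rightarrow> (complex \<Rightarrow> complex^2^2) \<Rightarrow> real" where
  "strip_norm \<delta> D = (SUP z\<in>strip \<delta>. mnorm (D z))"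

text \<open>\<open>iterate \<beta> D n x = D(x + (n - 1)\<beta>) \<cdots> D(x + \<beta>) D(x)\<close>.\<close>

primrec iterate :: "real \<Rightarrow> (complex \<Rightarrow> complex^2^2) \<Rightarrow> nat \<Rightarrow> real \<Rightarrow> complex^2^2" where
  "iterate \<beta> D 0 x = mat 1"
| "iterate \<beta> D (Suc n) x = D (complex_of_real (x + real n * \<beta>)) ** iterate \<beta> D n x"

text \<open>
  In \<open>lyap\<close> the convention \<open>ln 0 = 0\<close> is harmless: the entries of \<open>iterate \<beta> D n\<close> are analytic, so
  unless the iterate vanishes identically it has only finitely many zeros in \<open>[0,1)\<close> and
  \<open>ln (mnorm (iterate \<beta> D n x))\<close> is integrable.
\<close>

definition lyap :: "nat \<Rightarrow> real \<Rightarrow> (complex \<Rightarrow> complex^2^2) \<Rightarrow> real" where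
  "lyap n \<beta> D = 1 / real n * (LINT x|torus_measure. ln (mnorm (iterate \<beta> D n x)))"

text \<open>
  Logarithm with \<open>log 0 = -\<infinity>\<close>, so that the points where an iterate vanishes belong to the
  deviation set.  In particular, if an iterate vanishes identically (where \<open>lyap\<close> would be a
  default value) the deviation set is the whole torus.
\<close>

definition elog :: "real \<Rightarrow> ereal" where
  "elog t = (if t > 0 then ereal (ln t) else -\<infinity>)"

definition deviation_set :: "real \<Rightarrow> (complex \<Rightarrow> complex^2^2) \<Rightarrow> nat \<Rightarrow> real \<Rightarrow> real set" where
  "deviation_set \<beta> D n \<kappa> =
     {x \<in> space torus_measure.
        \<bar>ereal (1 / real n) * elog (mnorm (iterate \<beta> D n x)) - ereal (lyap n \<beta> D)\<bar> > ereal \<kappa>}"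

end

theory Submission
  imports Defs "HOL-Complex_Analysis.Complex_Analysis" "HOL-Number_Theory.Cong" "HOL-Real_Asymp.Real_Asymp"
begin

text \<open>The requirement Q >= q^2 pays for the ends of intervals. On an interval of length about
  1/q the orbit of length Q reproduces the integral up to a bounded number of copies out of about
  Q/q, a relative error O(q/Q), and only if this is O(1/q) does it drop below \<kappa> for large q;
  a denominator of size q would leave an error of order 1. The bound Q <= q^a acts in the opposite
  direction: Q shifts must change u little, and Q exceptional sets must be small together. From n >
  q^(a+2) >= Q q^2 their bound contains exp(-c \<kappa> q^2), which absorbs every power of q; hence
  \<eta> = a + 2 and C = 1. As the determinant may vanish on the torus, lower bounds hold only off
  small sets, and all constants must be common to all perturbations. One tail bound for the sublevel
  sets of the determinant serves twice: it bounds the integral of the negative part of log |det|, so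
  that \<open>M - mean 0\<close> is O(n), and it controls the shifts. Cartan's estimate concerns
  holomorphic functions, so norms are replaced by products of holomorphic functions touching them at
  chosen points.\<close>

text \<open>
  Let \<open>A\<^sub>n\<close> be the iterates of a perturbation of \<open>D\<close>, let \<open>\<parallel>\<cdot>\<parallel>\<close> be the Frobenius norm and
  \<open>u(z) = log (\<parallel>A\<^sub>n(z)\<parallel>\<^sup>2 + \<epsilon>) / 2n\<close>, a continuous subharmonic function (\<open>\<epsilon>\<close> tends to \<open>0\<close> at the very end).
  Only the size of \<open>q\<close> matters: by Dirichlet's theorem and the Diophantine condition \<open>\<beta>\<close> has an
  approximant \<open>P/Q\<close> with \<open>q\<^sup>2 \<le> Q \<le> q\<^sup>a\<close>, where \<open>a\<close> depends on \<open>\<beta>\<close> only, and \<open>n\<close> may be assumed to exceed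
  \<open>q\<^bsup>a+2\<^esup>\<close>.

  Let \<open>F\<close> be the average of the \<open>Q\<close> shifts \<open>u(z + j\<beta>)\<close>. The orbit is equidistributed on scale \<open>1/Q\<close>, so the
  mean value inequality on discs of radius \<open>2/q\<close> and the convexity of the means over horizontal lines
  give \<open>F \<le> \<integral>u + O(1/q)\<close> for \<open>\<bar>Im z\<bar> \<le> 6/q\<close>, and each interval of length \<open>1/q\<close> contains a point with
  \<open>F \<ge> \<integral>u - O(1/q)\<close>. A Cartan estimate on that scale shows that \<open>F < \<integral>u - \<kappa>\<close> only on a set of measure
  \<open>O(e\<^bsup>-c\<kappa>q\<^esup>)\<close>.

  Finally \<open>u(x + j\<beta>)\<close> and \<open>u(x)\<close> differ by \<open>O(Q(s + 1)/n)\<close> for all \<open>j < Q\<close> unless a determinant of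
  modulus less than \<open>e\<^bsup>-s\<^esup>\<close> occurs along the orbit. By another Cartan estimate this has probability
  \<open>O(Q e\<^bsup>-cs\<^esup>)\<close>, and \<open>s = n\<kappa>/8Q\<close> is of order at least \<open>\<kappa>q\<^sup>2\<close>.
\<close>

section \<open>Averages along the orbit of a rotation\<close>

lemma periodic_of_int:
  fixes w :: "real \<Rightarrow> 'a"
  assumes "\<And>x. w (x + 1) = w x"
  shows "w (x + of_int k) = w x"
proof -
  have *: "w (x + of_nat n) = w x" for x n
    by (induction n) (use assms in \<open>auto simp: add.assoc[symmetric] add.commute[of 1]\<close>)
  show ?thesis
  proof (cases "k \<ge> 0")
    case True then show ?thesis using *[of x "nat k"] by simp
  next
    case False then show ?thesis using *[of "x + of_int k" "nat (-k)"] by simp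
  qed
qed

lemma unit_interval_cover:
  assumes "0 \<le> x" "x < 1" "m > 0"
  obtains i where "i < m" "real i / real m \<le> x" "x < real i / real m + 1 / real m"
proof
  define i where "i = nat \<lfloor>x * real m\<rfloor>"
  have "real i = of_int \<lfloor>x * real m\<rfloor>" using assms(1) by (simp add: i_def)
  then have i: "real i \<le> x * real m" "x * real m < real i + 1" by linarith+
  have "x * real m < 1 * real m" using assms by (intro mult_strict_right_mono) auto
  then show "i < m" using i by linarith
  show "real i / real m \<le> x" "x < real i / real m + 1 / real m" using i assms(3) by (auto simp: field_simps)
qed

lemma emeasure_UN_le:
  assumes S: "\<And>i. i < m \<Longrightarrow> S i \<in> sets M" and B: "\<And>i. i < m \<Longrightarrow> emeasure M (S i) \<le> ennreal B"
  shows "emeasure M (\<Union>i<m. S i) \<le> ennreal (real m * B)"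
proof -
  have "emeasure M (\<Union>i<m. S i) \<le> (\<Sum>i<m. emeasure M (S i))"
    by (rule emeasure_subadditive_finite) (use S in auto)
  also have "\<dots> \<le> (\<Sum>i<m. ennreal B)" by (intro sum_mono B) simp
  also have "\<dots> = ennreal (real m * B)"
    by (simp add: ennreal_of_nat_eq_real_of_nat ennreal_mult')
  finally show ?thesis .
qed

lemma measurable_compose_continuous:
  assumes "G \<in> borel_measurable borel" "continuous_on UNIV f"
  shows "(\<lambda>x. G (f x)) \<in> borel_measurable borel"
  by (rule measurable_compose[OF borel_measurable_continuous_onI[OF assms(2)] assms(1)])

lemma nn_integral_shift:
  fixes w :: "real \<Rightarrow> ennreal"
  assumes [measurable]: "w \<in> borel_measurable borel"
  shows "(\<integral>\<^sup>+x\<in>{a..<b}. w (x + c) \<partial>lborel) = (\<integral>\<^sup>+x\<in>{a+c..<b+c}. w x \<partial>lborel)"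
proof -
  have "(\<integral>\<^sup>+x\<in>{a+c..<b+c}. w x \<partial>lborel) = (\<integral>\<^sup>+x. w (c + 1 * x) * indicator {a+c..<b+c} (c + 1 * x) \<partial>lborel)"
    by (subst nn_integral_real_affine[where c=1 and t=c]) auto
  also have "\<dots> = (\<integral>\<^sup>+x\<in>{a..<b}. w (x + c) \<partial>lborel)"
    by (intro nn_integral_cong) (auto simp: indicator_def add.commute)
  finally show ?thesis by simp
qed

lemma nn_integral_split:
  fixes w :: "real \<Rightarrow> ennreal"
  assumes [measurable]: "w \<in> borel_measurable borel" and "a \<le> b" "b \<le> c"
  shows "(\<integral>\<^sup>+x\<in>{a..<c}. w x \<partial>lborel) = (\<integral>\<^sup>+x\<in>{a..<b}. w x \<partial>lborel) + (\<integral>\<^sup>+x\<in>{b..<c}. w x \<partial>lborel)"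
proof -
  have "{a..<c} = {a..<b} \<union> {b..<c}" using assms by auto
  then show ?thesis by (simp add: nn_integral_disjoint_pair)
qed

lemma nn_integral_blocks:
  fixes w :: "real \<Rightarrow> ennreal"
  assumes [measurable]: "w \<in> borel_measurable borel" and "p \<ge> 0"
  shows "(\<integral>\<^sup>+x\<in>{a..<a + real k * p}. w x \<partial>lborel) = (\<Sum>i<k. \<integral>\<^sup>+x\<in>{a..<a+p}. w (x + real i * p) \<partial>lborel)"
proof (induction k)
  case (Suc k)
  have "(\<integral>\<^sup>+x\<in>{a..<a + real (Suc k) * p}. w x \<partial>lborel) = (\<integral>\<^sup>+x\<in>{a..<a + real k * p}. w x \<partial>lborel) + (\<integral>\<^sup>+x\<in>{a + real k * p..<a + real (Suc k) * p}. w x \<partial>lborel)"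
    using assms by (intro nn_integral_split) (auto intro: mult_right_mono)
  also have "(\<integral>\<^sup>+x\<in>{a + real k * p..<a + real (Suc k) * p}. w x \<partial>lborel) = (\<integral>\<^sup>+x\<in>{a..<a+p}. w (x + real k * p) \<partial>lborel)"
    by (subst nn_integral_shift) (auto simp: algebra_simps)
  finally show ?case using Suc by simp
qed simp

lemma nn_integral_period:
  fixes w :: "real \<Rightarrow> ennreal"
  assumes [measurable]: "w \<in> borel_measurable borel" and per: "\<And>x. w (x + p) = w x" and p: "p > 0"
  shows "(\<integral>\<^sup>+x\<in>{a..<a+p}. w x \<partial>lborel) = (\<integral>\<^sup>+x\<in>{0..<p}. w x \<partial>lborel)"
proof -
  define k where "k = \<lfloor>a / p\<rfloor>"
  define r where "r = a - of_int k * p"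
  have "of_int k \<le> a/p" "a/p < of_int k + 1" unfolding k_def by linarith+
  then have "of_int k * p \<le> a" "a < (of_int k + 1) * p"
    using p by (simp_all add: pos_le_divide_eq pos_divide_less_eq)
  then have r: "0 \<le> r" "r < p" by (auto simp: r_def algebra_simps)
  have perk: "w (x + of_int k * p) = w x" for x
  proof -
    have "w ((x/p + of_int k) * p) = w (x/p * p)"
      by (rule periodic_of_int[of "\<lambda>y. w (y * p)"]) (simp add: distrib_right per)
    then show ?thesis using p by (simp add: distrib_right)
  qed
  have "(\<integral>\<^sup>+x\<in>{a..<a+p}. w x \<partial>lborel) = (\<integral>\<^sup>+x\<in>{r..<r+p}. w (x + of_int k * p) \<partial>lborel)"
    by (subst nn_integral_shift) (auto simp: r_def algebra_simps)
  also have "\<dots> = (\<integral>\<^sup>+x\<in>{r..<r+p}. w x \<partial>lborel)" by (simp add: perk)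
  also have "\<dots> = (\<integral>\<^sup>+x\<in>{r..<p}. w x \<partial>lborel) + (\<integral>\<^sup>+x\<in>{p..<r+p}. w x \<partial>lborel)"
    using r by (intro nn_integral_split) auto
  also have "(\<integral>\<^sup>+x\<in>{p..<r+p}. w x \<partial>lborel) = (\<integral>\<^sup>+x\<in>{0..<r}. w (x + p) \<partial>lborel)"
    by (subst nn_integral_shift) (auto simp: algebra_simps)
  also have "\<dots> = (\<integral>\<^sup>+x\<in>{0..<r}. w x \<partial>lborel)" by (simp add: per)
  also have "(\<integral>\<^sup>+x\<in>{r..<p}. w x \<partial>lborel) + (\<integral>\<^sup>+x\<in>{0..<r}. w x \<partial>lborel) = (\<integral>\<^sup>+x\<in>{0..<p}. w x \<partial>lborel)"
    using r by (subst add.commute, intro nn_integral_split[symmetric]) auto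
  finally show ?thesis .
qed

text \<open>Multiplication by \<open>P\<close> permutes the residues mod \<open>Q\<close>, and
  reducing mod \<open>Q\<close> costs integer translations, which \<open>w\<close> does not
  see.\<close>

lemma sum_periodic_coprime:
  fixes w :: "real \<Rightarrow> 'a::comm_monoid_add" and P :: int
  assumes per: "\<And>x. w (x + 1) = w x" and "coprime P (int Q)" "Q > 0"
  shows "(\<Sum>j<Q. w (x + real j * (of_int P / real Q))) = (\<Sum>j<Q. w (x + real j / real Q))"
proof -
  define f where "f j = nat ((int j * P) mod int Q)" for j
  have inj: "inj_on f {..<Q}"
  proof (rule inj_onI)
    fix i j assume "i \<in> {..<Q}" "j \<in> {..<Q}" "f i = f j"
    moreover have "0 \<le> (int i * P) mod int Q" "0 \<le> (int j * P) mod int Q" using assms(3) by auto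
    ultimately have "(int i * P) mod int Q = (int j * P) mod int Q"
      unfolding f_def by (metis nat_eq_iff2)
    then have "[int i * P = int j * P] (mod int Q)" by (simp add: cong_def)
    then have "[int i = int j] (mod int Q)" using assms(2) by (simp add: cong_mult_rcancel coprime_commute)
    then show "i = j" using \<open>i \<in> _\<close> \<open>j \<in> _\<close> by (auto simp: cong_def)
  qed
  have "f ` {..<Q} \<subseteq> {..<Q}" using assms(3) by (auto simp: f_def nat_less_iff)
  then have "bij_betw f {..<Q} {..<Q}" using inj by (simp add: bij_betw_def endo_inj_surj)
  then have "(\<Sum>j<Q. w (x + real j / real Q)) = (\<Sum>j<Q. w (x + real (f j) / real Q))"
    by (rule sum.reindex_bij_betw[symmetric])
  also have "\<dots> = (\<Sum>j<Q. w (x + real j * (of_int P / real Q)))"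
  proof (intro sum.cong refl)
    fix j
    have "real (f j) = of_int ((int j * P) mod int Q)" using assms(3) by (simp add: f_def)
    also have "\<dots> = of_int (int j * P - (int j * P) div int Q * int Q)" by (simp add: minus_div_mult_eq_mod)
    finally have "x + real (f j) / real Q = x + real j * (of_int P / real Q) + of_int (- ((int j * P) div int Q))"
      using assms(3) by (simp add: field_simps)
    then show "w (x + real (f j) / real Q) = w (x + real j * (of_int P / real Q))"
      using periodic_of_int[of w, OF per] by metis
  qed
  finally show ?thesis by simp
qed


text \<open>The comb sum has period 1/Q, and over one period its teeth sweep out [0,1) exactly once.
  Hence only the number \<open>k\<close> of periods counts, whatever \<open>a\<close> is.\<close>

lemma nn_integral_comb:
  fixes w :: "real \<Rightarrow> ennreal"
  assumes [measurable]: "w \<in> borel_measurable borel" and per: "\<And>x. w (x + 1) = w x" and Q: "Q > 0"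
  shows "(\<integral>\<^sup>+x\<in>{a..<a + real k / real Q}. (\<Sum>j<Q. w (x + real j / real Q)) \<partial>lborel)
    = of_nat k * (\<integral>\<^sup>+x\<in>{0..<1}. w x \<partial>lborel)"
proof -
  define W where "W x = (\<Sum>j<Q. w (x + real j / real Q))" for x
  have [measurable]: "W \<in> borel_measurable borel" unfolding W_def by measurable
  have perW: "W (x + 1 / real Q) = W x" for x
  proof -
    obtain m where m: "Q = Suc m" using Q by (cases Q) auto
    define f where "f j = w (x + real j / real Q)" for j
    have "W (x + 1 / real Q) = (\<Sum>j<Suc m. f (Suc j))"
      unfolding W_def f_def m by (intro sum.cong refl arg_cong[where f=w]) (simp add: add_divide_distrib)
    also have "\<dots> = (\<Sum>j<m. f (Suc j)) + f Q" by (simp add: m)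
    also have "f Q = f 0" using per[of x] Q by (simp add: f_def)
    also have "(\<Sum>j<m. f (Suc j)) + f 0 = (\<Sum>j<Suc m. f j)" by (subst sum.lessThan_Suc_shift) (simp add: add.commute)
    finally show ?thesis by (simp add: W_def f_def m)
  qed
  have perW': "W (x + real i * (1 / real Q)) = W x" for x i
  proof (induction i)
    case (Suc i)
    have "x + real (Suc i) * (1 / real Q) = (x + real i * (1 / real Q)) + 1 / real Q"
      by (simp add: add_divide_distrib)
    then show ?case using perW Suc by metis
  qed simp
  have "(\<integral>\<^sup>+x\<in>{0..<0 + 1 / real Q}. W x \<partial>lborel) = (\<Sum>j<Q. \<integral>\<^sup>+x\<in>{0..<0 + 1/real Q}. w (x + real j * (1 / real Q)) \<partial>lborel)"
    unfolding W_def by (subst nn_integral_sum[symmetric]) (auto simp: sum_distrib_right)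
  also have "\<dots> = (\<integral>\<^sup>+x\<in>{0..<0 + real Q * (1 / real Q)}. w x \<partial>lborel)"
    by (rule nn_integral_blocks[symmetric]) auto
  finally have W1: "(\<integral>\<^sup>+x\<in>{0..<1 / real Q}. W x \<partial>lborel) = (\<integral>\<^sup>+x\<in>{0..<1}. w x \<partial>lborel)" using Q by simp
  have "(\<integral>\<^sup>+x\<in>{a..<a + real k * (1 / real Q)}. W x \<partial>lborel) = (\<Sum>i<k. \<integral>\<^sup>+x\<in>{a..<a + 1 / real Q}. W (x + real i * (1 / real Q)) \<partial>lborel)"
    by (rule nn_integral_blocks) auto
  also have "\<dots> = of_nat k * (\<integral>\<^sup>+x\<in>{a..<a + 1 / real Q}. W x \<partial>lborel)"
    unfolding perW' by simp
  also have "(\<integral>\<^sup>+x\<in>{a..<a + 1 / real Q}. W x \<partial>lborel) = (\<integral>\<^sup>+x\<in>{0..<1 / real Q}. W x \<partial>lborel)"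
    by (rule nn_integral_period) (use perW Q in auto)
  finally show ?thesis using W1 by (simp add: W_def)
qed

section \<open>Equidistribution of the orbit on intervals\<close>

context
  fixes w :: "real \<Rightarrow> ennreal" and P :: int and Q :: nat and \<beta> :: real
  assumes w[measurable]: "w \<in> borel_measurable borel" and per: "\<And>x. w (x + 1) = w x"
    and Q: "Q > 0" and cop: "coprime P (int Q)" and approx: "\<bar>\<beta> - of_int P / real Q\<bar> \<le> 1 / (real Q)\<^sup>2"
begin

text \<open>Fewer than Q steps, each with an error of at most 1/Q^2. The resulting distance 1/Q to
  the rational orbit is the margin at each end of an interval, whence the 2 in the hypotheses of the
  two orbit integral lemmas.\<close>

lemma shift_error:
  assumes "j < Q"
  shows "\<bar>real j * \<beta> - real j * (of_int P / real Q)\<bar> \<le> 1 / real Q"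
proof -
  have "\<bar>real j * \<beta> - real j * (of_int P / real Q)\<bar> = real j * \<bar>\<beta> - of_int P / real Q\<bar>"
    by (simp only: right_diff_distrib[symmetric] abs_mult abs_of_nat)
  also have "\<dots> \<le> real Q * (1 / (real Q)\<^sup>2)" using assms by (intro mult_mono approx) auto
  also have "\<dots> = 1 / real Q" by (simp add: power2_eq_square)
  finally show ?thesis .
qed

lemma comb_rational:
  "(\<Sum>j<Q. \<integral>\<^sup>+x\<in>{a..<a + real k / real Q}. w (x + real j * (of_int P / real Q)) \<partial>lborel)
    = of_nat k * (\<integral>\<^sup>+x\<in>{0..<1}. w x \<partial>lborel)"
proof -
  have "(\<Sum>j<Q. \<integral>\<^sup>+x\<in>{a..<a + real k / real Q}. w (x + real j * (of_int P / real Q)) \<partial>lborel)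
    = (\<integral>\<^sup>+x\<in>{a..<a + real k / real Q}. (\<Sum>j<Q. w (x + real j * (of_int P / real Q))) \<partial>lborel)"
    by (subst nn_integral_sum[symmetric]) (auto simp: sum_distrib_right)
  also have "\<dots> = (\<integral>\<^sup>+x\<in>{a..<a + real k / real Q}. (\<Sum>j<Q. w (x + real j / real Q)) \<partial>lborel)"
    by (simp only: sum_periodic_coprime[of w, OF per cop Q])
  finally show ?thesis using nn_integral_comb[OF w per Q] by simp
qed

text \<open>Since \<open>w\<close> is nonnegative, its integral grows with the interval: a rational
  window pulled in by 1/Q at both ends stays inside every true window. For the companion upper bound
  the window is pushed out instead.\<close>

lemma orbit_integral_ge:
  assumes "real k \<le> (b - a) * real Q - 2"
  shows "of_nat k * (\<integral>\<^sup>+x\<in>{0..<1}. w x \<partial>lborel) \<le> (\<Sum>j<Q. \<integral>\<^sup>+x\<in>{a..<b}. w (x + real j * \<beta>) \<partial>lborel)"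
  unfolding comb_rational[of "a + 1 / real Q" k, symmetric]
proof (intro sum_mono)
  fix j assume "j \<in> {..<Q}"
  then have e: "\<bar>real j * \<beta> - real j * (of_int P / real Q)\<bar> \<le> 1 / real Q" using shift_error by auto
  have "real k / real Q + 2 / real Q \<le> b - a" using assms Q by (simp add: field_simps)
  then have sub: "{a + 1 / real Q + real j * (of_int P / real Q)..<a + 1 / real Q + real k / real Q + real j * (of_int P / real Q)}
     \<subseteq> {a + real j * \<beta>..<b + real j * \<beta>}"
    using e by (auto simp: abs_le_iff)
  show "(\<integral>\<^sup>+x\<in>{a + 1 / real Q..<a + 1 / real Q + real k / real Q}. w (x + real j * (of_int P / real Q)) \<partial>lborel)
    \<le> (\<integral>\<^sup>+x\<in>{a..<b}. w (x + real j * \<beta>) \<partial>lborel)"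
    unfolding nn_integral_shift[OF w] using sub 
    by (intro nn_integral_mono mult_left_mono) (auto simp: indicator_def)
qed

lemma orbit_integral_le:
  assumes "(b - a) * real Q + 2 \<le> real k"
  shows "(\<Sum>j<Q. \<integral>\<^sup>+x\<in>{a..<b}. w (x + real j * \<beta>) \<partial>lborel) \<le> of_nat k * (\<integral>\<^sup>+x\<in>{0..<1}. w x \<partial>lborel)"
  unfolding comb_rational[of "a - 1 / real Q" k, symmetric]
proof (intro sum_mono)
  fix j assume "j \<in> {..<Q}"
  then have e: "\<bar>real j * \<beta> - real j * (of_int P / real Q)\<bar> \<le> 1 / real Q" using shift_error by auto
  have "real k / real Q - 2 / real Q \<ge> b - a" using assms Q by (simp add: field_simps)
  then have sub: "{a + real j * \<beta>..<b + real j * \<beta>} \<subseteq> {a - 1 / real Q + real j * (of_int P / real Q)..<a - 1 / real Q + real k / real Q + real j * (of_int P / real Q)}"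
    using e by (auto simp: abs_le_iff)
  show "(\<integral>\<^sup>+x\<in>{a..<b}. w (x + real j * \<beta>) \<partial>lborel) \<le>
    (\<integral>\<^sup>+x\<in>{a - 1 / real Q..<a - 1 / real Q + real k / real Q}. w (x + real j * (of_int P / real Q)) \<partial>lborel)"
    unfolding nn_integral_shift[OF w] using sub 
    by (intro nn_integral_mono mult_left_mono) (auto simp: indicator_def)
qed

end

section \<open>Uniform Riemann sums and the maximum principle on a strip\<close>

lemma periodic_integral:
  fixes \<phi> :: "real \<Rightarrow> real"
  assumes cont: "continuous_on UNIV \<phi>" and per: "\<And>x. \<phi> (x + 1) = \<phi> x" and x: "x \<ge> 0"
  shows "integral {x..x+1} \<phi> = integral {0..1} \<phi>"
proof -
  have int: "\<phi> integrable_on {a..b}" for a b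
    using cont by (intro integrable_continuous_real) (auto intro: continuous_on_subset)
  have "integral {0..x} (\<phi> \<circ> (\<lambda>x. x + 1)) = integral {0+1..x+1} \<phi>"
    by (rule integral_shift) (auto intro: continuous_on_subset[OF cont])
  then have 1: "integral {1..x+1} \<phi> = integral {0..x} \<phi>" by (simp add: o_def per)
  have "integral {0..1} \<phi> + integral {1..x+1} \<phi> = integral {0..x+1} \<phi>"
    using x int by (intro Henstock_Kurzweil_Integration.integral_combine) auto
  moreover have "integral {0..x} \<phi> + integral {x..x+1} \<phi> = integral {0..x+1} \<phi>"
    using x int by (intro Henstock_Kurzweil_Integration.integral_combine) auto
  ultimately show ?thesis using 1 by linarith
qed

text \<open>Uniformity in the starting point \<open>x\<close> is the purpose: the sums arise as
  logarithms of products of rotated or shifted functions that have to be bounded at every point of a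
  circle or a line.\<close>

lemma riemann_sums_uniform:
  fixes \<phi> :: "real \<Rightarrow> real"
  assumes cont: "continuous_on UNIV \<phi>" and per: "\<And>x. \<phi> (x + 1) = \<phi> x" and e: "e > 0"
  obtains n0 where "n0 > 0" "\<And>n x. n \<ge> n0 \<Longrightarrow> \<bar>(\<Sum>k<n. \<phi> (x + real k / real n)) - real n * integral {0..1} \<phi>\<bar> \<le> real n * e"
proof -
  have "uniformly_continuous_on {0..3} \<phi>"
    by (intro compact_uniformly_continuous continuous_on_subset[OF cont]) auto
  then obtain d where d: "d > 0" "\<And>x y. x \<in> {0..3} \<Longrightarrow> y \<in> {0..3} \<Longrightarrow> dist y x < d \<Longrightarrow> dist (\<phi> y) (\<phi> x) < e"
    using e unfolding uniformly_continuous_on_def by blast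
  obtain n0 where n0: "n0 > 0" "1 / real n0 < d"
    using d(1) reals_Archimedean[of d] by (metis inverse_eq_divide zero_less_Suc)
  have int: "\<phi> integrable_on {a..b}" for a b
    using cont by (intro integrable_continuous_real) (auto intro: continuous_on_subset)
  have *: "\<bar>(\<Sum>k<n. \<phi> (x + real k / real n)) - real n * integral {0..1} \<phi>\<bar> \<le> real n * e" 
    if x: "0 \<le> x" "x < 1" and nn0: "n \<ge> n0" for x n
  proof -
    have "1 / real n \<le> 1 / real n0" using nn0 n0 by (intro divide_left_mono) auto
    then have n: "n > 0" "1 / real n < d" using n0 nn0 by linarith+
    have split: "integral {x..x + real m / real n} \<phi> = (\<Sum>k<m. integral {x + real k / real n..x + real (Suc k) / real n} \<phi>)" for m
    proof (induction m)
      case (Suc m)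
      have "integral {x..x + real (Suc m) / real n} \<phi> = integral {x..x + real m / real n} \<phi> + integral {x + real m / real n..x + real (Suc m) / real n} \<phi>"
        using int by (intro Henstock_Kurzweil_Integration.integral_combine[symmetric]) (auto simp: divide_right_mono)
      then show ?case using Suc by simp
    qed simp
    have piece: "\<bar>\<phi> (x + real k / real n) - real n * integral {x + real k / real n..x + real (Suc k) / real n} \<phi>\<bar> \<le> e" if "k < n" for k
    proof -
      define a b where "a = x + real k / real n" and "b = x + real (Suc k) / real n"
      have ab: "b - a = 1 / real n" by (simp add: a_def b_def add_divide_distrib)
      have "real (Suc k) / real n \<le> 1" using that n by simp
      then have ab': "0 \<le> a" "a \<le> b" "b \<le> 3" using x n ab unfolding b_def by (auto simp: a_def add_divide_distrib)
      have "norm (integral {a..b} (\<lambda>t. \<phi> t - \<phi> a)) \<le> e * (b - a)"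
      proof (rule integral_bound)
        show "continuous_on {a..b} (\<lambda>t. \<phi> t - \<phi> a)"
          by (intro continuous_intros continuous_on_subset[OF cont]) auto
        fix t assume "t \<in> {a..b}"
        then have "dist (\<phi> t) (\<phi> a) < e"
          using ab ab' n by (intro d(2)) (auto simp: dist_real_def)
        then show "norm (\<phi> t - \<phi> a) \<le> e" by (simp add: dist_real_def)
      qed (use ab' in auto)
      moreover have "integral {a..b} (\<lambda>t. \<phi> t - \<phi> a) = integral {a..b} \<phi> - (b - a) * \<phi> a"
        using ab' int by (subst integral_diff) auto
      ultimately have "\<bar>integral {a..b} \<phi> - \<phi> a / real n\<bar> \<le> e / real n" by (simp add: ab)
      then have "real n * \<bar>integral {a..b} \<phi> - \<phi> a / real n\<bar> \<le> real n * (e / real n)"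
        by (intro mult_left_mono) auto
      moreover have "real n * \<bar>integral {a..b} \<phi> - \<phi> a / real n\<bar> = \<bar>real n * integral {a..b} \<phi> - \<phi> a\<bar>"
        using n by (subst abs_of_nat[symmetric], subst abs_mult[symmetric]) (simp add: right_diff_distrib)
      ultimately show ?thesis using n unfolding a_def b_def by (simp add: abs_minus_commute)
    qed
    have "integral {0..1} \<phi> = integral {x..x + real n / real n} \<phi>"
      using periodic_integral[OF cont per x(1)] n by simp
    also have "\<dots> = (\<Sum>k<n. integral {x + real k / real n..x + real (Suc k) / real n} \<phi>)" by (rule split)
    finally have I: "integral {0..1} \<phi> = \<dots>" .
    have "\<bar>(\<Sum>k<n. \<phi> (x + real k / real n)) - real n * integral {0..1} \<phi>\<bar>
      = \<bar>\<Sum>k<n. \<phi> (x + real k / real n) - real n * integral {x + real k / real n..x + real (Suc k) / real n} \<phi>\<bar>"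
      unfolding I by (simp add: sum_subtractf sum_distrib_left)
    also have "\<dots> \<le> (\<Sum>k<n. e)" using piece by (intro order.trans[OF sum_abs] sum_mono) auto
    finally show ?thesis by simp
  qed
  show ?thesis
  proof (rule that[OF n0(1)])
    fix x :: real and n assume "n \<ge> n0"
    have "\<phi> (x + t) = \<phi> (frac x + t)" for t
      using periodic_of_int[of \<phi>, OF per, of "frac x + t" "\<lfloor>x\<rfloor>"] by (simp add: frac_def)
    then show "\<bar>(\<Sum>k<n. \<phi> (x + real k / real n)) - real n * integral {0..1} \<phi>\<bar> \<le> real n * e"
      using *[of "frac x" n] \<open>n \<ge> n0\<close> by (simp add: frac_lt_1)
  qed
qed

section \<open>Open strips and the maximum principle\<close>

definition ostrip :: "real \<Rightarrow> complex set" where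
  "ostrip \<delta> = {z. \<bar>Im z\<bar> < \<delta>}"

lemma ostrip_eq: "ostrip \<delta> = {z. Im z < \<delta>} \<inter> {z. Im z > - \<delta>}"
  by (auto simp: ostrip_def)

lemma open_ostrip: "open (ostrip \<delta>)"
  unfolding ostrip_eq by (intro open_Int open_halfspace_Im_lt open_halfspace_Im_gt)

lemma convex_ostrip: "convex (ostrip \<delta>)"
  unfolding ostrip_eq by (intro convex_Int convex_halfspace_Im_lt convex_halfspace_Im_gt)

text \<open>Periodicity reduces the unbounded strip to a compact rectangle, so no growth condition
  enters. A maximum in the interior makes \<open>f\<close> constant up to the boundary. Only the
  modulus is assumed periodic, which admits exponential factors in z.\<close>

lemma strip_maximum_principle:
  fixes f :: "complex \<Rightarrow> complex"
  assumes hol: "f holomorphic_on S" and S: "open S" "{z. 0 \<le> Im z \<and> Im z \<le> T} \<subseteq> S"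
    and per: "\<And>z. 0 \<le> Im z \<Longrightarrow> Im z \<le> T \<Longrightarrow> norm (f (z + 1)) = norm (f z)"
    and bdry: "\<And>z. Im z = 0 \<or> Im z = T \<Longrightarrow> norm (f z) \<le> B"
    and z: "0 \<le> Im z" "Im z \<le> T"
  shows "norm (f z) \<le> B"
proof -
  define K where "K = cbox 0 (Complex 1 T)"
  have Kmem: "w \<in> K \<longleftrightarrow> 0 \<le> Re w \<and> Re w \<le> 1 \<and> 0 \<le> Im w \<and> Im w \<le> T" for w
    by (simp add: K_def in_cbox_complex_iff)
  have contf: "continuous_on S f" using hol by (rule holomorphic_on_imp_continuous_on)
  have "continuous_on K (\<lambda>w. norm (f w))"
    by (intro continuous_intros continuous_on_subset[OF contf]) (use S Kmem in auto)
  moreover have "compact K" "K \<noteq> {}" using z Kmem[of 0] by (auto simp: K_def)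
  ultimately obtain \<xi> where \<xi>: "\<xi> \<in> K" "\<And>w. w \<in> K \<Longrightarrow> norm (f w) \<le> norm (f \<xi>)"
    using continuous_attains_sup[of K "\<lambda>w. norm (f w)"] by blast
  have all: "norm (f w) \<le> norm (f \<xi>)" if w: "0 \<le> Im w" "Im w \<le> T" for w
  proof -
    have "norm (f (Complex (x + 1) (Im w))) = norm (f (Complex x (Im w)))" for x
      using per[of "Complex x (Im w)"] w by (simp add: Complex_eq algebra_simps)
    from periodic_of_int[of "\<lambda>x. norm (f (Complex x (Im w)))", OF this, of "frac (Re w)" "\<lfloor>Re w\<rfloor>"]
    have "norm (f w) = norm (f (Complex (frac (Re w)) (Im w)))"
      by (simp add: frac_def)
    also have "\<dots> \<le> norm (f \<xi>)" using w by (intro \<xi>(2)) (auto simp: Kmem less_imp_le[OF frac_lt_1])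
    finally show ?thesis .
  qed
  have "norm (f \<xi>) \<le> B"
  proof (cases "Im \<xi> = 0 \<or> Im \<xi> = T")
    case True then show ?thesis by (rule bdry)
  next
    case False
    define U where "U = {w. 0 < Im w} \<inter> {w. Im w < T}"
    have U: "open U" "convex U"
      unfolding U_def by (auto intro!: open_Int open_halfspace_Im_lt open_halfspace_Im_gt convex_Int convex_halfspace_Im_lt convex_halfspace_Im_gt)
    have \<xi>U: "\<xi> \<in> U" using False \<xi>(1) by (auto simp: U_def Kmem)
    have "f constant_on U"
    proof (rule maximum_modulus_principle[of f U U \<xi>])
      show "f holomorphic_on U" using hol S by (rule_tac holomorphic_on_subset) (auto simp: U_def)
    qed (use U \<xi>U all in \<open>auto simp: U_def convex_connected\<close>)
    have cl: "closure U \<subseteq> {w. 0 \<le> Im w} \<inter> {w. Im w \<le> T}"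
      by (rule closure_minimal) (auto simp: U_def intro!: closed_Int closed_halfspace_Im_le closed_halfspace_Im_ge)
    have "f constant_on closure U"
      by (rule constant_on_closureI[OF \<open>f constant_on U\<close>]) (use contf cl S in \<open>auto intro: continuous_on_subset\<close>)
    moreover have "of_real (Re \<xi>) \<in> closure U"
    proof (rule closure_approachable[THEN iffD2], intro allI impI)
      fix e :: real assume "e > 0"
      then show "\<exists>y\<in>U. dist y (of_real (Re \<xi>)) < e"
        using \<xi>U by (intro bexI[of _ "Complex (Re \<xi>) (min (e/2) (Im \<xi>))"])
          (auto simp: U_def dist_norm cmod_def min_def)
    qed
    moreover have "\<xi> \<in> closure U" using \<xi>U closure_subset by blast
    ultimately have "f \<xi> = f (of_real (Re \<xi>))" unfolding constant_on_def by metis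
    then show ?thesis using bdry[of "of_real (Re \<xi>)"] by simp
  qed
  then show ?thesis using all[OF z] by linarith
qed

section \<open>Norms of holomorphic vectors\<close>

text \<open>A norm of a vector of holomorphic functions has the touching property \<open>touch\<close>: pair the
  vector with its own direction at \<open>z\<^sub>0\<close>. It is all that is used of \<open>ln N\<close> being subharmonic.\<close>

locale peaked =
  fixes \<delta> :: real and N :: "complex \<Rightarrow> real"
  assumes delta_pos: "\<delta> > 0"
    and cont: "continuous_on (ostrip \<delta>) N"
    and pos: "\<And>z. z \<in> ostrip \<delta> \<Longrightarrow> N z > 0"
    and per: "\<And>z. z \<in> ostrip \<delta> \<Longrightarrow> N (z + 1) = N z"
    and touch: "\<And>z0. z0 \<in> ostrip \<delta> \<Longrightarrow> \<exists>f. f holomorphic_on ostrip \<delta> \<and>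
       (\<forall>z\<in>ostrip \<delta>. f (z + 1) = f z) \<and> (\<forall>z\<in>ostrip \<delta>. norm (f z) \<le> N z) \<and> norm (f z0) = N z0"
begin

lemma cont_ln: "continuous_on (ostrip \<delta>) (\<lambda>z. ln (N z))"
  using cont pos by (intro continuous_intros) force+

lemma strip_add_real [simp]: "z + of_real x \<in> ostrip \<delta> \<longleftrightarrow> z \<in> ostrip \<delta>"
  by (simp add: ostrip_def)

text \<open>The maximum principle for the product of the rotated functions \<open>f (z + w \<omega>\<^sup>k)\<close> bounds \<open>f z\<close> by a
  Riemann sum of \<open>ln N\<close> on the circle; the zeros of \<open>f\<close> on the circle do no harm.\<close>

lemma ln_le_circle_mean:
  assumes sub: "cball z (norm \<zeta>) \<subseteq> ostrip \<delta>"
  shows "ln (N z) \<le> integral {0..1} (\<lambda>\<theta>. ln (N (z + \<zeta> * cis (2 * pi * \<theta>))))"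
proof -
  define \<phi> where "\<phi> \<theta> = ln (N (z + \<zeta> * cis (2 * pi * \<theta>)))" for \<theta>
  have mem: "z + \<zeta> * cis t \<in> ostrip \<delta>" for t
    using sub by (auto simp: dist_norm norm_mult)
  have zin: "z \<in> ostrip \<delta>" using sub by auto
  have "continuous_on UNIV \<phi>" unfolding \<phi>_def
    by (rule continuous_on_compose2[OF cont_ln]) (auto intro!: continuous_intros mem)
  moreover have "\<phi> (x + 1) = \<phi> x" for x
    by (simp add: \<phi>_def distrib_left cis_mult[symmetric])
  ultimately have riem: "\<And>e. e > 0 \<Longrightarrow> \<exists>n>0. \<forall>x. \<bar>(\<Sum>k<n. \<phi> (x + real k / real n)) - real n * integral {0..1} \<phi>\<bar> \<le> real n * e"
    using riemann_sums_uniform by (metis order_refl)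
  show ?thesis
  proof (cases "\<zeta> = 0")
    case True then show ?thesis by simp
  next
    case nz: False
    have "ln (N z) \<le> integral {0..1} \<phi>"
    proof (rule field_le_epsilon)
      fix e :: real assume "e > 0"
      then obtain n where n: "n > 0" and
        rs: "\<And>x. \<bar>(\<Sum>k<n. \<phi> (x + real k / real n)) - real n * integral {0..1} \<phi>\<bar> \<le> real n * e"
        using riem by blast
      obtain f where f: "f holomorphic_on ostrip \<delta>" "\<And>z. z \<in> ostrip \<delta> \<Longrightarrow> norm (f z) \<le> N z" "norm (f z) = N z"
        using touch[OF zin] by blast
      define H where "H w = (\<Prod>k<n. f (z + w * cis (2 * pi * (real k / real n))))" for w
      have memw: "z + w * cis t \<in> ostrip \<delta>" if "w \<in> cball 0 (norm \<zeta>)" for w t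
        using sub that by (auto simp: dist_norm norm_mult)
      have Hhol: "H holomorphic_on ball 0 (norm \<zeta>)"
        unfolding H_def by (intro holomorphic_intros holomorphic_on_compose_gen[OF _ f(1), unfolded o_def])
          (use memw in auto)
      have Hcont: "continuous_on (cball 0 (norm \<zeta>)) H"
        unfolding H_def using memw
        by (intro continuous_on_prod continuous_on_compose2[OF holomorphic_on_imp_continuous_on[OF f(1)]] continuous_intros) auto
      have "norm (H 0) \<le> exp (real n * (integral {0..1} \<phi> + e))"
      proof (rule maximum_modulus_frontier[where f=H and S="cball 0 (norm \<zeta>)"])
        fix w :: complex assume "w \<in> frontier (cball 0 (norm \<zeta>))"
        then have w: "norm w = norm \<zeta>" using nz by (simp add: frontier_cball)
        then have "norm (w / \<zeta>) = 1" using nz by (simp add: norm_divide)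
        then have "w / \<zeta> = cis (Arg (w / \<zeta>))"
          by (metis complex_norm_eq_1_exp_eq cis_conv_exp)
        then obtain \<theta> where th: "w = \<zeta> * cis (2 * pi * \<theta>)"
          using nz by (metis nonzero_divide_eq_eq mult.commute nonzero_mult_div_cancel_left pi_neq_zero times_divide_eq_right zero_neq_numeral mult_eq_0_iff)
        have "norm (H w) \<le> (\<Prod>k<n. N (z + w * cis (2 * pi * (real k / real n))))"
          unfolding H_def prod_norm[symmetric] by (intro prod_mono) (use memw w f(2) in auto)
        also have "\<dots> = (\<Prod>k<n. exp (\<phi> (\<theta> + real k / real n)))"
        proof (intro prod.cong refl)
          fix k
          have "w * cis (2 * pi * (real k / real n)) = \<zeta> * cis (2 * pi * (\<theta> + real k / real n))"
            by (simp add: th cis_mult distrib_left mult.assoc)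
          then show "N (z + w * cis (2 * pi * (real k / real n))) = exp (\<phi> (\<theta> + real k / real n))"
            unfolding \<phi>_def using pos[OF mem] by simp
        qed
        also have "\<dots> = exp (\<Sum>k<n. \<phi> (\<theta> + real k / real n))" by (simp add: exp_sum)
        also have "\<dots> \<le> exp (real n * (integral {0..1} \<phi> + e))"
          using rs[of \<theta>] by (simp add: abs_le_iff algebra_simps)
        finally show "norm (H w) \<le> exp (real n * (integral {0..1} \<phi> + e))" .
      qed (use Hhol Hcont in auto)
      moreover have "norm (H 0) = exp (real n * ln (N z))"
        using f(3) pos[OF zin] by (simp add: H_def norm_power exp_of_nat_mult)
      ultimately show "ln (N z) \<le> integral {0..1} \<phi> + e" using n by simp
    qed
    then show ?thesis by (simp add: \<phi>_def[abs_def])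
  qed
qed

definition mean :: "real \<Rightarrow> real" where
  "mean t = integral {0..1} (\<lambda>x. ln (N (Complex x t)))"

lemma line_cont:
  assumes "\<bar>t\<bar> < \<delta>"
  shows "continuous_on UNIV (\<lambda>x. ln (N (Complex x t)))"
  by (rule continuous_on_compose2[OF cont_ln])
     (use assms in \<open>auto intro!: continuous_intros simp: ostrip_def Complex_eq\<close>)

lemma line_per:
  assumes "\<bar>t\<bar> < \<delta>"
  shows "ln (N (Complex (x + 1) t)) = ln (N (Complex x t))"
  using per[of "Complex x t"] assms by (simp add: ostrip_def Complex_eq algebra_simps)

lemma riemann:
  assumes "\<bar>t\<bar> < \<delta>" "e > 0"
  obtains n0 where "n0 > 0" "\<And>n x. n \<ge> n0 \<Longrightarrow> \<bar>(\<Sum>k<n. ln (N (Complex (x + real k / real n) t))) - real n * mean t\<bar> \<le> real n * e"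
  using riemann_sums_uniform[OF line_cont line_per, OF assms(1) assms(1,2)] unfolding mean_def by metis

text \<open>Hadamard's three lines theorem for the product of touching functions at the points \<open>z + k/n\<close>,
  whose logarithm on each line is a Riemann sum.\<close>

lemma mean_le_upper:
  assumes T: "0 < T" "T < \<delta>" and M: "\<And>z. z \<in> ostrip \<delta> \<Longrightarrow> ln (N z) \<le> M" and t: "0 \<le> t" "t \<le> T"
  shows "mean t \<le> mean 0 + t / T * (M - mean 0)"
proof (rule field_le_epsilon)
  fix e0 :: real assume "e0 > 0"
  define e where "e = e0 / 2"
  have e: "e > 0" using \<open>e0 > 0\<close> by (simp add: e_def)
  have strip: "z \<in> ostrip \<delta>" if "0 \<le> Im z" "Im z \<le> T" for z using that T by (auto simp: ostrip_def)
  obtain n1 where n1: "n1 > 0" "\<And>n x. n \<ge> n1 \<Longrightarrow> \<bar>(\<Sum>k<n. ln (N (Complex (x + real k / real n) t))) - real n * mean t\<bar> \<le> real n * e"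
    using riemann[of t e] t T e by auto
  obtain n2 where n2: "n2 > 0" "\<And>n x. n \<ge> n2 \<Longrightarrow> \<bar>(\<Sum>k<n. ln (N (Complex (x + real k / real n) 0))) - real n * mean 0\<bar> \<le> real n * e"
    using riemann[of 0 e] T e by auto
  define n where "n = max n1 n2"
  have n: "n \<ge> n1" "n \<ge> n2" "n > 0" using n1 by (auto simp: n_def)
  define z where "z k = Complex (real k / real n) t" for k
  have zin: "z k \<in> ostrip \<delta>" for k using t T by (auto simp: z_def ostrip_def)
  obtain f where f: "\<And>k. f k holomorphic_on ostrip \<delta>" "\<And>k w. w \<in> ostrip \<delta> \<Longrightarrow> f k (w + 1) = f k w"
    "\<And>k w. w \<in> ostrip \<delta> \<Longrightarrow> norm (f k w) \<le> N w" "\<And>k. norm (f k (z k)) = N (z k)"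
    using touch[OF zin] by metis
  \<comment> \<open>The slope turns the trivial bound \<open>real n * M\<close> on the line at
    height \<open>T\<close> into \<open>real n * (mean 0 + e)\<close>, the bound that the Riemann
    sum gives on the real line.\<close>
  define a where "a = real n * (M - mean 0 - e) / T"
  define H where "H w = exp (\<i> * of_real a * w) * (\<Prod>k<n. f k (w + of_real (real k / real n)))" for w
  have nH: "norm (H w) = exp (- a * Im w) * (\<Prod>k<n. norm (f k (w + of_real (real k / real n))))" for w
    by (simp add: H_def norm_mult prod_norm)
  have le: "norm (H w) \<le> exp (- a * Im w + (\<Sum>k<n. ln (N (w + of_real (real k / real n)))))" if "w \<in> ostrip \<delta>" for w
  proof -
    have "norm (H w) \<le> exp (- a * Im w) * (\<Prod>k<n. N (w + of_real (real k / real n)))"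
      unfolding nH using f(3) that by (intro mult_left_mono prod_mono) (auto simp del: of_real_divide)
    also have "(\<Prod>k<n. N (w + of_real (real k / real n))) = (\<Prod>k<n. exp (ln (N (w + of_real (real k / real n)))))"
      using pos that by (intro prod.cong refl) (simp del: of_real_divide)
    finally show ?thesis by (simp only: exp_add exp_sum[OF finite_lessThan])
  qed
  have "norm (H (Complex 0 t)) \<le> exp (real n * (mean 0 + e))"
  proof (rule strip_maximum_principle[of H "ostrip \<delta>" T])
    show "H holomorphic_on ostrip \<delta>"
      unfolding H_def
      by (intro holomorphic_intros holomorphic_on_compose_gen[OF _ f(1), unfolded o_def]) (auto simp del: of_real_divide)
    show "norm (H (w + 1)) = norm (H w)" if "0 \<le> Im w" "Im w \<le> T" for w
    proof -
      have "f k (w + 1 + of_real (real k / real n)) = f k (w + of_real (real k / real n))" for k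
        using f(2)[of "w + of_real (real k / real n)" k] strip[OF that] by (simp add: algebra_simps del: of_real_divide)
      then show ?thesis unfolding nH by (simp del: of_real_divide)
    qed
    fix w assume w: "Im w = 0 \<or> Im w = T"
    then have win: "w \<in> ostrip \<delta>" using T by (auto simp: ostrip_def)
    show "norm (H w) \<le> exp (real n * (mean 0 + e))"
    proof (cases "Im w = 0")
      case True
      then have eq: "w + of_real (real k / real n) = Complex (Re w + real k / real n) 0" for k by (simp add: complex_eq_iff)
      have "(\<Sum>k<n. ln (N (w + of_real (real k / real n)))) \<le> real n * (mean 0 + e)"
        using n2(2)[OF n(2), of "Re w"] unfolding eq by (simp add: abs_le_iff algebra_simps)
      then show ?thesis using True by (intro order.trans[OF le[OF win]]) (simp del: of_real_divide)
    next
      case False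
      then have "Im w = T" using w by simp
      have "(\<Sum>k<n. ln (N (w + of_real (real k / real n)))) \<le> (\<Sum>k<n. M)"
        using win by (intro sum_mono M) (simp del: of_real_divide)
      then have "- a * Im w + (\<Sum>k<n. ln (N (w + of_real (real k / real n)))) \<le> - (a * T) + real n * M"
        using \<open>Im w = T\<close> by simp
      also have "a * T = real n * (M - mean 0 - e)" using T by (simp add: a_def)
      also have "- \<dots> + real n * M = real n * (mean 0 + e)" by (simp add: algebra_simps)
      finally show ?thesis by (intro order.trans[OF le[OF win]]) (simp del: of_real_divide)
    qed
  qed (use open_ostrip strip t in auto)
  moreover have "norm (H (Complex 0 t)) = exp (- a * t + (\<Sum>k<n. ln (N (z k))))"
  proof -
    have "Complex 0 t + of_real (real k / real n) = z k" for k by (simp add: z_def complex_eq_iff)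
    then have "norm (H (Complex 0 t)) = exp (- a * t) * (\<Prod>k<n. exp (ln (N (z k))))"
      unfolding nH using f(4) pos[OF zin] by (simp del: of_real_divide)
    then show ?thesis by (simp only: exp_add exp_sum[OF finite_lessThan])
  qed
  ultimately have "- a * t + (\<Sum>k<n. ln (N (z k))) \<le> real n * (mean 0 + e)" by simp
  moreover have "real n * (mean t - e) \<le> (\<Sum>k<n. ln (N (z k)))"
    using n1(2)[OF n(1), of 0] by (simp add: z_def abs_le_iff algebra_simps)
  moreover have "a * t = real n * (t / T * (M - mean 0 - e))" by (simp add: a_def)
  ultimately have "real n * (mean t - e) \<le> real n * (mean 0 + e + t / T * (M - mean 0 - e))"
    by (simp add: algebra_simps)
  then have "mean t - e \<le> mean 0 + e + t / T * (M - mean 0 - e)" using n(3) by simp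
  also have "\<dots> \<le> mean 0 + e + t / T * (M - mean 0)"
    using e t T by (intro add_mono mult_left_mono) auto
  finally show "mean t \<le> mean 0 + t / T * (M - mean 0) + e0" by (simp add: e_def)
qed

end

text \<open>Carries the convexity estimate over to the lower half of the strip. The point
  reflection, unlike conjugation, keeps the touching functions holomorphic.\<close>

lemma peaked_reflect:
  assumes "peaked \<delta> N"
  shows "peaked \<delta> (\<lambda>z. N (- z))"
proof -
  interpret peaked \<delta> N by fact
  have neg: "- z \<in> ostrip \<delta> \<longleftrightarrow> z \<in> ostrip \<delta>" for z by (simp add: ostrip_def)
  show ?thesis
  proof
    show "continuous_on (ostrip \<delta>) (\<lambda>z. N (- z))"
      by (rule continuous_on_compose2[OF cont]) (auto intro!: continuous_intros simp: neg)
    fix z assume z: "z \<in> ostrip \<delta>"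
    then show "N (- z) > 0" using pos neg by simp
    show "N (- (z + 1)) = N (- z)" using per[of "- (z + 1)"] z by (simp add: ostrip_def)
    obtain f where f: "f holomorphic_on ostrip \<delta>" "\<forall>z\<in>ostrip \<delta>. f (z + 1) = f z"
      "\<forall>z\<in>ostrip \<delta>. norm (f z) \<le> N z" "norm (f (- z)) = N (- z)"
      using touch[of "- z"] z neg by auto
    have "(\<lambda>z. f (- z)) holomorphic_on ostrip \<delta>"
      by (intro holomorphic_on_compose_gen[OF _ f(1), unfolded o_def] holomorphic_intros) (use neg in auto)
    moreover have "\<forall>w\<in>ostrip \<delta>. f (- (w + 1)) = f (- w)"
    proof
      fix w assume "w \<in> ostrip \<delta>"
      then show "f (- (w + 1)) = f (- w)" using bspec[OF f(2), of "- (w + 1)"] by (simp add: ostrip_def)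
    qed
    ultimately show "\<exists>f. f holomorphic_on ostrip \<delta> \<and> (\<forall>z\<in>ostrip \<delta>. f (z + 1) = f z)
      \<and> (\<forall>z\<in>ostrip \<delta>. norm (f z) \<le> N (- z)) \<and> norm (f z) = N (- z)"
      using f neg by (intro exI[of _ "\<lambda>z. f (- z)"]) auto
  qed (rule delta_pos)
qed

context peaked
begin

lemma mean_reflect:
  assumes "\<bar>t\<bar> < \<delta>"
  shows "peaked.mean (\<lambda>z. N (- z)) t = mean (- t)"
proof -
  interpret r: peaked \<delta> "\<lambda>z. N (- z)" by (rule peaked_reflect) unfold_locales
  let ?g = "\<lambda>x. ln (N (Complex x (- t)))"
  have "r.mean t = integral {0..1} (\<lambda>x. ?g (- x))"
    unfolding r.mean_def by (simp add: complex_minus[symmetric] del: complex_minus)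
  also have "\<dots> = integral {-1..-0} ?g" using Henstock_Kurzweil_Integration.integral_reflect_real[of 0 "-1" ?g] by simp
  also have "\<dots> = integral {0..1} (?g \<circ> (\<lambda>x. x + (-1)))"
  proof -
    have "continuous_on {0 + -1..1 + -1} ?g"
      using assms by (intro continuous_on_subset[OF line_cont]) auto
    from integral_shift[OF this] show ?thesis by simp
  qed
  also have "\<dots> = integral {0..1} ?g"
    using line_per[of "- t" "x - 1" for x] assms by (simp add: o_def)
  finally show ?thesis by (simp add: mean_def)
qed

lemma mean_le:
  assumes T: "0 < T" "T < \<delta>" and M: "\<And>z. z \<in> ostrip \<delta> \<Longrightarrow> ln (N z) \<le> M" and t: "\<bar>t\<bar> \<le> T"
  shows "mean t \<le> mean 0 + \<bar>t\<bar> / T * (M - mean 0)"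
proof (cases "t \<ge> 0")
  case True then show ?thesis using mean_le_upper[OF T M] t by simp
next
  case False
  interpret r: peaked \<delta> "\<lambda>z. N (- z)" by (rule peaked_reflect) unfold_locales
  have "r.mean (- t) \<le> r.mean 0 + (- t) / T * (M - r.mean 0)"
    by (rule r.mean_le_upper[OF T]) (use M t False in \<open>auto simp: ostrip_def\<close>)
  then show ?thesis using False t T mean_reflect[of "- t"] mean_reflect[of 0] by simp
qed

end

section \<open>Means over discs\<close>

text \<open>Area integral, taken over pairs so that Tonelli's theorem applies in either order and a
  shear merely translates rows or columns. The integrand keeps a complex argument, in which
  rotations are multiplications.\<close>

definition plane_integral :: "(complex \<Rightarrow> ennreal) \<Rightarrow> ennreal" where
  "plane_integral G = (\<integral>\<^sup>+p. G (Complex (fst p) (snd p)) \<partial>(lborel :: (real \<times> real) measure))"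

lemma measurable_pair_Complex [measurable]: "(\<lambda>p. Complex (fst p) (snd p)) \<in> borel_measurable (borel :: (real \<times> real) measure)"
  by (intro borel_measurable_continuous_onI) (auto intro!: continuous_intros simp: Complex_eq)

lemma plane_integral_rows:
  assumes [measurable]: "G \<in> borel_measurable borel"
  shows "plane_integral G = (\<integral>\<^sup>+t. \<integral>\<^sup>+x. G (Complex x t) \<partial>lborel \<partial>lborel)"
proof -
  have "(\<lambda>p. G (Complex (fst p) (snd p))) \<in> borel_measurable (lborel \<Otimes>\<^sub>M lborel)"
    unfolding lborel_prod by measurable
  from lborel_pair.nn_integral_snd[OF this] show ?thesis
    unfolding plane_integral_def lborel_prod by simp
qed

lemma plane_integral_columns:
  assumes [measurable]: "G \<in> borel_measurable borel"
  shows "plane_integral G = (\<integral>\<^sup>+x. \<integral>\<^sup>+t. G (Complex x t) \<partial>lborel \<partial>lborel)"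
proof -
  have "(\<lambda>p. G (Complex (fst p) (snd p))) \<in> borel_measurable (lborel \<Otimes>\<^sub>M lborel)"
    unfolding lborel_prod by measurable
  from lborel.nn_integral_fst[OF this] show ?thesis
    unfolding plane_integral_def lborel_prod by simp
qed

lemma nn_integral_translate:
  fixes g :: "real \<Rightarrow> ennreal"
  assumes [measurable]: "g \<in> borel_measurable borel"
  shows "(\<integral>\<^sup>+x. g (x + c) \<partial>lborel) = (\<integral>\<^sup>+x. g x \<partial>lborel)"
  using nn_integral_real_affine[of g 1 c] by (simp add: add.commute)

lemma plane_integral_shear_Re:
  assumes [measurable]: "G \<in> borel_measurable borel"
  shows "plane_integral (\<lambda>z. G (Complex (Re z + a * Im z) (Im z))) = plane_integral G"
proof -
  have "(\<lambda>z. G (Complex (Re z + a * Im z) (Im z))) \<in> borel_measurable borel"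
    by (rule measurable_compose_continuous[OF assms]) (auto intro!: continuous_intros simp: Complex_eq)
  then have "plane_integral (\<lambda>z. G (Complex (Re z + a * Im z) (Im z))) = (\<integral>\<^sup>+t. \<integral>\<^sup>+x. G (Complex (x + a * t) t) \<partial>lborel \<partial>lborel)"
    by (simp add: plane_integral_rows)
  also have "\<dots> = (\<integral>\<^sup>+t. \<integral>\<^sup>+x. G (Complex x t) \<partial>lborel \<partial>lborel)"
  proof (rule nn_integral_cong)
    fix t
    have "(\<lambda>x. G (Complex x t)) \<in> borel_measurable borel"
      by (rule measurable_compose_continuous[OF assms]) (auto intro!: continuous_intros simp: Complex_eq)
    then show "(\<integral>\<^sup>+x. G (Complex (x + a * t) t) \<partial>lborel) = (\<integral>\<^sup>+x. G (Complex x t) \<partial>lborel)"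
      by (rule nn_integral_translate[of "\<lambda>x. G (Complex x t)"])
  qed
  finally show ?thesis by (simp add: plane_integral_rows)
qed

lemma plane_integral_shear_Im:
  assumes [measurable]: "G \<in> borel_measurable borel"
  shows "plane_integral (\<lambda>z. G (Complex (Re z) (Im z + a * Re z))) = plane_integral G"
proof -
  have "(\<lambda>z. G (Complex (Re z) (Im z + a * Re z))) \<in> borel_measurable borel"
    by (rule measurable_compose_continuous[OF assms]) (auto intro!: continuous_intros simp: Complex_eq)
  then have "plane_integral (\<lambda>z. G (Complex (Re z) (Im z + a * Re z))) = (\<integral>\<^sup>+x. \<integral>\<^sup>+t. G (Complex x (t + a * x)) \<partial>lborel \<partial>lborel)"
    by (simp add: plane_integral_columns)
  also have "\<dots> = (\<integral>\<^sup>+x. \<integral>\<^sup>+t. G (Complex x t) \<partial>lborel \<partial>lborel)"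
  proof (rule nn_integral_cong)
    fix x
    have "(\<lambda>t. G (Complex x t)) \<in> borel_measurable borel"
      by (rule measurable_compose_continuous[OF assms]) (auto intro!: continuous_intros simp: Complex_eq)
    then show "(\<integral>\<^sup>+t. G (Complex x (t + a * x)) \<partial>lborel) = (\<integral>\<^sup>+t. G (Complex x t) \<partial>lborel)"
      by (rule nn_integral_translate[of "\<lambda>t. G (Complex x t)"])
  qed
  finally show ?thesis by (simp add: plane_integral_columns)
qed

text \<open>A rotation by an angle other than \<open>\<pi>\<close> is a product of three shears.\<close>

lemma plane_integral_rotate_aux:
  assumes [measurable]: "G \<in> borel_measurable borel" and u: "norm u = 1" "Re u \<noteq> -1"
  shows "plane_integral (\<lambda>z. G (z * u)) = plane_integral G"
proof -
  define c s where "c = Re u" and "s = Im u"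
  have cs: "c * c + s * s = 1" using u(1) by (simp add: c_def s_def cmod_def power2_eq_square)
  have c1: "1 + c \<noteq> 0" using u(2) by (simp add: c_def)
  \<comment> \<open>This is minus the tangent of half the rotation angle, the coefficient of the two
    horizontal shears around the vertical shear by \<open>s\<close>.\<close>
  define \<alpha> where "\<alpha> = - s / (1 + c)"
  have "1 + s * \<alpha> = (1 + c - s * s) / (1 + c)" using c1 by (simp add: \<alpha>_def field_simps)
  also have "1 + c - s * s = c * (1 + c)" using cs by (simp add: algebra_simps)
  finally have sa: "1 + s * \<alpha> = c" using c1 by simp
  have ca: "\<alpha> * (1 + c) = - s" using c1 by (simp add: \<alpha>_def)
  define H1 where "H1 z = G (Complex (Re z + \<alpha> * Im z) (Im z))" for z
  define H2 where "H2 z = H1 (Complex (Re z) (Im z + s * Re z))" for z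
  have [measurable]: "H1 \<in> borel_measurable borel" unfolding H1_def
    by (rule measurable_compose_continuous[OF assms(1)]) (auto intro!: continuous_intros simp: Complex_eq)
  have [measurable]: "H2 \<in> borel_measurable borel" unfolding H2_def
    by (rule measurable_compose_continuous) (auto intro!: continuous_intros simp: Complex_eq)
  have "G (z * u) = H2 (Complex (Re z + \<alpha> * Im z) (Im z))" for z
  proof -
    have "Im z + s * (Re z + \<alpha> * Im z) = s * Re z + (1 + s * \<alpha>) * Im z" by (simp add: algebra_simps)
    then have i: "Im z + s * (Re z + \<alpha> * Im z) = s * Re z + c * Im z" by (simp add: sa)
    have "Re z + \<alpha> * Im z + \<alpha> * (s * Re z + c * Im z) = (1 + s * \<alpha>) * Re z + \<alpha> * (1 + c) * Im z"
      by (simp add: algebra_simps)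
    then have r: "Re z + \<alpha> * Im z + \<alpha> * (s * Re z + c * Im z) = c * Re z - s * Im z" by (simp add: sa ca)
    have "z * u = Complex (c * Re z - s * Im z) (s * Re z + c * Im z)"
      by (simp add: complex_eq_iff c_def s_def)
    then show ?thesis by (simp add: H1_def H2_def i r)
  qed
  then have "plane_integral (\<lambda>z. G (z * u)) = plane_integral H2"
    using plane_integral_shear_Re[of H2 \<alpha>] by simp
  also have "\<dots> = plane_integral H1" unfolding H2_def by (rule plane_integral_shear_Im) measurable
  also have "\<dots> = plane_integral G" unfolding H1_def by (rule plane_integral_shear_Re) measurable
  finally show ?thesis .
qed

text \<open>Rotating twice by the principal square root of \<open>u\<close>, whose real part is
  nonnegative, avoids the excluded angle and covers u = -1.\<close>

lemma plane_integral_rotate: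
  assumes [measurable]: "G \<in> borel_measurable borel" and u: "norm u = 1"
  shows "plane_integral (\<lambda>z. G (z * u)) = plane_integral G"
proof -
  have "Re (csqrt u) \<ge> 0" using csqrt_principal[of u] by linarith
  then have v: "norm (csqrt u) = 1" "Re (csqrt u) \<noteq> -1"
    using u by (auto simp: norm_csqrt simp del: csqrt.simps)
  have [measurable]: "(\<lambda>z. G (z * csqrt u)) \<in> borel_measurable borel"
    by (rule measurable_compose_continuous[OF assms(1)]) (auto intro!: continuous_intros)
  have "csqrt u * csqrt u = u" by (simp flip: power2_eq_square)
  then have "plane_integral (\<lambda>z. G (z * u)) = plane_integral (\<lambda>z. G (z * csqrt u * csqrt u))"
    by (simp add: mult.assoc)
  also have "\<dots> = plane_integral (\<lambda>z. G (z * csqrt u))"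
    by (rule plane_integral_rotate_aux[of "\<lambda>z. G (z * csqrt u)"]) (use v in auto)
  also have "\<dots> = plane_integral G" by (rule plane_integral_rotate_aux) (use v in auto)
  finally show ?thesis .
qed

lemma (in peaked) measurable_disc_integrand:
  assumes sub: "cball z \<rho> \<subseteq> ostrip \<delta>"
  shows "(\<lambda>\<zeta>. ennreal (indicator (cball 0 \<rho>) \<zeta> * (M - ln (N (z + \<zeta>))))) \<in> borel_measurable borel"
proof -
  have mem: "z + \<zeta> \<in> ostrip \<delta>" if "\<zeta> \<in> cball 0 \<rho>" for \<zeta> using sub that by (auto simp: dist_norm)
  have "continuous_on (cball 0 \<rho>) (\<lambda>\<zeta>. ln (N (z + \<zeta>)))"
    by (rule continuous_on_compose2[OF cont_ln]) (use mem sub in \<open>auto intro!: continuous_intros\<close>)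
  then have "(\<lambda>\<zeta>. indicator (cball 0 \<rho>) \<zeta> *\<^sub>R (M - ln (N (z + \<zeta>)))) \<in> borel_measurable borel"
    by (intro borel_measurable_continuous_on_indicator continuous_on_diff continuous_on_const) auto
  then show ?thesis by simp
qed

text \<open>Averaging over all rotations takes the place of polar coordinates: after the integrals
  are exchanged the inner one runs over a circle around \<open>z\<close>, where
  \<open>ln_le_circle_mean\<close> applies. Working with the deficit \<open>M - ln N\<close> keeps
  all integrands nonnegative.\<close>

lemma (in peaked) disc_mean_le:
  assumes M: "\<And>z. z \<in> ostrip \<delta> \<Longrightarrow> ln (N z) \<le> M" and sub: "cball z \<rho> \<subseteq> ostrip \<delta>" and "\<rho> > 0"
  shows "plane_integral (\<lambda>\<zeta>. ennreal (indicator (cball 0 \<rho>) \<zeta> * (M - ln (N (z + \<zeta>)))))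
    \<le> plane_integral (indicator (cball 0 \<rho>)) * ennreal (M - ln (N z))"
proof -
  define G where "G \<zeta> = ennreal (indicator (cball 0 \<rho>) \<zeta> * (M - ln (N (z + \<zeta>))))" for \<zeta>
  have [measurable]: "G \<in> borel_measurable borel" unfolding G_def by (rule measurable_disc_integrand) fact
  have mem: "z + \<zeta> \<in> ostrip \<delta>" if "\<zeta> \<in> cball 0 \<rho>" for \<zeta> using sub that by (auto simp: dist_norm)
  have rotmeas: "(\<lambda>(\<theta>, p). G (Complex (fst p) (snd p) * cis (2 * pi * \<theta>))) \<in> borel_measurable (lborel \<Otimes>\<^sub>M (lborel :: (real \<times> real) measure))"
    unfolding lborel_prod split_beta'
    by (rule measurable_compose[of _ _ borel, OF _ \<open>G \<in> _\<close>])
       (auto intro!: borel_measurable_continuous_onI continuous_intros simp: Complex_eq)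
  have "plane_integral G = (\<integral>\<^sup>+\<theta>\<in>{0..1::real}. plane_integral G \<partial>lborel)"
    by (subst nn_integral_cmult_indicator) auto
  also have "\<dots> = (\<integral>\<^sup>+\<theta>\<in>{0..1}. plane_integral (\<lambda>\<zeta>. G (\<zeta> * cis (2 * pi * \<theta>))) \<partial>lborel)"
    by (simp add: plane_integral_rotate)
  also have "\<dots> = (\<integral>\<^sup>+\<theta>. \<integral>\<^sup>+p. G (Complex (fst p) (snd p) * cis (2 * pi * \<theta>)) * indicator {0..1} \<theta> \<partial>lborel \<partial>lborel)"
  proof (intro nn_integral_cong)
    fix \<theta> :: real
    have "(\<lambda>p. G (Complex (fst p) (snd p) * cis (2 * pi * \<theta>))) \<in> borel_measurable borel"
      by (rule measurable_compose[of _ _ borel, OF _ \<open>G \<in> _\<close>])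
       (auto intro!: borel_measurable_continuous_onI continuous_intros simp: Complex_eq)
    then show "plane_integral (\<lambda>\<zeta>. G (\<zeta> * cis (2 * pi * \<theta>))) * indicator {0..1} \<theta>
      = (\<integral>\<^sup>+p. G (Complex (fst p) (snd p) * cis (2 * pi * \<theta>)) * indicator {0..1} \<theta> \<partial>lborel)"
      unfolding plane_integral_def by (subst nn_integral_multc) auto
  qed
  also have "\<dots> = (\<integral>\<^sup>+p. \<integral>\<^sup>+\<theta>. G (Complex (fst p) (snd p) * cis (2 * pi * \<theta>)) * indicator {0..1} \<theta> \<partial>lborel \<partial>lborel)"
    by (rule lborel_pair.Fubini'[symmetric]) (use rotmeas in \<open>simp add: split_beta'\<close>)
  also have "\<dots> \<le> (\<integral>\<^sup>+p. indicator (cball 0 \<rho>) (Complex (fst p) (snd p)) * ennreal (M - ln (N z)) \<partial>lborel)"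
  proof (intro nn_integral_mono)
    fix p :: "real \<times> real"
    define \<zeta> where "\<zeta> = Complex (fst p) (snd p)"
    show "(\<integral>\<^sup>+\<theta>. G (Complex (fst p) (snd p) * cis (2 * pi * \<theta>)) * indicator {0..1} \<theta> \<partial>lborel)
      \<le> indicator (cball 0 \<rho>) (Complex (fst p) (snd p)) * ennreal (M - ln (N z))"
      unfolding \<zeta>_def[symmetric]
    proof (cases "\<zeta> \<in> cball 0 \<rho>")
      case False
      then have "G (\<zeta> * cis t) = 0" for t by (simp add: G_def norm_mult)
      then show "(\<integral>\<^sup>+\<theta>. G (\<zeta> * cis (2 * pi * \<theta>)) * indicator {0..1} \<theta> \<partial>lborel)
        \<le> indicator (cball 0 \<rho>) \<zeta> * ennreal (M - ln (N z))" by simp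
    next
      case True
      have rin: "z + \<zeta> * cis t \<in> ostrip \<delta>" for t using True by (intro mem) (simp add: norm_mult)
      define \<phi> where "\<phi> \<theta> = ln (N (z + \<zeta> * cis (2 * pi * \<theta>)))" for \<theta>
      have c: "continuous_on {0..1} \<phi>" unfolding \<phi>_def
        by (rule continuous_on_compose2[OF cont_ln]) (auto intro!: continuous_intros rin)
      have I: "((\<lambda>\<theta>. M - \<phi> \<theta>) has_integral (M - integral {0..1} \<phi>)) {0..1}"
        using has_integral_diff[OF has_integral_const_real[of M 0 1] integrable_integral[OF integrable_continuous_real[OF c]]] by simp
      have "(\<integral>\<^sup>+\<theta>. G (\<zeta> * cis (2 * pi * \<theta>)) * indicator {0..1} \<theta> \<partial>lborel) = (\<integral>\<^sup>+\<theta>. ennreal (indicator {0..1} \<theta> * (M - \<phi> \<theta>)) \<partial>lborel)"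
        using True by (intro nn_integral_cong) (auto simp: G_def \<phi>_def norm_mult indicator_def)
      also have "\<dots> = ennreal (M - integral {0..1} \<phi>)"
        by (rule nn_integral_has_integral_lebesgue[OF _ I]) (use M rin in \<open>auto simp: \<phi>_def\<close>)
      also have "\<dots> \<le> ennreal (M - ln (N z))"
      proof (rule ennreal_leI)
        have "cball z (norm \<zeta>) \<subseteq> ostrip \<delta>" using True sub by (auto simp: subset_iff)
        from ln_le_circle_mean[OF this] show "M - integral {0..1} \<phi> \<le> M - ln (N z)" by (simp add: \<phi>_def[abs_def])
      qed
      finally show "(\<integral>\<^sup>+\<theta>. G (\<zeta> * cis (2 * pi * \<theta>)) * indicator {0..1} \<theta> \<partial>lborel)
        \<le> indicator (cball 0 \<rho>) \<zeta> * ennreal (M - ln (N z))" using True by simp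
    qed
  qed
  also have "\<dots> = plane_integral (indicator (cball 0 \<rho>)) * ennreal (M - ln (N z))"
  proof -
    have "(indicator (cball 0 \<rho>) :: complex \<Rightarrow> ennreal) \<in> borel_measurable borel"
      by (intro borel_measurable_indicator borel_closed closed_cball)
    from measurable_compose[OF measurable_pair_Complex this] show ?thesis
      unfolding plane_integral_def by (intro nn_integral_multc) simp
  qed
  finally show ?thesis by (simp add: G_def[abs_def])
qed

section \<open>Sublevel sets of holomorphic functions\<close>

lemma holomorphic_divide_zero:
  assumes "f holomorphic_on S" "open S" "f a = 0"
  obtains g where "g holomorphic_on S" "\<And>z. z \<in> S \<Longrightarrow> f z = (z - a) * g z"
proof
  show "(\<lambda>z. if z = a then deriv f a else (f z - f a)/(z-a)) holomorphic_on S"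
    by (rule pole_lemma_open) fact+
qed (use assms in auto)

text \<open>The scaling by \<open>r\<close> serves both bounds. On the frontier the distance to
  \<open>a\<close> is at least 2r, so dividing gains a factor 2, and the maximum principle carries
  this inside; at the centre the distance is at most r, so nothing is lost there.\<close>

lemma divide_out_zero:
  fixes y :: complex
  assumes r: "r > 0" and S: "open S" "cball y (3*r) \<subseteq> S" and f: "f holomorphic_on S"
    and M: "\<And>z. z \<in> cball y (3*r) \<Longrightarrow> norm (f z) \<le> M" and a: "a \<in> cball y r" "f a = 0"
  obtains g where "g holomorphic_on S" "\<And>z. z \<in> S \<Longrightarrow> f z = (z - a) / of_real r * g z"
    "\<And>z. z \<in> cball y (3*r) \<Longrightarrow> norm (g z) \<le> M / 2" "norm (f y) \<le> norm (g y)"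
proof -
  obtain g0 where g0: "g0 holomorphic_on S" "\<And>z. z \<in> S \<Longrightarrow> f z = (z - a) * g0 z"
    using holomorphic_divide_zero[OF f S(1) a(2)] by blast
  define g where "g z = of_real r * g0 z" for z
  have gh: "g holomorphic_on S" unfolding g_def by (intro holomorphic_intros g0)
  have fg: "f z = (z - a) / of_real r * g z" if "z \<in> S" for z
    using g0(2)[OF that] r by (simp add: g_def)
  have le: "norm (g z) \<le> M / 2" if "z \<in> cball y (3*r)" for z
  proof (rule maximum_modulus_frontier[of g "cball y (3*r)"])
    show "g holomorphic_on interior (cball y (3*r))"
      using gh S(2) interior_subset holomorphic_on_subset by blast
    show "continuous_on (closure (cball y (3*r))) g"
      using gh S(2) holomorphic_on_subset holomorphic_on_imp_continuous_on by (metis closed_cball closure_closed)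
    fix z assume "z \<in> frontier (cball y (3*r))"
    then have z: "dist y z = 3*r" using r by (simp add: frontier_cball)
    have "dist z a \<ge> 2*r" using a z dist_triangle[of y z a] by (simp add: dist_commute)
    then have "2 * norm (g z) \<le> dist z a / r * norm (g z)"
      using r by (intro mult_right_mono) (auto simp: field_simps)
    also have "\<dots> = norm (f z)"
      using fg[of z] z r subsetD[OF S(2), of z] by (auto simp: norm_mult norm_divide dist_norm)
    also have "\<dots> \<le> M" using M[of z] z by auto
    finally show "norm (g z) \<le> M / 2" by simp
  qed (use that in auto)
  have "norm (f y) = dist y a / r * norm (g y)"
    using fg[of y] r subsetD[OF S(2), of y] by (auto simp: norm_mult norm_divide dist_norm)
  also have "\<dots> \<le> 1 * norm (g y)"
    using a r by (intro mult_right_mono) auto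
  finally show thesis using that[OF gh fg le] by simp
qed

text \<open>Dividing out one zero halves the bound \<open>M\<close> and does not decrease \<open>norm (f y)\<close>, so at most
  \<open>k\<close> zeros can be divided out: factorization and Jensen's bound for the number of zeros in one
  induction.\<close>

lemma factor_out_zeros:
  fixes y :: complex
  assumes "r > 0" "open S" "cball y (3*r) \<subseteq> S" "f holomorphic_on S"
    "\<And>z. z \<in> cball y (3*r) \<Longrightarrow> norm (f z) \<le> M" "M > 0" "M / 2^k \<le> norm (f y)"
  shows "\<exists>as g. length as \<le> k \<and> set as \<subseteq> cball y r \<and> g holomorphic_on S \<and>
    (\<forall>z\<in>S. f z = (\<Prod>a\<leftarrow>as. (z - a) / of_real r) * g z) \<and> (\<forall>z\<in>cball y r. g z \<noteq> 0) \<and>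
    (\<forall>z\<in>cball y (3*r). norm (g z) \<le> M / 2 ^ length as) \<and> norm (f y) \<le> norm (g y)"
  using assms(4-)
proof (induction k arbitrary: f M)
  case (0 f M)
  have "\<forall>z\<in>cball y r. f z \<noteq> 0"
  proof (rule ccontr)
    assume "\<not> ?thesis"
    then obtain a where a: "a \<in> cball y r" "f a = 0" by auto
    obtain g where "g holomorphic_on S" "\<And>z. z \<in> S \<Longrightarrow> f z = (z - a) / of_real r * g z" and
      g: "\<And>z. z \<in> cball y (3*r) \<Longrightarrow> norm (g z) \<le> M / 2" "norm (f y) \<le> norm (g y)"
      by (rule divide_out_zero[OF assms(1-3) 0(1,2) a]) (simp, blast)
    show False using g(1)[of y] g(2) 0(3,4) assms(1) by simp
  qed
  then show ?case using 0 by (intro exI[of _ "[]"] exI[of _ f]) auto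
next
  case (Suc k f M)
  show ?case
  proof (cases "\<forall>z\<in>cball y r. f z \<noteq> 0")
    case True
    then show ?thesis using Suc.prems by (intro exI[of _ "[]"] exI[of _ f]) auto
  next
    case False
    then obtain a where a: "a \<in> cball y r" "f a = 0" by auto
    obtain g where g: "g holomorphic_on S" "\<And>z. z \<in> S \<Longrightarrow> f z = (z - a) / of_real r * g z"
      "\<And>z. z \<in> cball y (3*r) \<Longrightarrow> norm (g z) \<le> M / 2" "norm (f y) \<le> norm (g y)"
      by (rule divide_out_zero[OF assms(1-3) Suc.prems(1,2) a]) (simp, blast)
    have "\<exists>as h. length as \<le> k \<and> set as \<subseteq> cball y r \<and> h holomorphic_on S \<and>
      (\<forall>z\<in>S. g z = (\<Prod>a\<leftarrow>as. (z - a) / of_real r) * h z) \<and> (\<forall>z\<in>cball y r. h z \<noteq> 0) \<and>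
      (\<forall>z\<in>cball y (3*r). norm (h z) \<le> M/2 / 2 ^ length as) \<and> norm (g y) \<le> norm (h y)"
      by (rule Suc.IH) (use g Suc.prems in auto)
    then obtain as h where h: "length as \<le> k" "set as \<subseteq> cball y r" "h holomorphic_on S"
      "\<forall>z\<in>S. g z = (\<Prod>a\<leftarrow>as. (z - a) / of_real r) * h z" "\<forall>z\<in>cball y r. h z \<noteq> 0"
      "\<forall>z\<in>cball y (3*r). norm (h z) \<le> M/2 / 2 ^ length as" "norm (g y) \<le> norm (h y)" by blast
    then show ?thesis using a g(2,4) by (intro exI[of _ "a # as"] exI[of _ h]) auto
  qed
qed

text \<open>Harnack's inequality for \<open>B - Re L\<close> with \<open>g = exp L\<close>, by the Schwarz lemma for \<open>u / (5B - u)\<close>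
  with \<open>u = L - L y\<close>.\<close>

lemma zero_free_lower_bound:
  fixes y :: complex
  assumes "g holomorphic_on ball y r" "\<And>z. z \<in> ball y r \<Longrightarrow> g z \<noteq> 0"
    "\<And>z. z \<in> ball y r \<Longrightarrow> norm (g z) \<le> exp B" "norm (g y) \<ge> exp (-B)" "B > 0" "r > 0"
    "dist y x \<le> r/2"
  shows "norm (g x) \<ge> exp (-6*B)"
proof -
  obtain L where L: "L holomorphic_on ball y r" "\<And>z. z \<in> ball y r \<Longrightarrow> exp (L z) = g z"
    using holomorphic_logarithm_exists[of "ball y r" g y] assms by auto
  have nL: "norm (g z) = exp (Re (L z))" if "z \<in> ball y r" for z
    using L(2)[OF that] norm_exp_eq_Re by metis
  have ReL: "Re (L z) \<le> B" if "z \<in> ball y r" for z using assms(3)[OF that] nL[OF that] by simp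
  have yin: "y \<in> ball y r" using assms by simp
  have Ly: "Re (L y) \<ge> - B" using assms(4) nL[OF yin] by simp
  define u where "u w = L (y + of_real r * w) - L y" for w
  have inb: "y + of_real r * w \<in> ball y r" if "norm w < 1" for w
    using that assms(6) by (simp add: dist_norm norm_mult)
  have uh: "u holomorphic_on ball 0 1"
    unfolding u_def
    by (intro holomorphic_intros holomorphic_on_compose_gen[OF _ L(1), unfolded o_def])
       (use inb in auto)
  have Reu: "Re (u w) \<le> 2*B" if "norm w < 1" for w
    using ReL[OF inb[OF that]] Ly by (simp add: u_def)
  \<comment> \<open>With \<open>Re (u w)\<close> at most 2B the squared moduli differ by at least 25
    B^2 - 20 B^2 > 0, so the quotient maps the unit disc into itself.\<close>
  have less: "norm (u w) < norm (of_real (5*B) - u w)" if "norm w < 1" for w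
  proof -
    have "(norm (of_real (5*B) - u w))\<^sup>2 = (5*B)\<^sup>2 - 10*B*Re (u w) + (norm (u w))\<^sup>2"
      unfolding cmod_power2 by (simp add: power2_eq_square algebra_simps)
    moreover have "10*B*Re (u w) \<le> 10*B*(2*B)" using Reu[OF that(1)] assms(5) by (intro mult_left_mono) auto
    moreover have "10*B*(2*B) < (5*B)\<^sup>2" using assms(5) by (simp add: power2_eq_square)
    ultimately have "(norm (u w))\<^sup>2 < (norm (of_real (5*B) - u w))\<^sup>2" by linarith
    then show ?thesis using power2_less_imp_less norm_ge_zero by blast
  qed
  define w where "w = (x - y) / of_real r"
  have w: "norm w \<le> 1/2" using assms by (simp add: w_def norm_divide dist_norm norm_minus_commute field_simps)
  have xw: "y + of_real r * w = x" using assms by (simp add: w_def)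
  have "norm (u w / (of_real (5*B) - u w)) \<le> norm w"
  proof (rule Schwarz_Lemma(1)[of "\<lambda>w. u w / (of_real (5*B) - u w)"])
    show "(\<lambda>w. u w / (of_real (5*B) - u w)) holomorphic_on ball 0 1"
      using less by (intro holomorphic_intros uh) force
    show "norm (u z / (of_real (5*B) - u z)) < 1" if "norm z < 1" for z
      using less[OF that] by (simp add: norm_divide divide_less_eq)
  qed (use w in \<open>auto simp: u_def\<close>)
  then have "norm (u w) / norm (of_real (5*B) - u w) \<le> 1/2" using w unfolding norm_divide by linarith
  then have "norm (u w) \<le> 1/2 * norm (of_real (5*B) - u w)"
    using less[of w] w by (simp add: divide_le_eq split: if_splits)
  also have "\<dots> \<le> 1/2 * (5*B + norm (u w))"
    using norm_triangle_ineq4[of "of_real (5*B)" "u w"] assms(5) by simp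
  finally have "norm (u w) \<le> 5*B" by simp
  then have "Re (u w) \<ge> -5*B" using abs_Re_le_cmod[of "u w"] by linarith
  then have "Re (L x) \<ge> -6*B" using Ly xw by (simp add: u_def)
  moreover have "x \<in> ball y r" using inb[of w] w xw by simp
  ultimately show ?thesis using nL by simp
qed

text \<open>Points of the interval are within r/2 of \<open>y\<close>, hence within 3r/2 of
  \<open>a\<close>. After scaling it remains to integrate |u|^(-1/2) over [-3/2, 3/2], which gives 4
  sqrt(3/2) < 5.\<close>

lemma nn_integral_inverse_sqrt_le:
  fixes a y :: real
  assumes "r > 0" "\<bar>y - a\<bar> \<le> r"
  shows "(\<integral>\<^sup>+x\<in>{y - r/2..y + r/2}. ennreal ((\<bar>x - a\<bar> / r) powr (-1/2)) \<partial>lborel) \<le> ennreal (5 * r)"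
proof -
  define h :: "real \<Rightarrow> real" where "h u = \<bar>u\<bar> powr (-1/2)" for u
  have pos: "((\<lambda>u. u powr (-1/2)) has_integral ((3/2) powr (-1/2+1) / (-1/2+1))) {0..3/2::real}"
    by (rule has_integral_powr_from_0) auto
  then have "(h has_integral ((3/2) powr (1/2) * 2)) {0..3/2}"
    by (rule has_integral_eq_rhs[OF has_integral_eq, rotated]) (auto simp: h_def)
  moreover from this have "(h has_integral ((3/2) powr (1/2) * 2)) {-(3/2)..-0}"
    by (subst (asm) has_integral_reflect_real[symmetric]) (simp add: h_def[abs_def])
  ultimately have "(h has_integral (3/2) powr (1/2) * 4) {-(3/2)..3/2}"
    using has_integral_combine[of "-(3/2)" 0 "3/2" h "(3/2) powr (1/2) * 2" "(3/2) powr (1/2) * 2"] by (simp add: mult.commute)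
  then have "(\<integral>\<^sup>+u. ennreal (indicator {-(3/2)..3/2} u * h u) \<partial>lborel) = ennreal ((3/2) powr (1/2) * 4)"
    by (intro nn_integral_has_integral_lebesgue) (auto simp: h_def[abs_def])
  also have "(3/2::real) powr (1/2) * 4 \<le> 5"
  proof -
    have "sqrt (3/2) \<le> 5/4" by (rule real_le_lsqrt) (auto simp: power2_eq_square)
    then show ?thesis by (simp add: powr_half_sqrt)
  qed
  finally have i1: "(\<integral>\<^sup>+u. ennreal (indicator {-(3/2)..3/2} u * h u) \<partial>lborel) \<le> ennreal 5"
    by (simp add: ennreal_leI)
  have "(\<integral>\<^sup>+x\<in>{y - r/2..y + r/2}. ennreal ((\<bar>x - a\<bar> / r) powr (-1/2)) \<partial>lborel)
      = ennreal r * (\<integral>\<^sup>+u. ennreal ((\<bar>(a + r*u) - a\<bar> / r) powr (-1/2)) * indicator {y - r/2..y + r/2} (a + r*u) \<partial>lborel)"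
    using assms(1) by (subst nn_integral_real_affine[where c=r and t=a]) auto
  also have "\<dots> \<le> ennreal r * (\<integral>\<^sup>+u. ennreal (indicator {-(3/2)..3/2} u * h u) \<partial>lborel)"
  proof (intro mult_left_mono nn_integral_mono)
    fix u :: real
    have "u \<in> {-(3/2)..3/2}" if "a + r*u \<in> {y - r/2..y + r/2}"
    proof -
      have "\<bar>r * u\<bar> \<le> r * (3/2)" using that assms(2) unfolding atLeastAtMost_iff by argo
      then have "\<bar>u\<bar> \<le> 3/2" using assms(1) by (simp add: abs_mult)
      then show ?thesis by auto
    qed
    then show "ennreal ((\<bar>(a + r*u) - a\<bar> / r) powr (-1/2)) * indicator {y - r/2..y + r/2} (a + r*u)
      \<le> ennreal (indicator {-(3/2)..3/2} u * h u)"
      using assms(1) by (auto simp: indicator_def h_def abs_mult)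
  qed auto
  also have "\<dots> \<le> ennreal r * ennreal 5" by (intro mult_left_mono i1) auto
  also have "\<dots> = ennreal (5 * r)" using assms(1) by (subst ennreal_mult[symmetric]) (auto simp: mult.commute)
  finally show ?thesis .
qed


text \<open>Away from its zeros \<open>a\<^sub>1, \<dots>, a\<^sub>N\<close> the function is bounded below by Harnack's inequality. For the
  product over the zeros, AM-GM bounds the \<open>2N\<close>-th root of its inverse by the mean of the integrable
  functions \<open>\<bar>x - Re a\<^sub>i\<bar> powr (-1/2)\<close>, to which Markov's inequality applies.\<close>

lemma cartan_estimate:
  fixes y B r t :: real
  assumes r: "r > 0" and S: "open S" "cball (of_real y) (3*r) \<subseteq> S" and f: "f holomorphic_on S"
    and le: "\<And>z. z \<in> cball (of_real y) (3*r) \<Longrightarrow> norm (f z) \<le> exp B"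
    and ge: "norm (f (of_real y)) \<ge> exp (-B)" and B: "B > 0"
  shows "emeasure lborel {x\<in>{y - r/2..y + r/2}. norm (f (of_real x)) \<le> exp (-t*B)}
          \<le> ennreal (5 * exp 1 * r * exp (-t/6))"
proof -
  define I where "I = {y - r/2..y + r/2}"
  define E where "E = {x\<in>I. norm (f (of_real x)) \<le> exp (-t*B)}"
  have cI: "of_real x \<in> cball (complex_of_real y) (r/2)" if "x \<in> I" for x
    using that by (auto simp: I_def dist_of_real dist_real_def abs_if)
  \<comment> \<open>So many halvings bring the upper bound exp B down to exp (-B), which is what the
    factorization asks for.\<close>
  have "2 * B / ln 2 \<le> real (nat \<lceil>2 * B / ln 2\<rceil>)" by linarith
  then have "exp (2 * B) \<le> exp (real (nat \<lceil>2 * B / ln 2\<rceil>) * ln 2)" by (simp add: field_simps)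
  also have "\<dots> = 2 ^ nat \<lceil>2 * B / ln 2\<rceil>" by (subst exp_of_nat_mult) simp
  finally have k: "exp (2*B) \<le> 2 ^ nat \<lceil>2 * B / ln 2\<rceil>" .
  have "exp B / 2 ^ nat \<lceil>2 * B / ln 2\<rceil> \<le> exp B / exp (2*B)"
    using k by (intro divide_left_mono) auto
  also have "\<dots> = exp (-B)" by (simp add: exp_minus field_simps flip: exp_add)
  finally have k': "exp B / 2 ^ nat \<lceil>2 * B / ln 2\<rceil> \<le> norm (f (of_real y))" using ge by simp
  obtain as g where as: "set as \<subseteq> cball (of_real y) r" "g holomorphic_on S"
    "\<forall>z\<in>S. f z = (\<Prod>a\<leftarrow>as. (z - a) / of_real r) * g z" "\<forall>z\<in>cball (of_real y) r. g z \<noteq> 0"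
    "\<forall>z\<in>cball (of_real y) (3*r). norm (g z) \<le> exp B / 2 ^ length as" 
    "norm (f (of_real y)) \<le> norm (g (of_real y))"
    using factor_out_zeros[OF r S f le _ k'] by auto
  define N where "N = length as"
  have "norm (g (of_real y)) \<le> exp B / 2 ^ N" using bspec[OF as(5), of "of_real y"] r by (simp add: N_def)
  then have "exp (-B) \<le> exp B / 2 ^ N" using as(6) ge by linarith
  \<comment> \<open>The zeros are counted again through the bound on \<open>g\<close>: the exponent
    above is rounded up and would exceed 3B for small \<open>B\<close>.\<close>
  then have "2 ^ N \<le> exp (2 * B)" by (simp add: field_simps exp_minus flip: exp_add)
  then have "ln (2 ^ N) \<le> ln (exp (2*B))" by (subst ln_le_cancel_iff) auto
  then have "real N * ln 2 \<le> 2 * B" by (simp add: ln_realpow)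
  moreover have "real N * (2/3) \<le> real N * ln 2" using ln2_ge_two_thirds by (intro mult_left_mono) auto
  ultimately have N3: "real N \<le> 3 * B" by linarith
  have glow: "norm (g (of_real x)) \<ge> exp (-6*B)" if "x \<in> I" for x
  proof (rule zero_free_lower_bound[where r=r and y="of_real y" and g=g])
    show "g holomorphic_on ball (of_real y) r"
      using as(2) by (rule holomorphic_on_subset) (use S r in force)
    fix z assume z: "z \<in> ball (complex_of_real y) r"
    show "g z \<noteq> 0" using as(4) z by auto
    have "norm (g z) \<le> exp B / 2 ^ length as" using as(5) z r by auto
    also have "\<dots> \<le> exp B / 1" by (intro divide_left_mono) auto
    finally show "norm (g z) \<le> exp B" by simp
  next
    show "exp (-B) \<le> norm (g (of_real y))" using as(6) ge by simp
  qed (use cI[OF that] B r in auto)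
  define P where "P x = (\<Prod>a\<leftarrow>as. norm (complex_of_real x - a) / r)" for x
  have P: "norm (f (of_real x)) = P x * norm (g (of_real x))" if "x \<in> I" for x
  proof -
    have "of_real x \<in> S" using cI[OF that] S(2) r by force
    then have "norm (f (of_real x)) = norm (\<Prod>a\<leftarrow>as. (of_real x - a) / of_real r) * norm (g (of_real x))"
      using as(3) by (simp add: norm_mult)
    also have "norm (\<Prod>a\<leftarrow>as. (complex_of_real x - a) / of_real r) = P x"
      unfolding P_def using r by (induction as) (auto simp: norm_mult norm_divide)
    finally show ?thesis .
  qed
  have Psmall: "P x \<le> exp (- (t - 6) * B)" if "x \<in> E" for x
  proof -
    have "P x * exp (-6*B) \<le> P x * norm (g (of_real x))"
      using glow[of x] that r by (intro mult_left_mono) (auto simp: E_def P_def intro!: prod_list_nonneg)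
    also have "\<dots> \<le> exp (-t*B)" using that P[of x] by (auto simp: E_def)
    finally have "P x \<le> exp (-t*B) * exp (6*B)"
      by (simp add: exp_minus field_simps)
    then show ?thesis by (simp add: algebra_simps flip: exp_add)
  qed
  have "emeasure lborel E \<le> ennreal (5 * exp 1 * r * exp (-t/6))"
  proof (cases "t \<le> 6")
    \<comment> \<open>Here the claimed bound exceeds the length \<open>r\<close> of
      \<open>I\<close>.\<close>
    case True
    have "emeasure lborel E \<le> emeasure lborel I" by (intro emeasure_mono) (auto simp: E_def I_def)
    also have "\<dots> = ennreal (1 * r * 1)" using r by (simp add: I_def)
    also have "\<dots> \<le> ennreal (5 * r * exp (1 - t/6))"
      using True r by (intro ennreal_leI mult_mono) auto
    also have "5 * r * exp (1 - t/6) = 5 * exp 1 * r * exp (-t/6)" by (simp add: mult_ac flip: exp_add)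
    finally show ?thesis .
  next
    case False
    show ?thesis
    proof (cases "N = 0")
      case True
      then have "P x = 1" for x by (simp add: P_def N_def)
      moreover have "exp (- (t - 6) * B) < 1" using False B by (simp add: mult_neg_pos)
      ultimately have "E = {}" using Psmall by fastforce
      then show ?thesis by simp
    next
      case N0: False
      define c where "c i = Re (as ! i)" for i
      define h where "h x = (\<Sum>i<N. (\<bar>x - c i\<bar> / r) powr (-1/2))" for x
      \<comment> \<open>Since \<open>0 powr (-1/2)\<close> is 0, the sum \<open>h\<close> misses the
        singularity at the points \<open>c i\<close> themselves. They are split off as a finite null
        set.\<close>
      define Z where "Z = c ` {..<N}"
      have sub: "E \<subseteq> Z \<union> {x\<in>I. 1 \<le> ennreal (exp (- (t-6)/6) / N) * ennreal (h x)}"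
      proof
        fix x assume x: "x \<in> E"
        show "x \<in> Z \<union> {x\<in>I. 1 \<le> ennreal (exp (- (t-6)/6) / N) * ennreal (h x)}"
        proof (cases "x \<in> Z")
          case xZ: False
          define p where "p i = norm (complex_of_real x - as ! i) / r" for i
          have cp: "\<bar>x - c i\<bar> / r \<le> p i" for i
            using abs_Re_le_cmod[of "complex_of_real x - as ! i"] r
            by (simp add: p_def c_def divide_right_mono)
          have cpos: "\<bar>x - c i\<bar> / r > 0" if "i < N" for i
          proof -
            have "x \<noteq> c i" using xZ that by (auto simp: Z_def)
            then show ?thesis using r by (intro divide_pos_pos) auto
          qed
          have ppos: "p i > 0" if "i < N" for i using cp[of i] cpos[OF that] by linarith
          have PP: "P x = (\<Prod>i<N. p i)"
            unfolding P_def p_def N_def by (simp add: prod.list_conv_set_nth atLeast0LessThan)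
          have Ppos: "P x > 0" unfolding PP using ppos by (intro prod_pos) auto
          \<comment> \<open>Because 2N <= 6B, the root of order 2N of \<open>1 / P x\<close> is
            still at least exp((t-6)/6). In this way both \<open>B\<close> and the number of zeros
            leave the exponent.\<close>
          have "exp ((t-6)/6) = exp (- ((t - 6) * B)) powr (-1/(6*B))"
            using B by (simp add: powr_def)
          also have "\<dots> = exp ((t-6) * B * (1/(2*(3*B))))" by (simp add: powr_def)
          also have "\<dots> \<le> exp ((t-6) * B * (1/(2*N)))"
            using N3 N0 False B by (intro iffD2[OF exp_le_cancel_iff] mult_left_mono divide_left_mono) auto
          also have "\<dots> = exp (- (t - 6) * B) powr (-1/(2*N))" by (simp add: powr_def algebra_simps diff_divide_distrib)
          also have "\<dots> \<le> P x powr (-1/(2*N))"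
            using Psmall[OF x] Ppos by (intro powr_mono2') auto
          also have "\<dots> = (\<Prod>i<N. p i powr (-1/2)) powr (1/N)"
            unfolding PP by (subst prod_powr_distrib[symmetric]) (use ppos in \<open>auto simp: powr_powr less_imp_le\<close>)
          also have "\<dots> \<le> (\<Sum>i<N. p i powr (-1/2) / N)"
            using arith_geom_mean[of "{..<N}" "\<lambda>i. p i powr (-1/2)"] N0 by auto
          also have "\<dots> \<le> (\<Sum>i<N. (\<bar>x - c i\<bar> / r) powr (-1/2) / N)"
            using cp cpos by (intro sum_mono divide_right_mono powr_mono2') auto
          also have "\<dots> = h x / N" by (simp add: h_def sum_divide_distrib)
          finally have "exp ((t-6)/6) \<le> h x / N" .
          then have "exp (- (t-6)/6) * exp ((t-6)/6) \<le> exp (- (t-6)/6) * (h x / N)"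
            by (intro mult_left_mono) auto
          moreover have "exp (- (t-6)/6) * exp ((t-6)/6) = 1" unfolding exp_add[symmetric] by (simp add: field_simps)
          ultimately have "1 \<le> exp (- (t-6)/6) / N * h x" by simp
          moreover have "h x \<ge> 0" unfolding h_def by (intro sum_nonneg) auto
          ultimately show ?thesis using x
            by (auto simp: E_def ennreal_mult[symmetric] simp flip: ennreal_1 intro!: ennreal_leI)
        qed auto
      qed
      have [measurable]: "h \<in> borel_measurable borel" unfolding h_def by measurable
      have meas: "{x\<in>I. 1 \<le> ennreal (exp (- (t-6)/6) / N) * ennreal (h x)} \<in> sets lborel"
        unfolding I_def by measurable
      have "emeasure lborel Z = 0" by (intro emeasure_lborel_countable) (auto simp: Z_def countable_finite)
      have "emeasure lborel E \<le> emeasure lborel (Z \<union> {x\<in>I. 1 \<le> ennreal (exp (- (t-6)/6) / N) * ennreal (h x)})"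
        using meas by (intro emeasure_mono[OF sub] sets.Un) (auto simp: Z_def intro!: borel_closed finite_imp_closed)
      also have "\<dots> \<le> emeasure lborel Z + emeasure lborel {x\<in>I. 1 \<le> ennreal (exp (- (t-6)/6) / N) * ennreal (h x)}"
        using meas by (intro emeasure_subadditive) (auto simp: Z_def intro!: borel_closed finite_imp_closed)
      also have "\<dots> = emeasure lborel {x\<in>I. 1 \<le> ennreal (exp (- (t-6)/6) / N) * ennreal (h x)}"
        using \<open>emeasure lborel Z = 0\<close> by simp
      also have "\<dots> \<le> ennreal (exp (- (t-6)/6) / N) * (\<integral>\<^sup>+x\<in>I. ennreal (h x) \<partial>lborel)"
        using nn_integral_Markov_inequality[of "\<lambda>x. ennreal (h x)" I lborel "ennreal (exp (- (t-6)/6) / N)"]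
        by (auto simp: I_def)
      also have "(\<integral>\<^sup>+x\<in>I. ennreal (h x) \<partial>lborel) = (\<Sum>i<N. \<integral>\<^sup>+x\<in>I. ennreal ((\<bar>x - c i\<bar> / r) powr (-1/2)) \<partial>lborel)"
        unfolding h_def by (subst nn_integral_sum[symmetric]) 
          (auto simp: sum_distrib_right sum_ennreal[symmetric] I_def simp del: sum_ennreal)
      also have "\<dots> \<le> (\<Sum>i<N. ennreal (5 * r))"
      proof (intro sum_mono)
        fix i assume "i \<in> {..<N}"
        then have "as ! i \<in> cball (of_real y) r" using as(1) nth_mem N_def by blast
        then have "\<bar>y - c i\<bar> \<le> r"
          using abs_Re_le_cmod[of "of_real y - as ! i"] by (simp add: c_def dist_norm)
        then show "(\<integral>\<^sup>+x\<in>I. ennreal ((\<bar>x - c i\<bar> / r) powr (-1/2)) \<partial>lborel) \<le> ennreal (5 * r)"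
          unfolding I_def using nn_integral_inverse_sqrt_le r by blast
      qed
      also have "\<dots> = ennreal (N * (5 * r))" using r by (simp add: ennreal_mult ennreal_of_nat_eq_real_of_nat)
      also have "ennreal (exp (- (t-6)/6) / N) * \<dots> = ennreal (exp (- (t-6)/6) / N * (N * (5 * r)))"
        using r by (subst ennreal_mult) auto
      also have "exp (- (t-6)/6) / N * (N * (5 * r)) = 5 * exp 1 * r * exp (-t/6)"
      proof -
        have "exp (- (t-6)/6) = exp 1 * exp (-t/6)" unfolding exp_add[symmetric] by (simp add: field_simps)
        then show ?thesis using N0 by simp
      qed
      finally show ?thesis by (simp add: mult_left_mono)
    qed
  qed
  then show ?thesis by (simp add: E_def I_def)
qed

section \<open>Orbit averages\<close>

lemma disc_chord:
  assumes "\<bar>t\<bar> \<le> \<rho>"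
  shows "Complex x t \<in> cball 0 \<rho> \<longleftrightarrow> \<bar>x\<bar> \<le> sqrt (\<rho>\<^sup>2 - t\<^sup>2)"
proof -
  have "Complex x t \<in> cball 0 \<rho> \<longleftrightarrow> x\<^sup>2 + t\<^sup>2 \<le> \<rho>\<^sup>2"
    using real_sqrt_le_iff[of "x\<^sup>2 + t\<^sup>2" "\<rho>\<^sup>2"] assms by (simp add: cmod_def)
  also have "\<dots> \<longleftrightarrow> x\<^sup>2 \<le> \<rho>\<^sup>2 - t\<^sup>2" by linarith
  also have "\<dots> \<longleftrightarrow> \<bar>x\<bar> \<le> sqrt (\<rho>\<^sup>2 - t\<^sup>2)"
    using real_sqrt_le_iff[of "x\<^sup>2" "\<rho>\<^sup>2 - t\<^sup>2"] by simp
  finally show ?thesis .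
qed

text \<open>Comparison with two squares: the circumscribed one gives finiteness, the inscribed one
  of side \<rho> the lower bound, by which a boundary error will be divided.\<close>

lemma disc_area:
  assumes "\<rho> > 0"
  obtains A where "plane_integral (indicator (cball 0 \<rho>)) = ennreal A" "\<rho>\<^sup>2 \<le> A"
proof -
  have rows: "plane_integral (indicator S) = (\<integral>\<^sup>+t. \<integral>\<^sup>+x. indicator S (Complex x t) \<partial>lborel \<partial>lborel)"
    if "S \<in> sets borel" for S :: "complex set"
    by (rule plane_integral_rows) (use that in measurable)
  have box: "(\<integral>\<^sup>+t. \<integral>\<^sup>+x. indicator {-s..s::real} x * indicator {-s..s} t \<partial>lborel \<partial>lborel) = ennreal (4 * s\<^sup>2)" if "s > 0" for s :: real
  proof -
    have "(\<integral>\<^sup>+t. \<integral>\<^sup>+x. indicator {-s..s::real} x * indicator {-s..s} t \<partial>lborel \<partial>lborel) = (\<integral>\<^sup>+t\<in>{-s..s}. ennreal (2 * s) \<partial>lborel)"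
      using that by (intro nn_integral_cong) (simp add: nn_integral_multc)
    also have "\<dots> = ennreal (2 * s) * ennreal (2 * s)" using that by (subst nn_integral_cmult_indicator) auto
    also have "\<dots> = ennreal (4 * s\<^sup>2)" using that by (subst ennreal_mult[symmetric]) (auto simp: power2_eq_square)
    finally show ?thesis .
  qed
  have "plane_integral (indicator (cball 0 \<rho>)) \<le> (\<integral>\<^sup>+t. \<integral>\<^sup>+x. indicator {-\<rho>..\<rho>} x * indicator {-\<rho>..\<rho>} t \<partial>lborel \<partial>lborel)"
    unfolding rows[OF borel_closed[OF closed_cball]]
  proof (intro nn_integral_mono)
    fix t x show "indicator (cball 0 \<rho>) (Complex x t) \<le> (indicator {-\<rho>..\<rho>} x * indicator {-\<rho>..\<rho>} t :: ennreal)"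
      using abs_Re_le_cmod[of "Complex x t"] abs_Im_le_cmod[of "Complex x t"]
      by (auto simp: indicator_def simp del: cmod_def)
  qed
  then have "plane_integral (indicator (cball 0 \<rho>)) \<le> ennreal (4 * \<rho>\<^sup>2)" using box[OF assms] by simp
  then obtain A where A: "plane_integral (indicator (cball 0 \<rho>)) = ennreal A" "A \<ge> 0"
    by (metis ennreal_cases ennreal_neq_top top.extremum_uniqueI)
  have "(\<integral>\<^sup>+t. \<integral>\<^sup>+x. indicator {-(\<rho>/2)..\<rho>/2} x * indicator {-(\<rho>/2)..\<rho>/2} t \<partial>lborel \<partial>lborel) \<le> plane_integral (indicator (cball 0 \<rho>))"
    unfolding rows[OF borel_closed[OF closed_cball]]
  proof (intro nn_integral_mono)
    fix t x
    show "(indicator {-(\<rho>/2)..\<rho>/2} x * indicator {-(\<rho>/2)..\<rho>/2} t :: ennreal) \<le> indicator (cball 0 \<rho>) (Complex x t)"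
      using cmod_le[of "Complex x t"] by (auto simp: indicator_def simp del: cmod_def)
  qed
  then have "ennreal (\<rho>\<^sup>2) \<le> ennreal A" using box[of "\<rho>/2"] assms A by (simp add: power2_eq_square)
  then show ?thesis using that A by simp
qed

lemma measurable_indicator_cball [measurable]:
  "(indicator (cball z \<rho>) :: complex \<Rightarrow> ennreal) \<in> borel_measurable borel"
  by (intro borel_measurable_indicator borel_closed closed_cball)

context peaked
begin

lemma measurable_line:
  assumes "\<bar>t\<bar> < \<delta>"
  shows "(\<lambda>x. ennreal (M - ln (N (Complex x t)))) \<in> borel_measurable borel"
  using borel_measurable_continuous_onI[OF line_cont[OF assms]] by measurable

lemma line_integral:
  assumes M: "\<And>z. z \<in> ostrip \<delta> \<Longrightarrow> ln (N z) \<le> M" and t: "\<bar>t\<bar> < \<delta>"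
  shows "(\<integral>\<^sup>+x\<in>{0..<1}. ennreal (M - ln (N (Complex x t))) \<partial>lborel) = ennreal (M - mean t)" "mean t \<le> M"
proof -
  have c: "continuous_on {0..1} (\<lambda>x. ln (N (Complex x t)))"
    using line_cont[OF t] by (rule continuous_on_subset) auto
  have le: "ln (N (Complex x t)) \<le> M" for x using t by (intro M) (simp add: ostrip_def)
  have I: "((\<lambda>x. M - ln (N (Complex x t))) has_integral (M - mean t)) {0..1}"
    using has_integral_diff[OF has_integral_const_real[of M 0 1] integrable_integral[OF integrable_continuous_real[OF c]]]
    by (simp add: mean_def)
  show "mean t \<le> M" using has_integral_nonneg[OF I] le by simp
  have "(\<integral>\<^sup>+x\<in>{0..<1}. ennreal (M - ln (N (Complex x t))) \<partial>lborel) = (\<integral>\<^sup>+x. ennreal (indicator {0..1} x * (M - ln (N (Complex x t)))) \<partial>lborel)"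
    by (rule nn_integral_cong_AE, rule AE_mp[OF AE_lborel_singleton[of 1]]) (auto simp: indicator_def)
  also have "\<dots> = ennreal (M - mean t)"
    by (rule nn_integral_has_integral_lebesgue[OF _ I]) (use le in auto)
  finally show "(\<integral>\<^sup>+x\<in>{0..<1}. ennreal (M - ln (N (Complex x t))) \<partial>lborel) = ennreal (M - mean t)" .
qed

context
  fixes M T \<beta> :: real and P :: int and Q :: nat
  assumes M: "\<And>z. z \<in> ostrip \<delta> \<Longrightarrow> ln (N z) \<le> M" and T: "0 < T" "T < \<delta>"
    and Q: "Q > 0" and cop: "coprime P (int Q)" and approx: "\<bar>\<beta> - of_int P / real Q\<bar> \<le> 1 / (real Q)\<^sup>2"
begin

text \<open>Treats one horizontal chord of the disc. By convexity of the means the mean deficit on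
  the line through it is at least \<open>a\<close>, and the orbit of the chord collects one copy of
  it per 1/Q of length, apart from the ends.\<close>

lemma row_lower_bound:
  assumes t: "\<bar>Im z + t\<bar> \<le> h" "h \<le> T" and rho: "\<bar>t\<bar> \<le> \<rho>"
  defines "a \<equiv> (M - mean 0) * (1 - h / T)"
  shows "ennreal (2 * sqrt (\<rho>\<^sup>2 - t\<^sup>2) * real Q * a) \<le>
    (\<Sum>j<Q. \<integral>\<^sup>+x. ennreal (indicator (cball 0 \<rho>) (Complex x t) * (M - ln (N (z + of_real (real j * \<beta>) + Complex x t)))) \<partial>lborel) + ennreal (3 * a)"
proof -
  define s where "s = sqrt (\<rho>\<^sup>2 - t\<^sup>2)"
  have "t\<^sup>2 \<le> \<rho>\<^sup>2" using power_mono[OF rho, of 2] by simp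
  then have s: "s \<ge> 0" by (simp add: s_def)
  define \<tau> where "\<tau> = Im z + t"
  have \<tau>: "\<bar>\<tau>\<bar> \<le> h" "\<bar>\<tau>\<bar> \<le> T" "\<bar>\<tau>\<bar> < \<delta>" using t T by (auto simp: \<tau>_def)
  have A0: "M - mean 0 \<ge> 0" using line_integral(2)[of M 0] M T by simp
  have a0: "a \<ge> 0" unfolding a_def using A0 t T by (intro mult_nonneg_nonneg) auto
  define w where "w x = ennreal (M - ln (N (Complex (x + Re z) \<tau>)))" for x
  have wm: "w \<in> borel_measurable borel" unfolding w_def
    by (rule measurable_compose[OF _ measurable_line[OF \<tau>(3)], of "\<lambda>x. x + Re z"]) measurable
  have wp: "w (x + 1) = w x" for x
    using line_per[OF \<tau>(3), of "x + Re z"] by (simp add: w_def algebra_simps)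
  have "a \<le> M - mean \<tau>"
  proof -
    have "mean \<tau> \<le> mean 0 + \<bar>\<tau>\<bar> / T * (M - mean 0)" by (rule mean_le[OF T M \<tau>(2)])
    also have "\<dots> \<le> mean 0 + h / T * (M - mean 0)" using \<tau>(1) T A0 by (intro add_left_mono mult_right_mono divide_right_mono) auto
    finally show ?thesis by (simp add: a_def algebra_simps)
  qed
  then have wi: "ennreal a \<le> (\<integral>\<^sup>+x\<in>{0..<1}. w x \<partial>lborel)"
  proof -
    have "(\<integral>\<^sup>+x\<in>{0..<1}. w x \<partial>lborel) = (\<integral>\<^sup>+x\<in>{0+Re z..<1+Re z}. ennreal (M - ln (N (Complex x \<tau>))) \<partial>lborel)"
      unfolding w_def by (rule nn_integral_shift[OF measurable_line[OF \<tau>(3)]])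
    also have "\<dots> = (\<integral>\<^sup>+x\<in>{0..<1}. ennreal (M - ln (N (Complex x \<tau>))) \<partial>lborel)"
      using nn_integral_period[OF measurable_line[OF \<tau>(3), of M], where p=1 and a="Re z"] line_per[OF \<tau>(3)] by (simp add: add.commute)
    also have "\<dots> = ennreal (M - mean \<tau>)" by (rule line_integral) (use M \<tau> in auto)
    finally show ?thesis using \<open>a \<le> M - mean \<tau>\<close> by (simp add: ennreal_leI)
  qed
  \<comment> \<open>Two copies are lost at the ends of the chord and one by rounding down, which
    gives the 3 in the conclusion. On short chords truncation yields \<open>k = 0\<close>, and the
    term \<open>3 * a\<close> alone suffices.\<close>
  define k where "k = nat \<lfloor>2 * s * real Q - 2\<rfloor>"
  have "of_nat k * ennreal a \<le> of_nat k * (\<integral>\<^sup>+x\<in>{0..<1}. w x \<partial>lborel)" by (intro mult_left_mono wi) auto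
  also have "\<dots> \<le> (\<Sum>j<Q. \<integral>\<^sup>+x. ennreal (indicator (cball 0 \<rho>) (Complex x t) * (M - ln (N (z + of_real (real j * \<beta>) + Complex x t)))) \<partial>lborel)"
  proof (cases "k = 0")
    case False
    then have "real k = of_int \<lfloor>2 * s * real Q - 2\<rfloor>" by (simp add: k_def)
    then have "real k \<le> 2 * s * real Q - 2" by linarith
    then have "real k \<le> (s - (- s)) * real Q - 2" by simp
    from orbit_integral_ge[of w Q P \<beta>, OF wm wp Q cop approx this]
    have "of_nat k * (\<integral>\<^sup>+x\<in>{0..<1}. w x \<partial>lborel) \<le> (\<Sum>j<Q. \<integral>\<^sup>+x\<in>{- s..<s}. w (x + real j * \<beta>) \<partial>lborel)" .
    also have "\<dots> \<le> (\<Sum>j<Q. \<integral>\<^sup>+x. ennreal (indicator (cball 0 \<rho>) (Complex x t) * (M - ln (N (z + of_real (real j * \<beta>) + Complex x t)))) \<partial>lborel)"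
    proof (intro sum_mono nn_integral_mono)
      fix j and x :: real
      have eq: "w (x + real j * \<beta>) = ennreal (M - ln (N (z + of_real (real j * \<beta>) + Complex x t)))"
        unfolding w_def by (rule arg_cong[where f="\<lambda>v. ennreal (M - ln (N v))"]) (simp add: complex_eq_iff \<tau>_def)
      show "w (x + real j * \<beta>) * indicator {- s..<s} x \<le> ennreal (indicator (cball 0 \<rho>) (Complex x t) * (M - ln (N (z + of_real (real j * \<beta>) + Complex x t))))"
      proof (cases "x \<in> {-s..<s}")
        case True
        then have "Complex x t \<in> cball 0 \<rho>" unfolding disc_chord[OF rho] s_def[symmetric] by auto
        then show ?thesis unfolding eq indicator_def by (simp only: if_True) simp
      qed simp
    qed
    finally show ?thesis .
  qed simp
  finally have X: "of_nat k * ennreal a \<le> (\<Sum>j<Q. \<integral>\<^sup>+x. ennreal (indicator (cball 0 \<rho>) (Complex x t) * (M - ln (N (z + of_real (real j * \<beta>) + Complex x t)))) \<partial>lborel)" .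
  have "2 * s * real Q \<le> real k + 3" unfolding k_def by linarith
  then have "ennreal (2 * s * real Q * a) \<le> ennreal ((real k + 3) * a)"
    using a0 by (intro ennreal_leI mult_right_mono) auto
  also have "\<dots> = of_nat k * ennreal a + ennreal (3 * a)"
    using a0 by (simp add: distrib_right ennreal_plus ennreal_mult ennreal_of_nat_eq_real_of_nat)
  also have "\<dots> \<le> (\<Sum>j<Q. \<integral>\<^sup>+x. ennreal (indicator (cball 0 \<rho>) (Complex x t) * (M - ln (N (z + of_real (real j * \<beta>) + Complex x t)))) \<partial>lborel) + ennreal (3 * a)"
    by (rule add_right_mono[OF X])
  finally show ?thesis unfolding s_def .
qed

text \<open>Integrating the row estimates over the disc gives Q a times its area, less 3a on rows of
  total height 2\<rho>. The disc mean inequality bounds the same integral by the area times the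
  deficits at the centres. So the error 6 \<rho> a gets divided by an area of at least
  \<rho>^2.\<close>

lemma orbit_sum_upper:
  assumes h: "\<bar>Im z\<bar> + \<rho> \<le> h" "h \<le> T" and rho: "\<rho> > 0"
  shows "(\<Sum>j<Q. ln (N (z + of_real (real j * \<beta>)))) \<le> real Q * M - (M - mean 0) * (1 - h / T) * (real Q - 6 / \<rho>)"
proof -
  define a where "a = (M - mean 0) * (1 - h / T)"
  have A0: "M - mean 0 \<ge> 0" using line_integral(2)[of M 0] M T by simp
  have a0: "a \<ge> 0" unfolding a_def using A0 h T by (intro mult_nonneg_nonneg) auto
  obtain A where A: "plane_integral (indicator (cball 0 \<rho>)) = ennreal A" "\<rho>\<^sup>2 \<le> A" using disc_area[OF rho] .
  have Apos: "A > 0" using A(2) rho by (smt (verit) zero_less_power)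
  define zz where "zz j = z + of_real (real j * \<beta>)" for j
  have zin: "zz j \<in> ostrip \<delta>" for j unfolding zz_def using h T rho by (simp add: ostrip_def)
  have sub: "cball (zz j) \<rho> \<subseteq> ostrip \<delta>" for j
  proof
    fix v assume "v \<in> cball (zz j) \<rho>"
    then have "\<bar>Im (zz j - v)\<bar> \<le> \<rho>" using abs_Im_le_cmod[of "zz j - v"] by (simp add: dist_norm)
    then show "v \<in> ostrip \<delta>" using h T by (simp add: ostrip_def zz_def)
  qed
  define G where "G j \<zeta> = ennreal (indicator (cball 0 \<rho>) \<zeta> * (M - ln (N (zz j + \<zeta>))))" for j \<zeta>
  have [measurable]: "G j \<in> borel_measurable borel" for j unfolding G_def by (rule measurable_disc_integrand[OF sub])
  have [measurable]: "(\<lambda>x. G j (Complex x t)) \<in> borel_measurable borel" for j t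
    by (rule measurable_compose_continuous) (auto intro!: continuous_intros simp: Complex_eq)
  have "ennreal (real Q * a) * ennreal A = plane_integral (\<lambda>\<zeta>. ennreal (real Q * a) * indicator (cball 0 \<rho>) \<zeta>)"
    unfolding A(1)[symmetric] plane_integral_def
    by (rule nn_integral_cmult[symmetric])
       (use measurable_compose[OF measurable_pair_Complex measurable_indicator_cball] in simp)
  also have "\<dots> = (\<integral>\<^sup>+t. \<integral>\<^sup>+x. ennreal (real Q * a) * indicator (cball 0 \<rho>) (Complex x t) \<partial>lborel \<partial>lborel)"
    by (rule plane_integral_rows) measurable
  also have "\<dots> \<le> (\<integral>\<^sup>+t. (\<integral>\<^sup>+x. (\<Sum>j<Q. G j (Complex x t)) \<partial>lborel) + ennreal (3 * a) * indicator {-\<rho>..\<rho>} t \<partial>lborel)"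
  proof (rule nn_integral_mono)
    fix t :: real
    show "(\<integral>\<^sup>+x. ennreal (real Q * a) * indicator (cball 0 \<rho>) (Complex x t) \<partial>lborel)
       \<le> (\<integral>\<^sup>+x. (\<Sum>j<Q. G j (Complex x t)) \<partial>lborel) + ennreal (3 * a) * indicator {-\<rho>..\<rho>} t"
    proof (cases "\<bar>t\<bar> \<le> \<rho>")
      case False
      then have "Complex x t \<notin> cball 0 \<rho>" for x using abs_Im_le_cmod[of "Complex x t"] by (auto simp del: cmod_def)
      then show ?thesis by simp
    next
      case True
      define s where "s = sqrt (\<rho>\<^sup>2 - t\<^sup>2)"
      have "t\<^sup>2 \<le> \<rho>\<^sup>2" using power_mono[OF True, of 2] by simp
      then have s: "s \<ge> 0" by (simp add: s_def)
      have "(\<integral>\<^sup>+x. ennreal (real Q * a) * indicator (cball 0 \<rho>) (Complex x t) \<partial>lborel) = (\<integral>\<^sup>+x. ennreal (real Q * a) * indicator {-s..s} x \<partial>lborel)"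
      proof (rule nn_integral_cong)
        fix x show "ennreal (real Q * a) * indicator (cball 0 \<rho>) (Complex x t) = ennreal (real Q * a) * indicator {-s..s} x"
          using disc_chord[OF True, of x] unfolding s_def[symmetric] indicator_def
          by (auto simp: abs_le_iff simp del: mem_cball mem_cball_0)
      qed
      also have "\<dots> = ennreal (real Q * a) * ennreal (2 * s)" using s by (subst nn_integral_cmult_indicator) auto
      also have "\<dots> = ennreal (2 * s * real Q * a)" using s a0 by (subst ennreal_mult[symmetric]) (auto simp: mult_ac)
      also have "\<dots> \<le> (\<Sum>j<Q. \<integral>\<^sup>+x. G j (Complex x t) \<partial>lborel) + ennreal (3 * a)"
        unfolding G_def zz_def s_def a_def by (rule row_lower_bound) (use h True in auto)
      also have "(\<Sum>j<Q. \<integral>\<^sup>+x. G j (Complex x t) \<partial>lborel) = (\<integral>\<^sup>+x. (\<Sum>j<Q. G j (Complex x t)) \<partial>lborel)"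
        by (rule nn_integral_sum[symmetric]) measurable
      finally show ?thesis using True by (simp add: abs_le_iff)
    qed
  qed
  also have "\<dots> = plane_integral (\<lambda>\<zeta>. \<Sum>j<Q. G j \<zeta>) + ennreal (6 * \<rho> * a)"
  proof -
    have cm: "(\<lambda>p. Complex (snd p) (fst p)) \<in> borel_measurable (borel :: (real \<times> real) measure)"
      by (intro borel_measurable_continuous_onI) (auto intro!: continuous_intros simp: Complex_eq)
    have "(\<lambda>p. \<Sum>j<Q. G j (Complex (snd p) (fst p))) \<in> borel_measurable borel"
      by (rule borel_measurable_sum, rule measurable_compose[OF cm]) measurable
    then have m: "(\<lambda>(t, x). \<Sum>j<Q. G j (Complex x t)) \<in> borel_measurable (lborel \<Otimes>\<^sub>M lborel)"
      unfolding lborel_prod by (simp add: split_beta')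
    have m': "(\<lambda>t. \<integral>\<^sup>+x. (\<Sum>j<Q. G j (Complex x t)) \<partial>lborel) \<in> borel_measurable lborel"
      using lborel.borel_measurable_nn_integral[OF m] by simp
    have "(\<integral>\<^sup>+t. (\<integral>\<^sup>+x. (\<Sum>j<Q. G j (Complex x t)) \<partial>lborel) + ennreal (3 * a) * indicator {-\<rho>..\<rho>} t \<partial>lborel)
      = (\<integral>\<^sup>+t. (\<integral>\<^sup>+x. (\<Sum>j<Q. G j (Complex x t)) \<partial>lborel) \<partial>lborel) + (\<integral>\<^sup>+t. ennreal (3 * a) * indicator {-\<rho>..\<rho>} t \<partial>lborel)"
      by (rule nn_integral_add[OF m']) measurable
    also have "(\<integral>\<^sup>+t. ennreal (3 * a) * indicator {-\<rho>..\<rho>} t \<partial>lborel) = ennreal (3 * a) * ennreal (2 * \<rho>)"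
      using rho by (subst nn_integral_cmult_indicator) auto
    also have "\<dots> = ennreal (6 * \<rho> * a)" using a0 rho by (subst ennreal_mult[symmetric]) (auto simp: mult_ac)
    also have "(\<integral>\<^sup>+t. (\<integral>\<^sup>+x. (\<Sum>j<Q. G j (Complex x t)) \<partial>lborel) \<partial>lborel) = plane_integral (\<lambda>\<zeta>. \<Sum>j<Q. G j \<zeta>)"
      by (rule plane_integral_rows[symmetric]) measurable
    finally show ?thesis .
  qed
  also have "plane_integral (\<lambda>\<zeta>. \<Sum>j<Q. G j \<zeta>) = (\<Sum>j<Q. plane_integral (G j))"
    unfolding plane_integral_def
    by (rule nn_integral_sum) (use measurable_compose[OF measurable_pair_Complex] in simp)
  also have "\<dots> \<le> (\<Sum>j<Q. ennreal A * ennreal (M - ln (N (zz j))))"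
    unfolding G_def A(1)[symmetric] by (intro sum_mono disc_mean_le[OF M sub rho])
  also have "\<dots> = ennreal (\<Sum>j<Q. A * (M - ln (N (zz j))))"
    using Apos M zin by (subst sum_ennreal[symmetric]) (auto simp: ennreal_mult intro!: mult_nonneg_nonneg)
  finally have "ennreal (real Q * a * A) \<le> ennreal ((\<Sum>j<Q. A * (M - ln (N (zz j)))) + 6 * \<rho> * a)"
    using a0 Apos rho M zin by (subst ennreal_plus) (auto simp: ennreal_mult intro!: sum_nonneg mult_nonneg_nonneg add_right_mono)
  then have "real Q * a * A \<le> A * (\<Sum>j<Q. M - ln (N (zz j))) + 6 * \<rho> * a"
    using a0 Apos rho M zin by (subst (asm) ennreal_le_iff) (auto simp: sum_distrib_left intro!: add_nonneg_nonneg sum_nonneg mult_nonneg_nonneg)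
  then have "A * (real Q * a - (\<Sum>j<Q. M - ln (N (zz j)))) \<le> 6 * \<rho> * a" by (simp add: algebra_simps)
  then have "real Q * a - (\<Sum>j<Q. M - ln (N (zz j))) \<le> 6 * \<rho> * a / A" using Apos by (simp add: pos_le_divide_eq mult.commute)
  also have "\<dots> \<le> 6 * \<rho> * a / \<rho>\<^sup>2" using A(2) a0 rho Apos by (intro divide_left_mono) auto
  also have "\<dots> = a * (6 / \<rho>)" using rho by (simp add: power2_eq_square)
  finally have "real Q * a - (real Q * M - (\<Sum>j<Q. ln (N (zz j)))) \<le> a * (6 / \<rho>)" by (simp add: sum_subtractf)
  moreover have "a * (real Q - 6 / \<rho>) = real Q * a - a * (6 / \<rho>)" by (simp add: right_diff_distrib mult.commute)
  ultimately show ?thesis unfolding zz_def[symmetric] a_def[symmetric] by linarith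
qed

text \<open>If no point were good, the deficits over the interval would integrate to more than
  \<open>k\<close> copies of the mean deficit, where k <= Q/q + 3: two copies for the ends, one for
  rounding. The slack \<open>e\<close> makes the contradiction strict.\<close>

lemma orbit_sum_good_point:
  assumes q: "q > 0" and e: "e > 0"
  obtains y where "x0 \<le> y" "y < x0 + 1 / real q"
    "(\<Sum>j<Q. ln (N (of_real (y + real j * \<beta>)))) \<ge> real Q * M - (real Q + 3 * real q) * (M - mean 0) - e"
proof (rule ccontr)
  assume nt: "\<not> thesis"
  note good = that
  have neg: "(\<Sum>j<Q. ln (N (of_real (y + real j * \<beta>)))) < real Q * M - (real Q + 3 * real q) * (M - mean 0) - e"
    if "x0 \<le> y" "y < x0 + 1 / real q" for y
    using good[OF that] nt by linarith
  have d0: "\<bar>0\<bar> < \<delta>" using delta_pos by simp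
  have A0: "M - mean 0 \<ge> 0" using line_integral(2)[of M 0] M T by simp
  define w where "w x = ennreal (M - ln (N (Complex x 0)))" for x
  have wm [measurable]: "w \<in> borel_measurable borel" unfolding w_def by (rule measurable_line[OF d0])
  have wp: "w (x + 1) = w x" for x using line_per[OF d0] by (simp add: w_def)
  have le: "ln (N (Complex x 0)) \<le> M" for x using delta_pos by (intro M) (simp add: ostrip_def)
  define c where "c = (real Q + 3 * real q) * (M - mean 0) + e"
  define k where "k = nat \<lceil>real Q / real q + 2\<rceil>"
  have "0 \<le> real Q / real q" by simp
  then have k: "real Q / real q + 2 \<le> real k" "real k \<le> real Q / real q + 3" unfolding k_def by linarith+
  have "c / real q = (real Q / real q + 3) * (M - mean 0) + e / real q"
    using q by (simp add: c_def field_simps)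
  moreover have "real k * (M - mean 0) \<le> (real Q / real q + 3) * (M - mean 0)" using k A0 by (intro mult_right_mono) auto
  moreover have "e / real q > 0" using e q by simp
  ultimately have kc: "real k * (M - mean 0) < c / real q" by linarith
  have "ennreal (c / real q) = (\<integral>\<^sup>+x\<in>{x0..<x0 + 1 / real q}. ennreal c \<partial>lborel)"
  proof -
    have "c \<ge> 0" unfolding c_def using A0 e by (intro add_nonneg_nonneg mult_nonneg_nonneg) auto
    then have "ennreal (c / real q) = ennreal c * ennreal (1 / real q)" by (subst ennreal_mult[symmetric]) auto
    then show ?thesis by (subst nn_integral_cmult_indicator) auto
  qed
  also have "\<dots> \<le> (\<integral>\<^sup>+x\<in>{x0..<x0 + 1 / real q}. (\<Sum>j<Q. w (x + real j * \<beta>)) \<partial>lborel)"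
  proof (intro nn_integral_mono)
    fix x
    show "ennreal c * indicator {x0..<x0 + 1 / real q} x \<le> (\<Sum>j<Q. w (x + real j * \<beta>)) * indicator {x0..<x0 + 1 / real q} x"
    proof (cases "x \<in> {x0..<x0 + 1 / real q}")
      case True
      then have "c \<le> (\<Sum>j<Q. M - ln (N (Complex (x + real j * \<beta>) 0)))"
        using neg[of x] by (simp add: c_def sum_subtractf complex_of_real_def algebra_simps)
      then have "ennreal c \<le> (\<Sum>j<Q. w (x + real j * \<beta>))"
        unfolding w_def using le by (subst sum_ennreal) (auto intro!: ennreal_leI)
      then show ?thesis using True by simp
    qed simp
  qed
  also have "\<dots> = (\<Sum>j<Q. \<integral>\<^sup>+x\<in>{x0..<x0 + 1 / real q}. w (x + real j * \<beta>) \<partial>lborel)"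
    by (subst nn_integral_sum[symmetric]) (auto simp: sum_distrib_right)
  also have "\<dots> \<le> of_nat k * (\<integral>\<^sup>+x\<in>{0..<1}. w x \<partial>lborel)"
    by (rule orbit_integral_le[OF wm wp Q cop approx]) (use k q in \<open>simp add: field_simps\<close>)
  also have "(\<integral>\<^sup>+x\<in>{0..<1}. w x \<partial>lborel) = ennreal (M - mean 0)"
    unfolding w_def by (rule line_integral) (use M delta_pos in auto)
  also have "of_nat k * ennreal (M - mean 0) = ennreal (real k * (M - mean 0))"
    using A0 by (simp add: ennreal_mult ennreal_of_nat_eq_real_of_nat)
  finally show False using kc A0 by (subst (asm) ennreal_le_iff) auto
qed

text \<open>Discs of radius 2/q around points of height at most 6/q stay below height 8/q. The
  boundary error 6/\<rho> = 3q is at most 3Q/q because q^2 <= Q. The 4 in place of 3 matches the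
  loss at the good point, so that a single \<open>B\<close> serves for both bounds in Cartan's
  estimate.\<close>

lemma orbit_sum_uniform_bound:
  assumes q: "q > 0" "8 / real q \<le> T" "(real q)\<^sup>2 \<le> real Q" and A1: "M - mean 0 \<le> A1" "A1 > 0"
    and z: "\<bar>Im z\<bar> \<le> 6 / real q"
  shows "(\<Sum>j<Q. ln (N (z + of_real (real j * \<beta>)))) \<le> real Q * mean 0 + real Q / real q * A1 * (8 / T + 4)"
proof -
  define A where "A = M - mean 0"
  have A0: "A \<ge> 0" unfolding A_def using line_integral(2)[of M 0] M T by simp
  have "(\<Sum>j<Q. ln (N (z + of_real (real j * \<beta>)))) \<le> real Q * M - A * (1 - 8 / real q / T) * (real Q - 6 / (2 / real q))"
    unfolding A_def by (rule orbit_sum_upper) (use q z in \<open>auto simp: field_simps\<close>)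
  also have "\<dots> = real Q * mean 0 + A * (8 / T * (real Q / real q) + 3 * real q - 24 / T)"
    using q T by (simp add: A_def field_simps)
  also have "\<dots> \<le> real Q * mean 0 + A * (8 / T * (real Q / real q) + 4 * (real Q / real q))"
  proof (intro add_left_mono mult_left_mono A0)
    have "real q \<le> real Q / real q" using q by (simp add: power2_eq_square field_simps)
    moreover have "24 / T \<ge> 0" using T by simp
    ultimately show "8 / T * (real Q / real q) + 3 * real q - 24 / T \<le> 8 / T * (real Q / real q) + 4 * (real Q / real q)"
      using q by linarith
  qed
  also have "\<dots> \<le> real Q * mean 0 + A1 * (8 / T * (real Q / real q) + 4 * (real Q / real q))"
    using A1 T by (intro add_left_mono mult_right_mono) (auto simp: A_def intro!: add_nonneg_nonneg)
  finally show ?thesis by (simp add: algebra_simps)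
qed

text \<open>The product along the orbit of the functions touching at a good point \<open>y\<close> is comparable to
  \<open>exp (real Q * mean 0)\<close> at \<open>y\<close> and not much larger nearby, so Cartan's estimate applies to it.\<close>

lemma orbit_sum_deviation_local:
  assumes q: "q > 0" "8 / real q \<le> T" "(real q)\<^sup>2 \<le> real Q" and A1: "M - mean 0 \<le> A1" "A1 > 0"
  shows "emeasure lborel {x\<in>{x0..<x0 + 1 / real q}. (\<Sum>j<Q. ln (N (of_real (x + real j * \<beta>)))) < real Q * (mean 0 - \<kappa>)}
    \<le> ennreal (10 * exp 1 / real q * exp (- (\<kappa> * real q / (A1 * (8 / T + 4))) / 6))"
proof -
  define B where "B = real Q / real q * A1 * (8 / T + 4)"
  have B: "B > 0" using A1 T q Q by (simp add: B_def add_pos_pos)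
  \<comment> \<open>Chosen so that t B = Q \<kappa>, the depth of the deviation.\<close>
  define t where "t = real Q * \<kappa> / B"
  have t: "t = \<kappa> * real q / (A1 * (8 / T + 4))" using Q q T A1 by (simp add: t_def B_def)
  have q2: "real q * real q \<le> real Q" using q by (simp add: power2_eq_square)
  \<comment> \<open>This slack and the loss 3q (M - mean 0) at the good point add up to at most 4 q
    A1, which is below \<open>B\<close>.\<close>
  define e where "e = real q * A1"
  have e: "e > 0" using q A1 by (simp add: e_def)
  obtain y where y: "x0 \<le> y" "y < x0 + 1 / real q"
    "(\<Sum>j<Q. ln (N (of_real (y + real j * \<beta>)))) \<ge> real Q * M - (real Q + 3 * real q) * (M - mean 0) - e"
    using orbit_sum_good_point[OF q(1) e] by blast
  \<comment> \<open>Every point of the interval is within 1/q = r/2 of \<open>y\<close>, and 3r =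
    6/q is the height up to which \<open>orbit_sum_uniform_bound\<close> holds.\<close>
  define r where "r = 2 / real q"
  have r: "r > 0" using q by (simp add: r_def)
  have yin: "of_real (y + real j * \<beta>) \<in> ostrip \<delta>" for j using delta_pos by (simp add: ostrip_def)
  obtain g where g: "\<And>j. g j holomorphic_on ostrip \<delta>" "\<And>j z. z \<in> ostrip \<delta> \<Longrightarrow> norm (g j z) \<le> N z"
    "\<And>j. norm (g j (of_real (y + real j * \<beta>))) = N (of_real (y + real j * \<beta>))"
    using touch[OF yin] by metis
  define f where "f z = of_real (exp (- (real Q * mean 0))) * (\<Prod>j<Q. g j (z + of_real (real j * \<beta>)))" for z
  have fle: "norm (f z) \<le> exp (- (real Q * mean 0) + (\<Sum>j<Q. ln (N (z + of_real (real j * \<beta>)))))" if "z \<in> ostrip \<delta>" for z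
  proof -
    have "norm (f z) \<le> exp (- (real Q * mean 0)) * (\<Prod>j<Q. N (z + of_real (real j * \<beta>)))"
      unfolding f_def norm_mult prod_norm[symmetric] using g(2) that
      by (intro mult_mono prod_mono) (auto simp del: of_real_mult intro!: prod_nonneg)
    also have "(\<Prod>j<Q. N (z + of_real (real j * \<beta>))) = (\<Prod>j<Q. exp (ln (N (z + of_real (real j * \<beta>)))))"
      using pos that by (intro prod.cong refl) (simp del: of_real_mult)
    finally show ?thesis by (simp only: exp_add exp_sum[OF finite_lessThan])
  qed
  have c1: "emeasure lborel {x\<in>{y - r/2..y + r/2}. norm (f (of_real x)) \<le> exp (-t*B)} \<le> ennreal (5 * exp 1 * r * exp (-t/6))"
  proof (rule cartan_estimate[OF r open_ostrip])
    have im: "\<bar>Im z\<bar> \<le> 6 / real q" if "z \<in> cball (of_real y) (3 * r)" for z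
      using that abs_Im_le_cmod[of "of_real y - z"] by (simp add: dist_norm r_def)
    have T6: "6 / real q < \<delta>" 
    proof -
      have "6 / real q < 8 / real q" using q by (simp add: divide_strict_right_mono)
      then show ?thesis using q T by linarith
    qed
    show sub: "cball (complex_of_real y) (3 * r) \<subseteq> ostrip \<delta>" using im T6 by (force simp: ostrip_def)
    show "f holomorphic_on ostrip \<delta>"
      unfolding f_def by (intro holomorphic_intros holomorphic_on_compose_gen[OF _ g(1), unfolded o_def]) (auto simp del: of_real_mult)
    show "norm (f z) \<le> exp B" if "z \<in> cball (of_real y) (3 * r)" for z
    proof (rule order.trans[OF fle])
      show "exp (- (real Q * mean 0) + (\<Sum>j<Q. ln (N (z + of_real (real j * \<beta>))))) \<le> exp B"
        using orbit_sum_uniform_bound[OF q A1 im[OF that]] by (simp add: B_def del: of_real_mult)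
    qed (use sub that in auto)
    have "norm (f (of_real y)) = exp (- (real Q * mean 0)) * (\<Prod>j<Q. N (of_real (y + real j * \<beta>)))"
      unfolding f_def norm_mult prod_norm[symmetric] using g(3) by (simp add: of_real_add[symmetric] del: of_real_mult of_real_add)
    also have "(\<Prod>j<Q. N (of_real (y + real j * \<beta>))) = (\<Prod>j<Q. exp (ln (N (of_real (y + real j * \<beta>)))))"
      using pos yin by (intro prod.cong refl) (simp del: of_real_add of_real_mult)
    finally have fy: "norm (f (of_real y)) = exp (- (real Q * mean 0) + (\<Sum>j<Q. ln (N (of_real (y + real j * \<beta>)))))"
      by (simp only: exp_add exp_sum[OF finite_lessThan])
    have "real Q * mean 0 - (3 * real q * (M - mean 0) + real q * A1) \<le> (\<Sum>j<Q. ln (N (of_real (y + real j * \<beta>))))"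
      using y(3) by (simp add: e_def algebra_simps del: of_real_add of_real_mult)
    moreover have "3 * real q * (M - mean 0) + real q * A1 \<le> B"
    proof -
      have "3 * real q * (M - mean 0) + real q * A1 \<le> 3 * real q * A1 + real q * A1"
        using A1 by (intro add_right_mono mult_left_mono) auto
      also have "\<dots> = real q * A1 * 4" by simp
      also have "\<dots> \<le> real Q / real q * A1 * (8 / T + 4)"
        using q q2 A1 T by (intro mult_mono) (auto simp: field_simps)
      finally show ?thesis by (simp add: B_def)
    qed
    ultimately show "exp (- B) \<le> norm (f (of_real y))" unfolding fy by simp
  qed (rule B)
  have c2: "emeasure lborel {x\<in>{x0..<x0 + 1 / real q}. (\<Sum>j<Q. ln (N (of_real (x + real j * \<beta>)))) < real Q * (mean 0 - \<kappa>)}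
     \<le> emeasure lborel {x\<in>{y - r/2..y + r/2}. norm (f (of_real x)) \<le> exp (-t*B)}"
  proof (rule emeasure_mono)
    show "{x\<in>{x0..<x0 + 1 / real q}. (\<Sum>j<Q. ln (N (of_real (x + real j * \<beta>)))) < real Q * (mean 0 - \<kappa>)}
      \<subseteq> {x\<in>{y - r/2..y + r/2}. norm (f (of_real x)) \<le> exp (-t*B)}"
    proof (intro subsetI CollectI conjI; elim CollectE conjE)
      fix x assume x: "x \<in> {x0..<x0 + 1 / real q}" "(\<Sum>j<Q. ln (N (of_real (x + real j * \<beta>)))) < real Q * (mean 0 - \<kappa>)"
      show "x \<in> {y - r/2..y + r/2}" using x(1) y unfolding r_def by auto
      have "norm (f (of_real x)) \<le> exp (- (real Q * mean 0) + (\<Sum>j<Q. ln (N (of_real x + of_real (real j * \<beta>)))))"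
        using delta_pos by (intro fle) (simp add: ostrip_def)
      also have "\<dots> \<le> exp (- (real Q * \<kappa>))"
        using x(2) by (simp add: right_diff_distrib)
      also have "real Q * \<kappa> = t * B" using B by (simp add: t_def)
      finally show "norm (f (of_real x)) \<le> exp (- t * B)" by simp
    qed
    have "continuous_on {y - r/2..y + r/2} (\<lambda>x. f (of_real x))"
      unfolding f_def
      by (intro continuous_intros continuous_on_compose2[OF holomorphic_on_imp_continuous_on[OF g(1)]])
         (use delta_pos in \<open>auto simp: ostrip_def\<close>)
    then have "continuous_on {y - r/2..y + r/2} (\<lambda>x. norm (f (of_real x)))" by (rule continuous_on_norm)
    from continuous_closed_preimage[OF this, of "{..exp (-t*B)}"]
    have "closed ({y - r/2..y + r/2} \<inter> (\<lambda>x. norm (f (of_real x))) -` {..exp (-t*B)})" by simp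
    also have "{y - r/2..y + r/2} \<inter> (\<lambda>x. norm (f (of_real x))) -` {..exp (-t*B)} = {x\<in>{y - r/2..y + r/2}. norm (f (of_real x)) \<le> exp (-t*B)}" by auto
    finally show "{x\<in>{y - r/2..y + r/2}. norm (f (of_real x)) \<le> exp (-t*B)} \<in> sets lborel" by auto
  qed
  have c3: "5 * exp 1 * r * exp (-t/6) = 10 * exp 1 / real q * exp (- (\<kappa> * real q / (A1 * (8 / T + 4))) / 6)"
    by (simp add: t r_def)
  show ?thesis using order.trans[OF c2 c1] unfolding c3 .
qed

text \<open>The factor 1/q in the local bound, which is the length scale of Cartan's estimate, pays
  exactly for the q intervals covering [0,1).\<close>

lemma orbit_sum_deviation:
  assumes q: "q > 0" "8 / real q \<le> T" "(real q)\<^sup>2 \<le> real Q" and A1: "M - mean 0 \<le> A1" "A1 > 0"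
  shows "emeasure lborel {x\<in>{0..<1}. (\<Sum>j<Q. ln (N (of_real (x + real j * \<beta>)))) < real Q * (mean 0 - \<kappa>)}
    \<le> ennreal (10 * exp 1 * exp (- (\<kappa> * real q / (A1 * (8 / T + 4))) / 6))"
proof -
  define S where "S x0 = {x\<in>{x0..<x0 + 1 / real q}. (\<Sum>j<Q. ln (N (of_real (x + real j * \<beta>)))) < real Q * (mean 0 - \<kappa>)}" for x0
  have "continuous_on UNIV (\<lambda>x. \<Sum>j<Q. ln (N (of_real (x + real j * \<beta>))))"
    by (intro continuous_on_sum continuous_on_compose2[OF cont_ln])
       (use delta_pos in \<open>auto intro!: continuous_intros simp: ostrip_def\<close>)
  from borel_measurable_continuous_onI[OF this]
  have Sm [measurable]: "S x0 \<in> sets lborel" for x0 unfolding S_def by measurable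
  have "{x\<in>{0..<1}. (\<Sum>j<Q. ln (N (of_real (x + real j * \<beta>)))) < real Q * (mean 0 - \<kappa>)} \<subseteq> (\<Union>i<q. S (real i / real q))"
  proof
    fix x assume "x \<in> {x\<in>{0..<1}. (\<Sum>j<Q. ln (N (of_real (x + real j * \<beta>)))) < real Q * (mean 0 - \<kappa>)}"
    then have x: "0 \<le> x" "x < 1" "(\<Sum>j<Q. ln (N (of_real (x + real j * \<beta>)))) < real Q * (mean 0 - \<kappa>)" by auto
    obtain i where "i < q" "real i / real q \<le> x" "x < real i / real q + 1 / real q"
      by (rule unit_interval_cover[OF x(1,2) q(1)])
    then show "x \<in> (\<Union>i<q. S (real i / real q))" using x(3) unfolding S_def by auto
  qed
  then have "emeasure lborel {x\<in>{0..<1}. (\<Sum>j<Q. ln (N (of_real (x + real j * \<beta>)))) < real Q * (mean 0 - \<kappa>)}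
    \<le> emeasure lborel (\<Union>i<q. S (real i / real q))" by (rule emeasure_mono) measurable
  also have "\<dots> \<le> ennreal (real q * (10 * exp 1 / real q * exp (- (\<kappa> * real q / (A1 * (8 / T + 4))) / 6)))"
    unfolding S_def by (intro emeasure_UN_le Sm[unfolded S_def] orbit_sum_deviation_local[OF q A1])
  also have "real q * (10 * exp 1 / real q * exp (- (\<kappa> * real q / (A1 * (8 / T + 4))) / 6)) = 10 * exp 1 * exp (- (\<kappa> * real q / (A1 * (8 / T + 4))) / 6)"
    using q by simp
  finally show ?thesis .
qed

end
end

section \<open>Matrices and determinants\<close>

no_notation fps_nth (infixl \<open>$\<close> 75)

lemma ostrip_subset_strip: "ostrip \<delta> \<subseteq> strip \<delta>"
  by (auto simp: ostrip_def strip_def)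

lemma norm_matrix2_sq:
  fixes A :: "complex^2^2"
  shows "(norm A)\<^sup>2 = (norm (A$1$1))\<^sup>2 + (norm (A$1$2))\<^sup>2 + (norm (A$2$1))\<^sup>2 + (norm (A$2$2))\<^sup>2"
  by (simp add: norm_vec_def L2_set_def sum_2 add_nonneg_nonneg)

lemma norm_entry_le:
  fixes A :: "complex^2^2"
  shows "norm (A $ i $ j) \<le> norm A"
  using Finite_Cartesian_Product.norm_nth_le[of "A $ i" j] Finite_Cartesian_Product.norm_nth_le[of A i] by linarith

lemma cauchy_schwarz_2:
  fixes a b c d :: complex
  shows "(norm (a * c + b * d))\<^sup>2 \<le> ((norm a)\<^sup>2 + (norm b)\<^sup>2) * ((norm c)\<^sup>2 + (norm d)\<^sup>2)"
proof -
  have "norm (a * c + b * d) \<le> norm a * norm c + norm b * norm d"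
    by (metis norm_mult norm_triangle_ineq)
  then have "(norm (a * c + b * d))\<^sup>2 \<le> (norm a * norm c + norm b * norm d)\<^sup>2" by (intro power_mono) auto
  also have "\<dots> \<le> ((norm a)\<^sup>2 + (norm b)\<^sup>2) * ((norm c)\<^sup>2 + (norm d)\<^sup>2)"
    using zero_le_power2[of "norm a * norm d - norm b * norm c"] by (simp add: power2_eq_square algebra_simps)
  finally show ?thesis .
qed

lemma norm_matrix_vector_le:
  fixes A :: "complex^2^2"
  shows "norm (A *v x) \<le> norm A * norm x"
proof (rule power2_le_imp_le)
  have nx: "(norm x)\<^sup>2 = (norm (x$1))\<^sup>2 + (norm (x$2))\<^sup>2"
    by (simp add: norm_vec_def L2_set_def sum_2 add_nonneg_nonneg)
  have "(norm (A *v x))\<^sup>2 = (norm (A$1$1 * x$1 + A$1$2 * x$2))\<^sup>2 + (norm (A$2$1 * x$1 + A$2$2 * x$2))\<^sup>2"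
    by (simp add: norm_vec_def L2_set_def sum_2 matrix_vector_mult_def add_nonneg_nonneg)
  also have "\<dots> \<le> ((norm (A$1$1))\<^sup>2 + (norm (A$1$2))\<^sup>2) * (norm x)\<^sup>2 + ((norm (A$2$1))\<^sup>2 + (norm (A$2$2))\<^sup>2) * (norm x)\<^sup>2"
    unfolding nx by (intro add_mono cauchy_schwarz_2)
  finally show "(norm (A *v x))\<^sup>2 \<le> (norm A * norm x)\<^sup>2" by (simp add: norm_matrix2_sq power_mult_distrib algebra_simps)
qed simp

lemma mnorm_mult_vec_le: "norm (A *v x) \<le> mnorm A * norm x"
  unfolding mnorm_def
proof (rule onorm, rule bounded_linear_intro)
  show "A *v (r *\<^sub>R x) = r *\<^sub>R (A *v x)" for r :: real and x
    by (simp add: vec_eq_iff matrix_vector_mult_def sum_2 scaleR_right_distrib)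
  show "norm (A *v x) \<le> norm x * norm A" for x
    using norm_matrix_vector_le[of A x] by (simp add: mult.commute)
qed (rule matrix_vector_right_distrib)

lemma mnorm_le_norm: "mnorm A \<le> norm A"
  unfolding mnorm_def by (rule onorm_bound) (auto intro: norm_matrix_vector_le)

lemma norm_axis_complex: "norm (axis j 1 :: complex^2) = 1"
  using exhaust_2[of j] by (auto simp: norm_vec_def L2_set_def sum_2 axis_def)

text \<open>The columns are images of unit vectors, so each has norm at most \<open>mnorm A\<close>;
  the resulting factor sqrt 2 is rounded up.\<close>

lemma norm_le_mnorm: "norm A \<le> 2 * mnorm A"
proof (rule power2_le_imp_le)
  have col: "(norm (A$1$j))\<^sup>2 + (norm (A$2$j))\<^sup>2 \<le> (mnorm A)\<^sup>2" for j
  proof -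
    have "norm (A *v axis j 1) \<le> mnorm A"
      using mnorm_mult_vec_le[of A "axis j 1"] by (simp add: norm_axis_complex)
    then have "(norm (A *v axis j 1))\<^sup>2 \<le> (mnorm A)\<^sup>2" by (intro power_mono) auto
    moreover have "A *v axis j 1 = column j A" 
      using exhaust_2[of j] by (auto simp: vec_eq_iff matrix_vector_mult_def sum_2 axis_def column_def)
    ultimately show ?thesis by (simp add: norm_vec_def L2_set_def sum_2 column_def add_nonneg_nonneg)
  qed
  have "(2 * mnorm A)\<^sup>2 = 4 * (mnorm A)\<^sup>2" by (simp add: power_mult_distrib)
  then show "(norm A)\<^sup>2 \<le> (2 * mnorm A)\<^sup>2"
    using col[of 1] col[of 2] zero_le_power2[of "mnorm A"] unfolding norm_matrix2_sq by linarith
  show "0 \<le> 2 * mnorm A"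
    using mnorm_mult_vec_le[of A "axis 1 1"] norm_ge_zero[of "A *v axis 1 1"] by (simp add: norm_axis_complex del: norm_ge_zero)
qed

lemma norm_matrix_mult_le:
  fixes A B :: "complex^2^2"
  shows "norm (A ** B) \<le> norm A * norm B"
proof (rule power2_le_imp_le)
  define a where "a i = (norm (A$i$1))\<^sup>2 + (norm (A$i$2))\<^sup>2" for i
  define b where "b j = (norm (B$1$j))\<^sup>2 + (norm (B$2$j))\<^sup>2" for j
  have e: "(norm ((A ** B) $ i $ j))\<^sup>2 \<le> a i * b j" for i j
    using cauchy_schwarz_2[of "A$i$1" "B$1$j" "A$i$2" "B$2$j"] by (simp add: matrix_matrix_mult_def sum_2 a_def b_def)
  have "(norm (A ** B))\<^sup>2 \<le> a 1 * b 1 + a 1 * b 2 + a 2 * b 1 + a 2 * b 2"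
    unfolding norm_matrix2_sq[of "A ** B"] by (intro add_mono e)
  also have "\<dots> = (a 1 + a 2) * (b 1 + b 2)" by (simp add: algebra_simps)
  also have "\<dots> = (norm A)\<^sup>2 * (norm B)\<^sup>2" by (simp add: norm_matrix2_sq a_def b_def add_ac)
  finally show "(norm (A ** B))\<^sup>2 \<le> (norm A * norm B)\<^sup>2" by (simp only: power_mult_distrib)
qed simp

section \<open>Cancellation of matrix factors by determinants\<close>

definition adjugate2 :: "complex^2^2 \<Rightarrow> complex^2^2" where
  "adjugate2 A = vector [vector [A$2$2, - A$1$2], vector [- A$2$1, A$1$1]]"

lemma norm_adjugate2: "norm (adjugate2 A) = norm A"
proof -
  have "(norm (adjugate2 A))\<^sup>2 = (norm A)\<^sup>2" by (simp add: norm_matrix2_sq adjugate2_def)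
  then show ?thesis by simp
qed

lemma mult_adjugate2: "A ** adjugate2 A = mat (det A)" "adjugate2 A ** A = mat (det A)"
  by (simp_all add: vec_eq_iff forall_2 matrix_matrix_mult_def sum_2 adjugate2_def mat_def det_2 algebra_simps)

lemma mult_mat: "A ** mat c = (\<chi> i j. c * (A :: complex^2^2) $ i $ j)" "mat c ** A = (\<chi> i j. c * A $ i $ j)"
  by (simp_all add: vec_eq_iff forall_2 matrix_matrix_mult_def sum_2 mat_def)

lemma norm_scaled: "norm (\<chi> i j. c * (A :: complex^2^2) $ i $ j) = norm c * norm A"
proof -
  have "(norm (\<chi> i j. c * A $ i $ j))\<^sup>2 = (norm c * norm A)\<^sup>2"
    by (simp add: norm_matrix2_sq norm_mult power_mult_distrib algebra_simps)
  then show ?thesis by (simp only: power2_eq_iff_nonneg norm_ge_zero mult_nonneg_nonneg)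
qed

text \<open>The adjugate stands in for an inverse that need not exist: it recovers \<open>A\<close>
  from \<open>A ** B\<close> up to the factor det B, and in dimension two it has the same Frobenius
  norm as \<open>B\<close>.\<close>

lemma norm_mult_det_le_right: "norm A * norm (det B) \<le> norm (A ** B) * norm B" for A B :: "complex^2^2"
proof -
  have "norm (det B) * norm A = norm ((A ** B) ** adjugate2 B)"
    by (simp add: matrix_mul_assoc[symmetric] mult_adjugate2 mult_mat norm_scaled)
  also have "\<dots> \<le> norm (A ** B) * norm B" using norm_matrix_mult_le[of "A ** B" "adjugate2 B"] by (simp add: norm_adjugate2)
  finally show ?thesis by (simp add: mult.commute)
qed

lemma norm_mult_det_le_left: "norm A * norm (det B) \<le> norm B * norm (B ** A)" for A B :: "complex^2^2"
proof -
  have "norm (det B) * norm A = norm (adjugate2 B ** (B ** A))"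
    by (simp add: matrix_mul_assoc mult_adjugate2 mult_mat norm_scaled)
  also have "\<dots> \<le> norm B * norm (B ** A)" using norm_matrix_mult_le[of "adjugate2 B" "B ** A"] by (simp add: norm_adjugate2)
  finally show ?thesis by (simp add: mult.commute)
qed

lemma norm_det_le: "norm (det A) \<le> (norm A)\<^sup>2" for A :: "complex^2^2"
proof -
  have "norm (det A) \<le> norm (A$1$1) * norm (A$2$2) + norm (A$1$2) * norm (A$2$1)"
    unfolding det_2 by (rule order.trans[OF norm_triangle_ineq4]) (simp add: norm_mult)
  also have "\<dots> \<le> (norm A)\<^sup>2"
    using sum_squares_bound[of "norm (A$1$1)" "norm (A$2$2)"] sum_squares_bound[of "norm (A$1$2)" "norm (A$2$1)"]
      zero_le_power2[of "norm (A$1$1)"] zero_le_power2[of "norm (A$2$2)"] zero_le_power2[of "norm (A$1$2)"] zero_le_power2[of "norm (A$2$1)"]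
    unfolding norm_matrix2_sq by linarith
  finally show ?thesis .
qed

lemma norm_det_diff_le:
  fixes A B :: "complex^2^2"
  assumes "norm A \<le> K" "norm B \<le> K"
  shows "norm (det A - det B) \<le> 4 * K * norm (A - B)"
proof -
  have m: "norm (a * d - a' * d') \<le> 2 * K * e" if "norm (a - a') \<le> e" "norm (d - d') \<le> e" "norm a' \<le> K" "norm d \<le> K"
    for a d a' d' :: complex and e
  proof -
    have eq: "a * d - a' * d' = (a - a') * d + a' * (d - d')" by (simp add: algebra_simps)
    have "norm (a * d - a' * d') \<le> norm (a - a') * norm d + norm a' * norm (d - d')"
      unfolding eq by (rule order.trans[OF norm_triangle_ineq]) (simp add: norm_mult)
    also have "\<dots> \<le> e * K + K * e"
      using that by (intro add_mono mult_mono) (auto intro: order.trans[OF norm_ge_zero])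
    finally show ?thesis by simp
  qed
  have e: "norm (A $ i $ j - B $ i $ j) \<le> norm (A - B)" for i j using norm_entry_le[of "A - B" i j] by simp
  have k: "norm (A $ i $ j) \<le> K" "norm (B $ i $ j) \<le> K" for i j using norm_entry_le assms by (meson order.trans)+
  have "det A - det B = (A$1$1 * A$2$2 - B$1$1 * B$2$2) - (A$1$2 * A$2$1 - B$1$2 * B$2$1)" by (simp add: det_2)
  then have "norm (det A - det B) \<le> norm (A$1$1 * A$2$2 - B$1$1 * B$2$2) + norm (A$1$2 * A$2$1 - B$1$2 * B$2$1)"
    by (simp add: norm_triangle_ineq4)
  also have "\<dots> \<le> 2 * K * norm (A - B) + 2 * K * norm (A - B)" by (intro add_mono m e k)
  finally show ?thesis by simp
qed

section \<open>Cocycles near a given one and their determinants\<close>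

lemma cocycle_holomorphic:
  assumes "D \<in> analytic_cocycles \<delta>"
  shows "(\<lambda>z. D z $ i $ j) holomorphic_on ostrip \<delta>"
proof -
  have "(\<lambda>z. D z $ i $ j) analytic_on strip \<delta>" using assms by (simp add: analytic_cocycles_def)
  then show ?thesis using analytic_imp_holomorphic holomorphic_on_subset ostrip_subset_strip by metis
qed

lemma cocycle_periodic:
  assumes "D \<in> analytic_cocycles \<delta>" "z \<in> strip \<delta>"
  shows "D (z + 1) = D z"
  using assms by (auto simp: analytic_cocycles_def)

lemma cocycle_continuous:
  assumes "D \<in> analytic_cocycles \<delta>"
  shows "continuous_on (strip \<delta>) D"
proof -
  have "continuous_on (strip \<delta>) (\<lambda>z. D z $ i $ j)" for i j
  proof -
    have "(\<lambda>z. D z $ i $ j) analytic_on strip \<delta>" using assms by (simp add: analytic_cocycles_def)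
    then show ?thesis by (intro holomorphic_on_imp_continuous_on analytic_imp_holomorphic)
  qed
  then have "continuous_on (strip \<delta>) (\<lambda>z. \<chi> i. \<chi> j. D z $ i $ j)" by (intro continuous_on_vec_lambda)
  then show ?thesis by simp
qed

lemma cocycle_bounded:
  assumes D: "D \<in> analytic_cocycles \<delta>"
  shows "\<exists>K. \<forall>z\<in>strip \<delta>. norm (D z) \<le> K"
proof -
  define R where "R = cbox (Complex 0 (- \<delta>)) (Complex 1 \<delta>)"
  have sub: "R \<subseteq> strip \<delta>" by (auto simp: R_def strip_def in_cbox_complex_iff)
  have "compact (D ` R)"
    by (intro compact_continuous_image continuous_on_subset[OF cocycle_continuous[OF D] sub]) (simp add: R_def)
  then have "bounded (D ` R)" by (rule compact_imp_bounded)
  then obtain K where "\<forall>v\<in>D ` R. norm v \<le> K" unfolding bounded_iff ..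
  then have K: "\<And>z. z \<in> R \<Longrightarrow> norm (D z) \<le> K" by simp
  have "norm (D z) \<le> K" if z: "z \<in> strip \<delta>" for z
  proof -
    have "D (Complex (x + 1) (Im z)) = D (Complex x (Im z))" for x
      using cocycle_periodic[OF D, of "Complex x (Im z)"] z by (simp add: strip_def Complex_eq algebra_simps)
    from periodic_of_int[of "\<lambda>x. D (Complex x (Im z))", OF this, of "frac (Re z)" "\<lfloor>Re z\<rfloor>"]
    have "D z = D (Complex (frac (Re z)) (Im z))" by (simp add: frac_def)
    moreover have "Complex (frac (Re z)) (Im z) \<in> R"
      using z by (auto simp: R_def in_cbox_complex_iff strip_def less_imp_le[OF frac_lt_1])
    ultimately show ?thesis using K by simp
  qed
  then show ?thesis by blast
qed

lemma strip_norm_bound: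
  assumes D: "D \<in> analytic_cocycles \<delta>" "D' \<in> analytic_cocycles \<delta>"
    and less: "strip_norm \<delta> (\<lambda>z. D' z - D z) < \<gamma>" and z: "z \<in> strip \<delta>"
  shows "norm (D' z - D z) \<le> 2 * \<gamma>"
proof -
  obtain K where K: "\<forall>z\<in>strip \<delta>. norm (D z) \<le> K" using cocycle_bounded[OF D(1)] ..
  obtain K' where K': "\<forall>z\<in>strip \<delta>. norm (D' z) \<le> K'" using cocycle_bounded[OF D(2)] ..
  \<comment> \<open>The supremum in \<open>strip_norm\<close> dominates its members only for a
    family bounded above; this is where boundedness of both cocycles on the whole strip
    enters.\<close>
  have "bdd_above ((\<lambda>z. mnorm (D' z - D z)) ` strip \<delta>)"
  proof (rule bdd_aboveI2)
    fix w assume "w \<in> strip \<delta>"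
    then show "mnorm (D' w - D w) \<le> K' + K"
      using mnorm_le_norm[of "D' w - D w"] norm_triangle_ineq4[of "D' w" "D w"] bspec[OF K, of w] bspec[OF K', of w] by linarith
  qed
  then have "mnorm (D' z - D z) \<le> strip_norm \<delta> (\<lambda>z. D' z - D z)"
    unfolding strip_norm_def using z by (intro cSUP_upper)
  then show ?thesis using norm_le_mnorm[of "D' z - D z"] less by linarith
qed

lemma det_holomorphic:
  assumes "D \<in> analytic_cocycles \<delta>"
  shows "(\<lambda>z. det (D z)) holomorphic_on ostrip \<delta>"
  unfolding det_2 by (intro holomorphic_intros cocycle_holomorphic[OF assms])

lemma cocycle_neighbourhood:
  assumes D: "D \<in> analytic_cocycles \<delta>"
  obtains K where "K \<ge> 1" "\<And>D' z \<gamma>. D' \<in> analytic_cocycles \<delta> \<Longrightarrow> strip_norm \<delta> (\<lambda>z. D' z - D z) < \<gamma> \<Longrightarrow> \<gamma> \<le> 1 \<Longrightarrow> z \<in> strip \<delta> \<Longrightarrow>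
     norm (D' z) \<le> K \<and> norm (det (D' z) - det (D z)) \<le> 8 * K * \<gamma>"
proof -
  obtain K0 where K0: "\<forall>z\<in>strip \<delta>. norm (D z) \<le> K0" using cocycle_bounded[OF D] ..
  define K where "K = max K0 0 + 2"
  show thesis
  proof (rule that[of K])
    show "K \<ge> 1" by (simp add: K_def)
    fix D' z and \<gamma> :: real
    assume a: "D' \<in> analytic_cocycles \<delta>" "strip_norm \<delta> (\<lambda>z. D' z - D z) < \<gamma>" "\<gamma> \<le> 1" "z \<in> strip \<delta>"
    have d: "norm (D' z - D z) \<le> 2 * \<gamma>" by (rule strip_norm_bound[OF D a(1,2,4)])
    have k0: "norm (D z) \<le> K0" using K0 a(4) by blast
    have k: "norm (D' z) \<le> K" using norm_triangle_sub[of "D' z" "D z"] d k0 a(3) by (simp add: K_def)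
    have "norm (det (D' z) - det (D z)) \<le> 4 * K * norm (D' z - D z)"
      using k k0 by (intro norm_det_diff_le) (auto simp: K_def)
    also have "\<dots> \<le> 4 * K * (2 * \<gamma>)" using d by (intro mult_left_mono) (auto simp: K_def)
    finally show "norm (D' z) \<le> K \<and> norm (det (D' z) - det (D z)) \<le> 8 * K * \<gamma>" using k by simp
  qed
qed

text \<open>Zeros filling an interval would accumulate at its left end, and the identity theorem
  would make \<open>f\<close> vanish on the whole strip. This supplies a sample point in every
  prescribed interval.\<close>

lemma nonzero_point:
  assumes f: "f holomorphic_on ostrip \<delta>" and x: "f (of_real x) \<noteq> 0" and ab: "a < b" and d: "\<delta> > 0"
  shows "\<exists>y. a \<le> y \<and> y < b \<and> f (of_real y) \<noteq> 0"
proof (rule ccontr)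
  assume neg: "\<not> ?thesis"
  have "f (of_real x) = 0"
  proof (rule analytic_continuation[OF f open_ostrip])
    show "connected (ostrip \<delta>)" using convex_ostrip by (rule convex_connected)
    show "of_real ` {a..<b} \<subseteq> ostrip \<delta>" "of_real a \<in> ostrip \<delta>" "of_real x \<in> ostrip \<delta>" using d by (auto simp: ostrip_def)
    show "complex_of_real a islimpt of_real ` {a..<b}"
      unfolding islimpt_approachable
    proof (intro allI impI)
      fix e :: real assume "e > 0"
      define t where "t = min (a + e/2) ((a + b) / 2)"
      have "a < t" "t < b" "t < a + e" using \<open>e > 0\<close> ab by (auto simp: t_def min_def)
      then have "of_real t \<in> complex_of_real ` {a..<b}" "complex_of_real t \<noteq> of_real a" "dist (complex_of_real t) (of_real a) < e"
        by (auto simp: dist_of_real dist_real_def)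
      then show "\<exists>x'\<in>complex_of_real ` {a..<b}. x' \<noteq> of_real a \<and> dist x' (of_real a) < e" by blast
    qed
    show "f z = 0" if "z \<in> of_real ` {a..<b}" for z using neg that by auto
  qed
  then show False using x by simp
qed

lemma sublevel_borel:
  assumes f: "f holomorphic_on ostrip \<delta>" and d: "\<delta> > 0"
  shows "{x\<in>{a..b}. norm (f (of_real x)) \<le> c} \<in> sets lborel" "{x\<in>{a..<b}. norm (f (of_real x)) \<le> c} \<in> sets lborel"
    "(\<lambda>x. f (of_real x)) \<in> borel_measurable borel"
proof -
  have "continuous_on UNIV (\<lambda>x. f (complex_of_real x))"
    by (rule continuous_on_compose2[OF holomorphic_on_imp_continuous_on[OF f]])
       (use d in \<open>auto intro!: continuous_intros simp: ostrip_def\<close>)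
  then show [measurable]: "(\<lambda>x. f (of_real x)) \<in> borel_measurable borel" by (rule borel_measurable_continuous_onI)
  show "{x\<in>{a..b}. norm (f (of_real x)) \<le> c} \<in> sets lborel" "{x\<in>{a..<b}. norm (f (of_real x)) \<le> c} \<in> sets lborel" by measurable
qed

text \<open>Uniformity in \<open>D'\<close> comes from finitely many sample points, one per cell of
  length 1/m, where det D has modulus at least \<open>a\<close>. For small \<gamma> the modulus of
  det D' is still at least a/2 there, so Cartan's estimate applies with the same \<open>B\<close>
  for all \<open>D'\<close>. With radius 2/m its interval around a sample point covers the
  cell.\<close>

lemma det_sublevel_bound:
  assumes D: "D \<in> analytic_cocycles \<delta>" and nz: "det (D (of_real x0)) \<noteq> 0" and d: "\<delta> > 0"
  obtains \<gamma> c where "\<gamma> > 0" "\<gamma> \<le> 1" "c > 0"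
    "\<And>D' s. D' \<in> analytic_cocycles \<delta> \<Longrightarrow> strip_norm \<delta> (\<lambda>z. D' z - D z) < \<gamma> \<Longrightarrow>
       emeasure lborel {x\<in>{0..<1}. norm (det (D' (of_real x))) \<le> exp (- s)} \<le> ennreal (10 * exp 1 * exp (- c * s))"
proof -
  obtain K where K: "K \<ge> 1" "\<And>D' z \<gamma>. D' \<in> analytic_cocycles \<delta> \<Longrightarrow> strip_norm \<delta> (\<lambda>z. D' z - D z) < \<gamma> \<Longrightarrow> \<gamma> \<le> 1 \<Longrightarrow> z \<in> strip \<delta> \<Longrightarrow>
     norm (D' z) \<le> K \<and> norm (det (D' z) - det (D z)) \<le> 8 * K * \<gamma>" by (rule cocycle_neighbourhood[OF D]) blast
  obtain m where m: "real m > max 1 (6 / \<delta>)" using reals_Archimedean2 by blast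
  then have m0: "real m > 1" "6 / \<delta> < real m" by auto
  have m6: "6 / real m < \<delta>" using m0 d by (simp add: field_simps)
  have "\<exists>y. real i / real m \<le> y \<and> y < real i / real m + 1 / real m \<and> det (D (of_real y)) \<noteq> 0" for i
    using nonzero_point[OF det_holomorphic[OF D] nz, of "real i / real m" "real i / real m + 1 / real m"] m0 d by simp
  then obtain y where y: "\<And>i. real i / real m \<le> y i" "\<And>i. y i < real i / real m + 1 / real m" "\<And>i. det (D (of_real (y i))) \<noteq> 0"
    by metis
  define a where "a = Min ((\<lambda>i. norm (det (D (of_real (y i))))) ` {..<m})"
  have a0: "a > 0" unfolding a_def using m0 y(3) by (subst Min_gr_iff) (auto simp: lessThan_empty_iff)
  have ale: "a \<le> norm (det (D (of_real (y i))))" if "i < m" for i unfolding a_def using that by (intro Min_le) auto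
  \<comment> \<open>Makes the perturbation 8 K \<gamma> of the determinant at most a/2.\<close>
  define \<gamma> where "\<gamma> = min 1 (a / (16 * K))"
  define B where "B = max 1 (max (ln (K\<^sup>2)) (- ln (a / 2)))"
  have B0: "B > 0" by (simp add: B_def)
  have BK: "K\<^sup>2 \<le> exp B"
  proof -
    have "K\<^sup>2 = exp (ln (K\<^sup>2))" using K(1) by simp
    also have "\<dots> \<le> exp B" unfolding B_def exp_le_cancel_iff by linarith
    finally show ?thesis .
  qed
  have Ba: "exp (- B) \<le> a / 2"
  proof -
    have "exp (- B) \<le> exp (ln (a / 2))" unfolding B_def exp_le_cancel_iff by linarith
    then show ?thesis using a0 by simp
  qed
  show thesis
  proof (rule that[of \<gamma> "1 / (6 * B)"])
    show "\<gamma> > 0" "\<gamma> \<le> 1" using a0 K(1) by (auto simp: \<gamma>_def)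
    show "1 / (6 * B) > 0" using B0 by simp
    fix D' and s :: real assume D': "D' \<in> analytic_cocycles \<delta>" "strip_norm \<delta> (\<lambda>z. D' z - D z) < \<gamma>"
    define f where "f z = det (D' z)" for z
    have fh: "f holomorphic_on ostrip \<delta>" unfolding f_def by (rule det_holomorphic[OF D'(1)])
    note KK = K(2)[OF D' \<open>\<gamma> \<le> 1\<close>]
    define S where "S i = {x\<in>{y i - (2 / real m)/2..y i + (2 / real m)/2}. norm (f (of_real x)) \<le> exp (- (s / B) * B)}" for i
    have Sm: "S i \<in> sets lborel" for i unfolding S_def by (rule sublevel_borel[OF fh d])
    have SB: "emeasure lborel (S i) \<le> ennreal (5 * exp 1 * (2 / real m) * exp (- (s / B) / 6))" if i: "i < m" for i
      unfolding S_def
    proof (rule cartan_estimate[OF _ open_ostrip])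
      show sub: "cball (complex_of_real (y i)) (3 * (2 / real m)) \<subseteq> ostrip \<delta>"
      proof
        fix z assume "z \<in> cball (complex_of_real (y i)) (3 * (2 / real m))"
        then have "\<bar>Im z\<bar> \<le> 6 / real m" using abs_Im_le_cmod[of "of_real (y i) - z"] by (simp add: dist_norm)
        then show "z \<in> ostrip \<delta>" using m6 by (simp add: ostrip_def)
      qed
      show "norm (f z) \<le> exp B" if "z \<in> cball (complex_of_real (y i)) (3 * (2 / real m))" for z
      proof -
        have le: "norm (f z) \<le> (norm (D' z))\<^sup>2" unfolding f_def by (rule norm_det_le)
        have "z \<in> strip \<delta>" using that sub ostrip_subset_strip by blast
        then have "(norm (D' z))\<^sup>2 \<le> K\<^sup>2" using KK[of z] by (intro power_mono) auto
        then show ?thesis using BK le by linarith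
      qed
      have "norm (f (of_real (y i)) - det (D (of_real (y i)))) \<le> 8 * K * \<gamma>"
        using KK[of "of_real (y i)"] d unfolding f_def by (simp add: strip_def)
      also have "\<dots> \<le> 8 * K * (a / (16 * K))" using K(1) by (intro mult_left_mono) (auto simp: \<gamma>_def)
      also have "\<dots> = a / 2" using K(1) by simp
      finally have "norm (f (of_real (y i))) \<ge> a / 2"
        using ale[OF i] norm_triangle_ineq3[of "f (of_real (y i))" "det (D (of_real (y i)))"] by linarith
      then show "exp (- B) \<le> norm (f (of_real (y i)))" using Ba by linarith
    qed (use m0 B0 fh in auto)
    have "{x\<in>{0..<1}. norm (det (D' (of_real x))) \<le> exp (- s)} \<subseteq> (\<Union>i<m. S i)"
    proof
      fix x assume "x \<in> {x\<in>{0..<1}. norm (det (D' (of_real x))) \<le> exp (- s)}"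
      then have x: "0 \<le> x" "x < 1" "norm (f (of_real x)) \<le> exp (- s)" by (auto simp: f_def)
      obtain i where im: "i < m" and "real i / real m \<le> x" "x < real i / real m + 1 / real m"
        by (rule unit_interval_cover[OF x(1,2), of m]) (use m0 in auto)
      then have "x \<in> S i" using y(1,2)[of i] x(3) B0 unfolding S_def by simp
      then show "x \<in> (\<Union>i<m. S i)" using im by blast
    qed
    then have "emeasure lborel {x\<in>{0..<1}. norm (det (D' (of_real x))) \<le> exp (- s)} \<le> emeasure lborel (\<Union>i<m. S i)"
      using Sm by (intro emeasure_mono) auto
    also have "\<dots> \<le> ennreal (real m * (5 * exp 1 * (2 / real m) * exp (- (s / B) / 6)))"
      by (intro emeasure_UN_le Sm SB)
    also have "real m * (5 * exp 1 * (2 / real m) * exp (- (s / B) / 6)) = 10 * exp 1 * exp (- (1 / (6 * B)) * s)"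
      using m0 by (simp add: mult_ac)
    finally show "emeasure lborel {x\<in>{0..<1}. norm (det (D' (of_real x))) \<le> exp (- s)} \<le> ennreal (10 * exp 1 * exp (- (1 / (6 * B)) * s))" .
  qed
qed

text \<open>Layer cake over integer levels: \<open>\<psi> x\<close> is at most the number of
  naturals k below it, and the measures of the levels form a geometric series.\<close>

lemma nn_integral_le_of_tail:
  fixes \<psi> :: "real \<Rightarrow> real"
  assumes c: "c > 0" and C: "C \<ge> 0" and A: "\<And>k. A k \<in> sets lborel"
    and sub: "\<And>x k. x \<in> {0..<1} \<Longrightarrow> real k < \<psi> x \<Longrightarrow> x \<in> A k"
    and tail: "\<And>k::nat. emeasure lborel (A k) \<le> ennreal (C * exp (- c * real k))"
  shows "(\<integral>\<^sup>+x\<in>{0..<1}. ennreal (\<psi> x) \<partial>lborel) \<le> ennreal (C / (1 - exp (- c)))"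
proof -
  have "(\<integral>\<^sup>+x\<in>{0..<1}. ennreal (\<psi> x) \<partial>lborel) \<le> (\<integral>\<^sup>+x. (\<Sum>k. indicator (A k) x) \<partial>lborel)"
  proof (intro nn_integral_mono)
    fix x :: real
    show "ennreal (\<psi> x) * indicator {0..<1} x \<le> (\<Sum>k. indicator (A k) x)"
    proof (cases "x \<in> {0..<1}")
      case True
      define n where "n = nat \<lceil>\<psi> x\<rceil>"
      have "\<psi> x \<le> real n" unfolding n_def by linarith
      then have "ennreal (\<psi> x) \<le> ennreal (real n)" by (rule ennreal_leI)
      also have "\<dots> = (\<Sum>k<n. indicator (A k) x)"
      proof -
        have "indicator (A k) x = (1::ennreal)" if "k < n" for k
        proof -
          have "real k < \<psi> x" using that unfolding n_def by linarith
          then show ?thesis using sub[OF True] by simp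
        qed
        then show ?thesis by (simp add: ennreal_of_nat_eq_real_of_nat)
      qed
      also have "\<dots> \<le> (\<Sum>k. indicator (A k) x)" by (rule sum_le_suminf) auto
      finally show ?thesis using True by simp
    qed simp
  qed
  also have "\<dots> = (\<Sum>k. \<integral>\<^sup>+x. indicator (A k) x \<partial>lborel)" using A by (intro nn_integral_suminf) auto
  also have "\<dots> = (\<Sum>k. emeasure lborel (A k))" using A by simp
  also have "\<dots> \<le> (\<Sum>k. ennreal (C * exp (- c * real k)))" using tail by (intro suminf_le) auto
  also have "\<dots> = ennreal (C / (1 - exp (- c)))"
  proof -
    have e: "C * exp (- c * real k) = C * exp (- c) ^ k" for k
      by (simp add: exp_of_nat_mult[symmetric] mult.commute)
    have "(\<lambda>k. C * exp (- c) ^ k) sums (C * (1 / (1 - exp (- c))))"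
      using c by (intro sums_mult geometric_sums) simp
    then show ?thesis unfolding e using C by (intro suminf_ennreal_eq) auto
  qed
  finally show ?thesis .
qed

section \<open>Regularized norms of the iterates\<close>

text \<open>Extends the iterates, which are given for real arguments, to the strip, where their
  entries are holomorphic.\<close>

primrec citer :: "real \<Rightarrow> (complex \<Rightarrow> complex^2^2) \<Rightarrow> nat \<Rightarrow> complex \<Rightarrow> complex^2^2" where
  "citer \<beta> D 0 z = mat 1"
| "citer \<beta> D (Suc n) z = D (z + of_real (real n * \<beta>)) ** citer \<beta> D n z"

lemma citer_of_real: "citer \<beta> D n (of_real x) = iterate \<beta> D n x"
  by (induction n) auto

lemma norm_mat_1: "norm (mat 1 :: complex^2^2) \<le> 2"
proof (rule power2_le_imp_le)
  show "(norm (mat 1 :: complex^2^2))\<^sup>2 \<le> 2\<^sup>2" unfolding norm_matrix2_sq by (simp add: mat_def)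
qed simp

text \<open>The Hermitian Cauchy-Schwarz inequality follows from the real one after a unit factor
  \<open>u\<close> has made the sum real and nonnegative.\<close>

lemma norm_entry_sum_le:
  fixes A B :: "complex^2^2"
  shows "norm (\<Sum>i\<in>UNIV. \<Sum>j\<in>UNIV. cnj (A$i$j) * B$i$j) \<le> norm A * norm B"
proof -
  define S where "S = (\<Sum>i\<in>UNIV. \<Sum>j\<in>UNIV. cnj (A$i$j) * B$i$j)"
  obtain u where u: "norm u = 1" "u * S = of_real (norm S)"
  proof (cases "S = 0")
    case False
    have "cnj S * S = of_real ((norm S)\<^sup>2)" unfolding complex_norm_square by (rule mult.commute)
    then have "cnj S / of_real (norm S) * S = of_real (norm S)" using False by (simp add: power2_eq_square)
    then show ?thesis using False by (intro that[of "cnj S / of_real (norm S)"]) (simp_all add: norm_divide)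
  qed (use that[of 1] in auto)
  have "norm S = Re (u * S)" using u(2) by simp
  also have "\<dots> = inner (\<chi> i j. cnj u * A $ i $ j) B"
    unfolding S_def by (simp add: inner_vec_def inner_complex_def sum_2 algebra_simps)
  also have "\<dots> \<le> norm (\<chi> i j. cnj u * A $ i $ j) * norm B" by (rule norm_cauchy_schwarz)
  also have "\<dots> = norm A * norm B" using u(1) by (simp add: norm_scaled)
  finally show ?thesis by (simp only: S_def)
qed

text \<open>For \<epsilon> > 0 this is the Euclidean norm of the vector formed by the four entries
  and the constant sqrt \<epsilon>. It is thus still the norm of a holomorphic vector, and positive
  even where the iterate vanishes.\<close>

definition reg_norm :: "real \<Rightarrow> (complex \<Rightarrow> complex^2^2) \<Rightarrow> nat \<Rightarrow> real \<Rightarrow> complex \<Rightarrow> real" where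
  "reg_norm \<beta> D n \<epsilon> z = sqrt ((norm (citer \<beta> D n z))\<^sup>2 + \<epsilon>)"

locale cocycle =
  fixes \<delta> \<beta> K :: real and D :: "complex \<Rightarrow> complex^2^2"
  assumes D: "D \<in> analytic_cocycles \<delta>" and dpos: "\<delta> > 0" and K1: "K \<ge> 1"
    and bound: "\<And>z. z \<in> strip \<delta> \<Longrightarrow> norm (D z) \<le> K"
begin

lemma citer_holomorphic: "(\<lambda>z. citer \<beta> D n z $ i $ j) holomorphic_on ostrip \<delta>"
proof (induction n arbitrary: i j)
  case (Suc n)
  have "(\<lambda>z. D (z + of_real (real n * \<beta>)) $ i $ k) holomorphic_on ostrip \<delta>" for i k
    by (intro holomorphic_on_compose_gen[OF _ cocycle_holomorphic[OF D, of i k], unfolded o_def] holomorphic_intros)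
       (auto simp: ostrip_def)
  then show ?case using Suc by (simp add: matrix_matrix_mult_def sum_2) (intro holomorphic_intros)
qed (simp add: mat_def)

lemma citer_periodic: "z \<in> ostrip \<delta> \<Longrightarrow> citer \<beta> D n (z + 1) = citer \<beta> D n z"
proof (induction n)
  case (Suc n)
  have "D (z + of_real (real n * \<beta>) + 1) = D (z + of_real (real n * \<beta>))"
    using Suc.prems by (intro cocycle_periodic[OF D]) (auto simp: ostrip_def strip_def)
  then show ?case using Suc by (simp add: add_ac)
qed simp

lemma citer_bound: "z \<in> ostrip \<delta> \<Longrightarrow> norm (citer \<beta> D n z) \<le> 2 * K ^ n"
proof (induction n)
  case 0
  then show ?case using norm_mat_1 by simp
next
  case (Suc n)
  have "norm (citer \<beta> D (Suc n) z) \<le> norm (D (z + of_real (real n * \<beta>))) * norm (citer \<beta> D n z)"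
    by (simp add: norm_matrix_mult_le)
  also have "\<dots> \<le> K * (2 * K ^ n)"
    using Suc K1 by (intro mult_mono bound) (auto simp: ostrip_def strip_def)
  finally show ?case by simp
qed

lemma citer_continuous: "continuous_on (ostrip \<delta>) (citer \<beta> D n)"
proof -
  have "continuous_on (ostrip \<delta>) (\<lambda>z. \<chi> i. \<chi> j. citer \<beta> D n z $ i $ j)"
    by (intro continuous_on_vec_lambda holomorphic_on_imp_continuous_on citer_holomorphic)
  then show ?thesis by simp
qed

lemma reg_norm_pos: "\<epsilon> > 0 \<Longrightarrow> reg_norm \<beta> D n \<epsilon> z > 0"
  unfolding reg_norm_def by (simp add: add_nonneg_pos)

text \<open>The touching function pairs the vector of the entries and sqrt \<epsilon> with its
  normalized value at \<open>z\<close>; the constant component contributes the summand \<epsilon>.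
  The bound is Cauchy-Schwarz for five components.\<close>

lemma peaked_reg_norm:
  assumes e: "\<epsilon> > 0"
  shows "peaked \<delta> (reg_norm \<beta> D n \<epsilon>)"
proof
  show "continuous_on (ostrip \<delta>) (reg_norm \<beta> D n \<epsilon>)"
    unfolding reg_norm_def by (intro continuous_intros citer_continuous)
  fix z assume z: "z \<in> ostrip \<delta>"
  show "reg_norm \<beta> D n \<epsilon> z > 0" by (rule reg_norm_pos[OF e])
  show "reg_norm \<beta> D n \<epsilon> (z + 1) = reg_norm \<beta> D n \<epsilon> z" using citer_periodic[OF z] by (simp add: reg_norm_def)
  define A where "A = citer \<beta> D n z"
  define N0 where "N0 = reg_norm \<beta> D n \<epsilon> z"
  have N0: "N0 > 0" unfolding N0_def by (rule reg_norm_pos[OF e])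
  define f where "f w = ((\<Sum>i\<in>UNIV. \<Sum>j\<in>UNIV. cnj (A$i$j) * citer \<beta> D n w $i$j) + of_real \<epsilon>) / of_real N0" for w
  have "f holomorphic_on ostrip \<delta>" unfolding f_def
    using N0 by (intro holomorphic_intros citer_holomorphic) auto
  moreover have "\<forall>w\<in>ostrip \<delta>. f (w + 1) = f w" using citer_periodic by (simp add: f_def)
  moreover have "norm (f w) \<le> reg_norm \<beta> D n \<epsilon> w" for w
  proof -
    define p r where "p = norm A" and "r = norm (citer \<beta> D n w)"
    have "norm ((\<Sum>i\<in>UNIV. \<Sum>j\<in>UNIV. cnj (A$i$j) * citer \<beta> D n w $i$j) + of_real \<epsilon>) \<le> p * r + \<epsilon>"
      using norm_entry_sum_le[of A "citer \<beta> D n w"] e by (intro norm_triangle_le) (auto simp: p_def r_def)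
    also have "\<dots> \<le> sqrt ((p\<^sup>2 + \<epsilon>) * (r\<^sup>2 + \<epsilon>))"
    proof (rule real_le_rsqrt)
      have "0 \<le> \<epsilon> * (p - r)\<^sup>2" using e by simp
      then show "(p * r + \<epsilon>)\<^sup>2 \<le> (p\<^sup>2 + \<epsilon>) * (r\<^sup>2 + \<epsilon>)" by (simp add: power2_eq_square algebra_simps)
    qed
    also have "\<dots> = reg_norm \<beta> D n \<epsilon> w * N0"
      by (simp add: N0_def reg_norm_def A_def p_def r_def real_sqrt_mult mult.commute)
    finally show ?thesis using N0 by (simp add: f_def norm_divide divide_le_eq)
  qed
  moreover have "norm (f z) = N0"
  proof -
    have "(\<Sum>i\<in>UNIV. \<Sum>j\<in>UNIV. cnj (A$i$j) * A$i$j) = of_real ((norm A)\<^sup>2)"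
      unfolding norm_matrix2_sq sum_2 of_real_add complex_norm_square by (simp add: mult.commute add.assoc)
    then have "f z = of_real (((norm A)\<^sup>2 + \<epsilon>) / N0)" by (simp add: f_def A_def)
    also have "((norm A)\<^sup>2 + \<epsilon>) = N0 * N0" unfolding N0_def reg_norm_def A_def using e by (simp add: add_nonneg_nonneg)
    finally show ?thesis using N0 by simp
  qed
  ultimately show "\<exists>f. f holomorphic_on ostrip \<delta> \<and> (\<forall>z\<in>ostrip \<delta>. f (z + 1) = f z) \<and>
      (\<forall>z\<in>ostrip \<delta>. norm (f z) \<le> reg_norm \<beta> D n \<epsilon> z) \<and> norm (f z) = reg_norm \<beta> D n \<epsilon> z"
    unfolding N0_def by blast
qed (rule dpos)

abbreviation det_at :: "real \<Rightarrow> real" where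
  "det_at x \<equiv> norm (det (D (of_real x)))"

abbreviation v :: "nat \<Rightarrow> real \<Rightarrow> real" where
  "v n x \<equiv> ln (norm (iterate \<beta> D n x))"

abbreviation u :: "nat \<Rightarrow> real \<Rightarrow> real \<Rightarrow> real" where
  "u n \<epsilon> x \<equiv> ln (reg_norm \<beta> D n \<epsilon> (of_real x))"

abbreviation u_mean :: "nat \<Rightarrow> real \<Rightarrow> real" where
  "u_mean n \<epsilon> \<equiv> peaked.mean (reg_norm \<beta> D n \<epsilon>) 0"

lemma ln_reg_norm_le:
  assumes e: "0 < \<epsilon>" "\<epsilon> \<le> 1" and n: "n > 0" and z: "z \<in> ostrip \<delta>"
  shows "ln (reg_norm \<beta> D n \<epsilon> z) \<le> real n * ln (3 * K)"
proof -
  have Kn: "1 \<le> K ^ n" using K1 by simp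
  have "reg_norm \<beta> D n \<epsilon> z \<le> sqrt ((2 * K ^ n)\<^sup>2 + 1)"
    unfolding reg_norm_def using e citer_bound[OF z] by (intro real_sqrt_le_mono add_mono power_mono) auto
  also have "\<dots> \<le> 3 * K ^ n"
    using Kn mult_mono[OF Kn Kn] by (intro real_le_lsqrt) (auto simp: power2_eq_square)
  \<comment> \<open>One factor 3 per step instead of a single one makes the logarithmic bound a pure
    multiple of \<open>n\<close>.\<close>
  also have "\<dots> \<le> 3 ^ n * K ^ n"
    using n Kn self_le_power[of "3::real" n] by (intro mult_right_mono) auto
  finally have "reg_norm \<beta> D n \<epsilon> z \<le> (3 * K) ^ n" by (simp add: power_mult_distrib)
  then have "ln (reg_norm \<beta> D n \<epsilon> z) \<le> ln ((3 * K) ^ n)"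
    using reg_norm_pos[OF e(1)] K1 by (subst ln_le_cancel_iff) auto
  also have "ln ((3 * K) ^ n) = real n * ln (3 * K)" using K1 by (subst ln_realpow) auto
  finally show ?thesis .
qed

lemma iterate_Suc_right: "iterate \<beta> D (Suc n) x = iterate \<beta> D n (x + \<beta>) ** D (of_real x)"
proof (induction n)
  case (Suc n)
  have "iterate \<beta> D (Suc (Suc n)) x = D (of_real (x + real (Suc n) * \<beta>)) ** iterate \<beta> D (Suc n) x" by simp
  also have "\<dots> = D (of_real (x + \<beta> + real n * \<beta>)) ** (iterate \<beta> D n (x + \<beta>) ** D (of_real x))"
    unfolding Suc by (simp add: algebra_simps)
  finally show ?case by (simp add: matrix_mul_assoc del: of_real_add)
qed simp

lemma real_in_strip: "of_real x \<in> strip \<delta>" "of_real x \<in> ostrip \<delta>"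
  using dpos by (auto simp: strip_def ostrip_def)

lemma reg_norm_shift_le:
  assumes s: "s \<ge> 0" and e: "\<epsilon> > 0"
    and le: "norm (iterate \<beta> D n y) * exp (- s) \<le> K\<^sup>2 * norm (iterate \<beta> D n x)"
  shows "u n \<epsilon> y \<le> u n \<epsilon> x + (s + 2 * ln K)"
proof -
  define L where "L = exp (s + 2 * ln K)"
  have lnK: "ln K \<ge> 0" using K1 by simp
  \<comment> \<open>Since \<open>L\<close> is at least 1, \<epsilon> may be scaled up along with the
    norm, and the comparison survives the regularization.\<close>
  have L1: "L \<ge> 1" using s lnK by (simp add: L_def)
  have LK: "L = exp s * K\<^sup>2" unfolding L_def mult_2 exp_add power2_eq_square using K1 by simp
  have "norm (iterate \<beta> D n y) = (norm (iterate \<beta> D n y) * exp (- s)) * exp s" by (simp add: exp_minus)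
  also have "\<dots> \<le> K\<^sup>2 * norm (iterate \<beta> D n x) * exp s" using le by (intro mult_right_mono) auto
  finally have y: "norm (iterate \<beta> D n y) \<le> L * norm (iterate \<beta> D n x)" by (simp add: LK mult_ac)
  have "(norm (iterate \<beta> D n y))\<^sup>2 + \<epsilon> \<le> (L * norm (iterate \<beta> D n x))\<^sup>2 + L\<^sup>2 * \<epsilon>"
    using y L1 e by (intro add_mono power_mono) auto
  also have "\<dots> = L\<^sup>2 * ((norm (iterate \<beta> D n x))\<^sup>2 + \<epsilon>)" by (simp add: power_mult_distrib algebra_simps)
  finally have "reg_norm \<beta> D n \<epsilon> (of_real y) \<le> sqrt (L\<^sup>2 * ((norm (iterate \<beta> D n x))\<^sup>2 + \<epsilon>))"
    unfolding reg_norm_def citer_of_real by (rule real_sqrt_le_mono)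
  also have "\<dots> = L * reg_norm \<beta> D n \<epsilon> (of_real x)"
    unfolding reg_norm_def citer_of_real using L1 by (simp add: real_sqrt_mult)
  finally have "u n \<epsilon> y \<le> ln (L * reg_norm \<beta> D n \<epsilon> (of_real x))"
    using reg_norm_pos[OF e] L1 by (subst ln_le_cancel_iff) auto
  also have "\<dots> = ln L + u n \<epsilon> x"
    using reg_norm_pos[OF e, of n "of_real x"] L1 by (subst ln_mult) auto
  finally show ?thesis by (simp add: L_def)
qed

text \<open>With A_n for the iterate, A_n(x + \<beta>) D(x) = D(x + n \<beta>) A_n(x). Cancelling
  D(x) or D(x + n \<beta>) costs the modulus of its determinant, hence the lower bounds at exactly
  these two points.\<close>

lemma ln_reg_norm_step:
  assumes s: "s \<ge> 0" and e: "\<epsilon> > 0"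
    and d: "exp (- s) \<le> det_at x" "exp (- s) \<le> det_at (x + real n * \<beta>)"
  shows "\<bar>u n \<epsilon> (x + \<beta>) - u n \<epsilon> x\<bar> \<le> s + 2 * ln K"
proof -
  define B E where "B = iterate \<beta> D n x" and "E = iterate \<beta> D n (x + \<beta>)"
  define D0 Dn where "D0 = D (of_real x)" and "Dn = D (of_real (x + real n * \<beta>))"
  have eq: "E ** D0 = Dn ** B"
    using iterate_Suc_right[of n x] by (simp add: B_def E_def D0_def Dn_def)
  have k: "norm D0 \<le> K" "norm Dn \<le> K" unfolding D0_def Dn_def by (intro bound real_in_strip)+
  have "norm E * exp (- s) \<le> norm E * norm (det D0)" using d by (intro mult_left_mono) (auto simp: D0_def)
  also have "\<dots> \<le> norm (Dn ** B) * norm D0" using norm_mult_det_le_right[of E D0] eq by simp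
  also have "\<dots> \<le> (norm Dn * norm B) * norm D0" by (intro mult_right_mono norm_matrix_mult_le) auto
  also have "\<dots> \<le> (K * norm B) * K" using k K1 by (intro mult_mono mult_nonneg_nonneg) auto
  finally have 1: "norm E * exp (- s) \<le> K\<^sup>2 * norm B" by (simp add: power2_eq_square mult_ac)
  have "norm B * exp (- s) \<le> norm B * norm (det Dn)" using d by (intro mult_left_mono) (auto simp: Dn_def)
  also have "\<dots> \<le> norm Dn * norm (E ** D0)" using norm_mult_det_le_left[of B Dn] eq by simp
  also have "\<dots> \<le> norm Dn * (norm E * norm D0)" by (intro mult_left_mono norm_matrix_mult_le) auto
  also have "\<dots> \<le> K * (norm E * K)" using k K1 by (intro mult_mono mult_nonneg_nonneg) auto
  finally have 2: "norm B * exp (- s) \<le> K\<^sup>2 * norm E" by (simp add: power2_eq_square mult_ac)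
  show ?thesis
    using reg_norm_shift_le[OF s e 1[unfolded E_def B_def]] reg_norm_shift_le[OF s e 2[unfolded E_def B_def]] by linarith
qed

lemma ln_reg_norm_shifts:
  assumes s: "s \<ge> 0" and e: "\<epsilon> > 0"
    and d: "\<And>i. i < Q \<Longrightarrow> exp (- s) \<le> det_at (x + real i * \<beta>)"
      "\<And>i. i < Q \<Longrightarrow> exp (- s) \<le> det_at (x + real (n + i) * \<beta>)"
    and j: "j \<le> Q"
  shows "\<bar>u n \<epsilon> (x + real j * \<beta>) - u n \<epsilon> x\<bar> \<le> real j * (s + 2 * ln K)"
  using j
proof (induction j)
  case (Suc j)
  have "\<bar>u n \<epsilon> (x + real j * \<beta> + \<beta>) - u n \<epsilon> (x + real j * \<beta>)\<bar> \<le> s + 2 * ln K"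
    by (rule ln_reg_norm_step[OF s e]) (use d[of j] Suc.prems in \<open>auto simp: algebra_simps\<close>)
  moreover have "x + real (Suc j) * \<beta> = x + real j * \<beta> + \<beta>" by (simp add: algebra_simps)
  ultimately show ?case using Suc by (simp add: algebra_simps del: of_real_add)
qed simp

end

section \<open>Means of the iterates\<close>

lemma mnorm_continuous: "continuous_on UNIV mnorm"
proof -
  have le: "mnorm A \<le> mnorm B + norm (A - B)" for A B :: "complex^2^2"
    unfolding mnorm_def[of A]
  proof (rule onorm_bound)
    show "0 \<le> mnorm B + norm (A - B)" using norm_le_mnorm[of B] norm_ge_zero[of B] norm_ge_zero[of "A - B"] by linarith
    fix x
    have "A *v x = B *v x + (A - B) *v x" by (simp add: matrix_vector_mult_diff_rdistrib)
    then have "norm (A *v x) \<le> norm (B *v x) + norm ((A - B) *v x)" using norm_triangle_ineq by metis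
    then show "norm (A *v x) \<le> (mnorm B + norm (A - B)) * norm x"
      using mnorm_mult_vec_le[of B x] norm_matrix_vector_le[of "A - B" x] by (simp add: distrib_right)
  qed
  show ?thesis
  proof (rule continuous_on_eq_continuous_within[THEN iffD2], intro ballI)
    fix A :: "complex^2^2"
    have "(mnorm \<longlongrightarrow> mnorm A) (at A)"
    proof (rule tendsto_sandwich)
      show "\<forall>\<^sub>F B in at A. mnorm A - norm (B - A) \<le> mnorm B" using le[of A] by (simp add: norm_minus_commute algebra_simps)
      show "\<forall>\<^sub>F B in at A. mnorm B \<le> mnorm A + norm (B - A)" using le by simp
      show "((\<lambda>B. mnorm A - norm (B - A)) \<longlongrightarrow> mnorm A) (at A)" by (auto intro!: tendsto_eq_intros)
      show "((\<lambda>B. mnorm A + norm (B - A)) \<longlongrightarrow> mnorm A) (at A)" by (auto intro!: tendsto_eq_intros)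
    qed
    then show "continuous (at A within UNIV) mnorm" by (simp add: continuous_within)
  qed
qed

lemma nn_integral_torus_shift:
  fixes w :: "real \<Rightarrow> ennreal"
  assumes w: "w \<in> borel_measurable borel" and per: "\<And>x. w (x + 1) = w x"
  shows "(\<integral>\<^sup>+x\<in>{0..<1}. w (x + c) \<partial>lborel) = (\<integral>\<^sup>+x\<in>{0..<1}. w x \<partial>lborel)"
proof -
  have "(\<integral>\<^sup>+x\<in>{0..<1}. w (x + c) \<partial>lborel) = (\<integral>\<^sup>+x\<in>{c..<c+1}. w x \<partial>lborel)"
    using nn_integral_shift[OF w, where a=0 and b=1 and c=c] by (simp only: add_0 add.commute[of 1 c])
  then show ?thesis using nn_integral_period[OF w per, where a=c] by simp
qed

lemma space_torus: "space torus_measure = {0..<1}"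
  by (simp add: torus_measure_def space_restrict_space)

lemma nn_integral_torus: "(\<integral>\<^sup>+x. f x \<partial>torus_measure) = (\<integral>\<^sup>+x\<in>{0..<1}. f x \<partial>lborel)"
  unfolding torus_measure_def by (rule nn_integral_restrict_space) simp

lemma emeasure_torus: "A \<subseteq> {0..<1} \<Longrightarrow> emeasure torus_measure A = emeasure lborel A"
  unfolding torus_measure_def by (rule emeasure_restrict_space) auto

lemma measurable_torus: "f \<in> borel_measurable borel \<Longrightarrow> f \<in> borel_measurable torus_measure"
  unfolding torus_measure_def by (intro measurable_restrict_space1) simp

lemma integral_torus_continuous:
  fixes f :: "real \<Rightarrow> real"
  assumes f: "continuous_on UNIV f"
  shows "(LINT x|torus_measure. f x) = integral {0..1} f"
proof -
  have c: "continuous_on {0..1} f" using f by (rule continuous_on_subset) simp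
  have [measurable]: "f \<in> borel_measurable borel" using f by (rule borel_measurable_continuous_onI)
  have "(LINT x|torus_measure. f x) = (LINT x|lborel. indicator {0..<1} x *\<^sub>R f x)"
    unfolding torus_measure_def by (rule integral_restrict_space) simp
  also have "\<dots> = (LINT x:{0..1}|lborel. f x)"
    unfolding set_lebesgue_integral_def
    by (rule integral_cong_AE, measurable, rule AE_mp[OF AE_lborel_singleton[of 1]]) (auto simp: indicator_def)
  also have "\<dots> = integral {0..1} f"
    using c by (intro set_borel_integral_eq_integral borel_integrable_compact[unfolded set_integrable_def[symmetric]] set_integrable_subset)
       (auto simp: set_integrable_def intro: borel_integrable_compact)
  finally show ?thesis .
qed

text \<open>The numbers \<open>K\<close>, \<open>C1\<close> and \<open>c1\<close> will be common to
  all cocycles near a given one, so a constant built from them and \<delta> does not depend on the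
  perturbation.\<close>

locale cocycle_tail = cocycle +
  fixes C1 c1 :: real
  assumes c1: "c1 > 0" and C1: "C1 \<ge> 0"
    and tail: "\<And>s. emeasure lborel {x\<in>{0..<1}. det_at x \<le> exp (- s)} \<le> ennreal (C1 * exp (- c1 * s))"
begin

section \<open>Integrability of the logarithm of the determinant\<close>

definition psi :: "real \<Rightarrow> real" where
  "psi x = max 0 (- ln (det_at x))"

definition M1 :: real where "M1 = C1 / (1 - exp (- c1))"

lemma M1_nonneg: "M1 \<ge> 0"
  using c1 C1 by (simp add: M1_def)

lemma psi_nonneg: "psi x \<ge> 0" by (simp add: psi_def)

lemma det_measurable [measurable]: "(\<lambda>x. det (D (of_real x))) \<in> borel_measurable borel"
  by (rule sublevel_borel(3)[OF det_holomorphic[OF D] dpos])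

lemma psi_measurable [measurable]: "psi \<in> borel_measurable borel"
  unfolding psi_def by measurable

lemma D_periodic: "D (of_real (x + 1)) = D (of_real x)"
  using cocycle_periodic[OF D real_in_strip(1)[of x]] by simp

lemma psi_periodic: "psi (x + 1) = psi x"
  using D_periodic[of x] by (simp add: psi_def)

lemma psi_integral: "(\<integral>\<^sup>+x\<in>{0..<1}. ennreal (psi x) \<partial>lborel) \<le> ennreal M1"
  unfolding M1_def
proof (rule nn_integral_le_of_tail[where A = "\<lambda>k. {x\<in>{0..<1}. det_at x \<le> exp (- real k)}"])
  fix x :: real and k :: nat assume x: "x \<in> {0..<1}" and k: "real k < psi x"
  then have "real k < - ln (det_at x)" by (auto simp: psi_def max_def split: if_splits)
  \<comment> \<open>At a zero of the determinant the default \<open>ln 0 = 0\<close> gives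
    \<open>psi x = 0\<close>, which is not above any level k.\<close>
  moreover have "det (D (of_real x)) \<noteq> 0" using k by (auto simp: psi_def)
  ultimately have "det_at x < exp (- real k)"
    using ln_less_cancel_iff[of "det_at x" "exp (- real k)"] by simp
  then show "x \<in> {x\<in>{0..<1}. det_at x \<le> exp (- real k)}" using x by simp
qed (use c1 C1 tail in auto)

lemma orbit_sublevel: 
  "emeasure lborel {x\<in>{0..<1}. det_at (x + c) \<le> exp (- s)} \<le> ennreal (C1 * exp (- c1 * s))"
proof -
  let ?w = "\<lambda>x. indicator {x. det_at x \<le> exp (- s)} x :: ennreal"
  have "emeasure lborel {x\<in>{0..<1}. det_at (x + c) \<le> exp (- s)}
     = (\<integral>\<^sup>+x. indicator {x\<in>{0..<1}. det_at (x + c) \<le> exp (- s)} x \<partial>lborel)"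
    by (rule nn_integral_indicator[symmetric]) measurable
  also have "\<dots> = (\<integral>\<^sup>+x\<in>{0..<1}. ?w (x + c) \<partial>lborel)"
    by (intro nn_integral_cong) (auto simp: indicator_def)
  also have "\<dots> = (\<integral>\<^sup>+x\<in>{0..<1}. ?w x \<partial>lborel)"
  proof (rule nn_integral_torus_shift)
    show "?w (x + 1) = ?w x" for x using D_periodic[of x] by (simp add: indicator_def)
  qed measurable
  also have "\<dots> = (\<integral>\<^sup>+x. indicator {x\<in>{0..<1}. det_at x \<le> exp (- s)} x \<partial>lborel)"
    by (intro nn_integral_cong) (auto simp: indicator_def)
  also have "\<dots> = emeasure lborel {x\<in>{0..<1}. det_at x \<le> exp (- s)}"
    by (rule nn_integral_indicator) measurable
  finally show ?thesis using tail[of s] by simp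
qed

text \<open>Zeros lie in every sublevel set, so letting s tend to infinity in the tail bound shows
  that they form a null set.\<close>

lemma det_orbit_nonzero_AE: "AE x in torus_measure. \<forall>j<n. det (D (of_real (x + real j * \<beta>))) \<noteq> 0"
proof -
  have "AE x in torus_measure. det (D (of_real (x + c))) \<noteq> 0" for c
  proof -
    define Z where "Z = {x\<in>{0..<1}. det (D (of_real (x + c))) = 0}"
    have Zm: "Z \<in> sets borel" unfolding Z_def by measurable
    have Z01: "Z \<subseteq> {0..<1}" by (auto simp: Z_def)
    show ?thesis
    proof (rule AE_I)
      show "{x \<in> space torus_measure. \<not> det (D (of_real (x + c))) \<noteq> 0} \<subseteq> Z"
        by (auto simp: space_torus Z_def)
      show "Z \<in> sets torus_measure"
        unfolding torus_measure_def using Zm Z01 by (subst sets_restrict_space_iff) auto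
      have "emeasure lborel Z \<le> ennreal e" if "e > 0" for e
      proof -
        have "((\<lambda>s. exp (- c1 * s)) \<longlongrightarrow> 0) at_top" using c1 by real_asymp
        then have "((\<lambda>s. C1 * exp (- c1 * s)) \<longlongrightarrow> C1 * 0) at_top" by (intro tendsto_mult tendsto_const)
        then have "eventually (\<lambda>s. C1 * exp (- c1 * s) < e) at_top" using that by (intro order_tendstoD(2)[of _ "C1 * 0"]) auto
        then obtain s where s: "C1 * exp (- c1 * s) < e" unfolding eventually_at_top_linorder by blast
        have "emeasure lborel Z \<le> emeasure lborel {x\<in>{0..<1}. det_at (x + c) \<le> exp (- s)}"
        proof (rule emeasure_mono)
          show "{x\<in>{0..<1}. det_at (x + c) \<le> exp (- s)} \<in> sets lborel" by measurable
        qed (auto simp: Z_def)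
        also have "\<dots> \<le> ennreal (C1 * exp (- c1 * s))" by (rule orbit_sublevel)
        also have "\<dots> \<le> ennreal e" using s by (intro ennreal_leI) simp
        finally show ?thesis .
      qed
      note le = this
      have "emeasure lborel Z \<le> 0"
      proof (rule ennreal_le_epsilon)
        fix e :: real assume "e > 0"
        from le[OF this] show "emeasure lborel Z \<le> 0 + ennreal e" by simp
      qed
      moreover have "emeasure torus_measure Z = emeasure lborel Z"
        by (rule emeasure_torus[OF Z01])
      ultimately show "emeasure torus_measure Z = 0" by simp
    qed
  qed
  note ae = this
  have "AE x in torus_measure. \<forall>j\<in>{..<n}. det (D (of_real (x + real j * \<beta>))) \<noteq> 0"
    by (intro AE_finite_allI finite_lessThan ae)
  then show ?thesis by (simp only: Ball_def lessThan_iff)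
qed

definition Psi :: "nat \<Rightarrow> real \<Rightarrow> real" where "Psi n x = (\<Sum>j<n. psi (x + real j * \<beta>))"

lemma Psi_measurable [measurable]: "Psi n \<in> borel_measurable borel"
  unfolding Psi_def by measurable

lemma Psi_nonneg: "Psi n x \<ge> 0"
  unfolding Psi_def by (intro sum_nonneg psi_nonneg)

lemma Psi_integral: "(\<integral>\<^sup>+x. ennreal (Psi n x) \<partial>torus_measure) \<le> ennreal (real n * M1)"
proof -
  have "(\<integral>\<^sup>+x. ennreal (Psi n x) \<partial>torus_measure) = (\<integral>\<^sup>+x\<in>{0..<1}. (\<Sum>j<n. ennreal (psi (x + real j * \<beta>))) \<partial>lborel)"
    unfolding nn_integral_torus Psi_def by (simp add: psi_nonneg)
  also have "\<dots> = (\<Sum>j<n. \<integral>\<^sup>+x\<in>{0..<1}. ennreal (psi (x + real j * \<beta>)) \<partial>lborel)"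
    by (subst nn_integral_sum[symmetric]) (auto simp: sum_distrib_right)
  also have "\<dots> = (\<Sum>j<n. \<integral>\<^sup>+x\<in>{0..<1}. ennreal (psi x) \<partial>lborel)"
    by (intro sum.cong refl nn_integral_torus_shift[of "\<lambda>x. ennreal (psi x)"]) (simp_all add: psi_periodic)
  also have "\<dots> \<le> (\<Sum>j<n. ennreal M1)" by (intro sum_mono psi_integral)
  also have "\<dots> = ennreal (real n * M1)" using M1_nonneg by (simp add: ennreal_mult ennreal_of_nat_eq_real_of_nat)
  finally show ?thesis .
qed

text \<open>The determinant is multiplicative along the orbit and is dominated by the square of the
  Frobenius norm, hence the 1/2.\<close>

lemma ln_norm_iterate_ge:
  assumes nz: "\<forall>j<n. det (D (of_real (x + real j * \<beta>))) \<noteq> 0"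
  shows "iterate \<beta> D n x \<noteq> 0" "v n x \<ge> - Psi n x / 2"
proof -
  have det: "det (iterate \<beta> D n x) = (\<Prod>j<n. det (D (of_real (x + real j * \<beta>))))"
    by (induction n) (auto simp: det_mul mult.commute)
  have pos: "norm (det (iterate \<beta> D n x)) > 0" unfolding det using nz by auto
  have sq: "norm (det (iterate \<beta> D n x)) \<le> (norm (iterate \<beta> D n x))\<^sup>2" by (rule norm_det_le)
  then have np: "norm (iterate \<beta> D n x) > 0" using pos by (smt (verit) norm_ge_zero zero_less_power2 power_zero_numeral)
  then show "iterate \<beta> D n x \<noteq> 0" by auto
  have "- Psi n x \<le> (\<Sum>j<n. ln (det_at (x + real j * \<beta>)))"
    unfolding Psi_def sum_negf[symmetric] by (intro sum_mono) (auto simp: psi_def)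
  also have "\<dots> = ln (norm (det (iterate \<beta> D n x)))"
    unfolding det prod_norm[symmetric] by (rule ln_prod[symmetric]) (use nz in auto)
  also have "\<dots> \<le> ln ((norm (iterate \<beta> D n x))\<^sup>2)" using sq pos np by (subst ln_le_cancel_iff) auto
  also have "\<dots> = 2 * v n x" using np by (simp add: ln_realpow)
  finally show "v n x \<ge> - Psi n x / 2" by simp
qed

lemma norm_le_reg_norm: "norm (iterate \<beta> D n x) \<le> reg_norm \<beta> D n \<epsilon> (of_real x)" if "\<epsilon> \<ge> 0"
  unfolding reg_norm_def citer_of_real using that by (intro real_le_rsqrt) simp

text \<open>For n > 0 it dominates |\<open>v n\<close>| and, uniformly in 0 < \<epsilon> <= 1,
  |\<open>u n \<epsilon>\<close>| almost everywhere. Its integral is linear in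
  \<open>n\<close>.\<close>

definition majorant :: "nat \<Rightarrow> real \<Rightarrow> real" where "majorant n x = real n * ln (3 * K) + Psi n x / 2"

lemma majorant_integral: "(\<integral>\<^sup>+x. ennreal (majorant n x) \<partial>torus_measure) \<le> ennreal (real n * (ln (3 * K) + M1 / 2))"
proof -
  have lnK: "ln (3 * K) \<ge> 0" using K1 by simp
  have one: "emeasure torus_measure (space torus_measure) = 1" by (simp add: space_torus emeasure_torus)
  have "(\<integral>\<^sup>+x. ennreal (majorant n x) \<partial>torus_measure) = (\<integral>\<^sup>+x. ennreal (real n * ln (3 * K)) + ennreal (1/2) * ennreal (Psi n x) \<partial>torus_measure)"
  proof (rule nn_integral_cong)
    fix x
    have "ennreal (1/2) * ennreal (Psi n x) = ennreal (1/2 * Psi n x)"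
      by (rule ennreal_mult[symmetric]) (simp_all add: Psi_nonneg)
    then show "ennreal (majorant n x) = ennreal (real n * ln (3 * K)) + ennreal (1/2) * ennreal (Psi n x)"
      unfolding majorant_def using lnK Psi_nonneg by (subst ennreal_plus) auto
  qed
  also have "\<dots> = (\<integral>\<^sup>+x. ennreal (real n * ln (3 * K)) \<partial>torus_measure) + ennreal (1/2) * (\<integral>\<^sup>+x. ennreal (Psi n x) \<partial>torus_measure)"
    using measurable_torus[OF Psi_measurable] by (subst nn_integral_add) (auto simp: nn_integral_cmult)
  also have "\<dots> \<le> ennreal (real n * ln (3 * K)) + ennreal (1/2) * ennreal (real n * M1)"
    by (intro add_mono mult_left_mono Psi_integral) (simp_all add: one)
  also have "\<dots> = ennreal (real n * (ln (3 * K) + M1 / 2))"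
  proof -
    have "ennreal (1/2) * ennreal (real n * M1) = ennreal (1/2 * (real n * M1))"
      by (rule ennreal_mult[symmetric]) (simp_all add: M1_nonneg)
    moreover have "real n * (ln (3 * K) + M1 / 2) = real n * ln (3 * K) + 1/2 * (real n * M1)" by (simp add: algebra_simps)
    ultimately show ?thesis using lnK M1_nonneg by (simp only: ennreal_plus mult_nonneg_nonneg of_nat_0_le_iff)
  qed
  finally show ?thesis .
qed

lemma majorant_nonneg: "majorant n x \<ge> 0"
  using Psi_nonneg K1 by (simp add: majorant_def)

lemma majorant_integrable: "integrable torus_measure (majorant n)"
proof (rule integrableI_bounded)
  show "majorant n \<in> borel_measurable torus_measure" by (intro measurable_torus) (simp add: majorant_def[abs_def])
  show "(\<integral>\<^sup>+x. ennreal (norm (majorant n x)) \<partial>torus_measure) < \<infinity>"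
    using le_less_trans[OF majorant_integral ennreal_less_top] majorant_nonneg by simp
qed

lemma reg_norm_line_continuous:
  assumes e: "\<epsilon> > 0"
  shows "continuous_on UNIV (\<lambda>x. u n \<epsilon> x)"
proof -
  interpret p: peaked \<delta> "reg_norm \<beta> D n \<epsilon>" by (rule peaked_reg_norm[OF e])
  show ?thesis using p.line_cont[of 0] dpos by (simp add: complex_of_real_def)
qed

lemma mean_eq_integral:
  assumes e: "\<epsilon> > 0"
  shows "u_mean n \<epsilon> = (LINT x|torus_measure. u n \<epsilon> x)"
proof -
  interpret p: peaked \<delta> "reg_norm \<beta> D n \<epsilon>" by (rule peaked_reg_norm[OF e])
  show ?thesis unfolding integral_torus_continuous[OF reg_norm_line_continuous[OF e]] p.mean_def
    by (simp add: complex_of_real_def)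
qed

lemma iterate_continuous: "continuous_on UNIV (iterate \<beta> D n)"
proof -
  have "continuous_on UNIV (\<lambda>x. citer \<beta> D n (of_real x))"
    by (rule continuous_on_compose2[OF citer_continuous]) (auto intro!: continuous_intros simp: real_in_strip)
  then show ?thesis by (simp add: citer_of_real)
qed

lemma ln_norm_measurable [measurable]: "(\<lambda>x. v n x) \<in> borel_measurable borel"
proof -
  have [measurable]: "(\<lambda>x. norm (iterate \<beta> D n x)) \<in> borel_measurable borel"
    by (intro borel_measurable_continuous_onI continuous_on_norm iterate_continuous)
  show ?thesis by measurable
qed

lemma ln_mnorm_measurable [measurable]: "(\<lambda>x. ln (mnorm (iterate \<beta> D n x))) \<in> borel_measurable borel"
proof -
  have [measurable]: "(\<lambda>x. mnorm (iterate \<beta> D n x)) \<in> borel_measurable borel"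
    by (intro borel_measurable_continuous_onI continuous_on_compose2[OF mnorm_continuous iterate_continuous]) auto
  show ?thesis by measurable
qed

lemma ln_bounds:
  assumes nz: "\<forall>j<n. det (D (of_real (x + real j * \<beta>))) \<noteq> 0" and n: "n > 0" and e: "0 < \<epsilon>" "\<epsilon> \<le> 1"
  shows "\<bar>v n x\<bar> \<le> majorant n x" "\<bar>u n \<epsilon> x\<bar> \<le> majorant n x"
proof -
  note lower = ln_norm_iterate_ge[OF nz]
  have "v n x \<le> u n \<epsilon> x"
    using lower(1) norm_le_reg_norm[of \<epsilon> n x] reg_norm_pos[OF e(1)] e by (subst ln_le_cancel_iff) auto
  moreover have "u n \<epsilon> x \<le> real n * ln (3 * K)"
    by (rule ln_reg_norm_le[OF e n real_in_strip(2)])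
  moreover have "real n * ln (3 * K) \<ge> 0" using K1 by simp
  ultimately show "\<bar>v n x\<bar> \<le> majorant n x" "\<bar>u n \<epsilon> x\<bar> \<le> majorant n x"
    using lower(2) Psi_nonneg[of n x] unfolding majorant_def by (auto simp: abs_le_iff)
qed

text \<open>Supplies the constant \<open>A1\<close> of the orbit estimates. Its linear growth in
  \<open>n\<close>, uniform in \<epsilon>, is what makes the final rate independent of
  \<open>n\<close>.\<close>

lemma mean_lower:
  assumes n: "n > 0" and e: "0 < \<epsilon>" "\<epsilon> \<le> 1"
  shows "real n * ln (3 * K) - u_mean n \<epsilon> \<le> real n * (ln (3 * K) + M1 / 2)"
proof -
  interpret p: peaked \<delta> "reg_norm \<beta> D n \<epsilon>" by (rule peaked_reg_norm[OF e(1)])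
  have "ennreal (real n * ln (3 * K) - p.mean 0) = (\<integral>\<^sup>+x. ennreal (real n * ln (3 * K) - ln (reg_norm \<beta> D n \<epsilon> (Complex x 0))) \<partial>torus_measure)"
    unfolding nn_integral_torus by (rule p.line_integral(1)[symmetric]) (use ln_reg_norm_le[OF e n] dpos in auto)
  also have "\<dots> \<le> (\<integral>\<^sup>+x. ennreal (majorant n x) \<partial>torus_measure)"
  proof (rule nn_integral_mono_AE, rule AE_mp[OF det_orbit_nonzero_AE[of n]], rule AE_I2, intro impI ennreal_leI)
    fix x assume nz: "\<forall>j<n. det (D (of_real (x + real j * \<beta>))) \<noteq> 0"
    note lower = ln_norm_iterate_ge[OF nz]
    have "v n x \<le> u n \<epsilon> x"
      using lower(1) norm_le_reg_norm[of \<epsilon> n x] reg_norm_pos[OF e(1)] e by (subst ln_le_cancel_iff) auto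
    then show "real n * ln (3 * K) - ln (reg_norm \<beta> D n \<epsilon> (Complex x 0)) \<le> majorant n x"
      using lower(2) by (simp add: majorant_def complex_of_real_def)
  qed
  also have "\<dots> \<le> ennreal (real n * (ln (3 * K) + M1 / 2))" by (rule majorant_integral)
  finally show ?thesis using K1 M1_nonneg by (subst (asm) ennreal_le_iff) auto
qed

lemma mean_limit:
  assumes n: "n > 0" and e: "\<And>k. 0 < \<epsilon> k" "\<And>k. \<epsilon> k \<le> 1" "\<epsilon> \<longlonglongrightarrow> 0"
  shows "(\<lambda>k. u_mean n (\<epsilon> k)) \<longlonglongrightarrow> (LINT x|torus_measure. v n x)"
    and "\<And>x. iterate \<beta> D n x \<noteq> 0 \<Longrightarrow> (\<lambda>k. u n (\<epsilon> k) x) \<longlonglongrightarrow> v n x"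
proof -
  show lim: "(\<lambda>k. u n (\<epsilon> k) x) \<longlonglongrightarrow> v n x" if nz: "iterate \<beta> D n x \<noteq> 0" for x
  proof -
    have "(\<lambda>k. sqrt ((norm (iterate \<beta> D n x))\<^sup>2 + \<epsilon> k)) \<longlonglongrightarrow> sqrt ((norm (iterate \<beta> D n x))\<^sup>2 + 0)"
      by (intro tendsto_intros e(3))
    then have "(\<lambda>k. ln (sqrt ((norm (iterate \<beta> D n x))\<^sup>2 + \<epsilon> k))) \<longlonglongrightarrow> ln (sqrt ((norm (iterate \<beta> D n x))\<^sup>2 + 0))"
      using nz by (intro tendsto_ln) auto
    then show ?thesis by (simp add: reg_norm_def citer_of_real)
  qed
  show "(\<lambda>k. u_mean n (\<epsilon> k)) \<longlonglongrightarrow> (LINT x|torus_measure. v n x)"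
    unfolding mean_eq_integral[OF e(1)]
  proof (rule integral_dominated_convergence[where w="majorant n"])
    show "(\<lambda>x. v n x) \<in> borel_measurable torus_measure" by (intro measurable_torus ln_norm_measurable)
    show "(\<lambda>x. u n (\<epsilon> k) x) \<in> borel_measurable torus_measure" for k
      by (intro measurable_torus borel_measurable_continuous_onI reg_norm_line_continuous e)
    show "integrable torus_measure (majorant n)" by (rule majorant_integrable)
    show "AE x in torus_measure. (\<lambda>k. u n (\<epsilon> k) x) \<longlonglongrightarrow> v n x"
      by (rule AE_mp[OF det_orbit_nonzero_AE[of n]], rule AE_I2, intro impI lim ln_norm_iterate_ge(1))
    show "AE x in torus_measure. norm (u n (\<epsilon> k) x) \<le> majorant n x" for k
      by (rule AE_mp[OF det_orbit_nonzero_AE[of n]], rule AE_I2) (use ln_bounds(2) n e in auto)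
  qed
qed

lemma ln_mnorm_close:
  assumes "A \<noteq> 0"
  shows "mnorm A > 0" "ln (mnorm A) \<le> ln (norm A)" "ln (norm A) - ln 2 \<le> ln (mnorm A)"
proof -
  have n: "norm A > 0" using assms by simp
  then show m: "mnorm A > 0" using norm_le_mnorm[of A] by linarith
  show "ln (mnorm A) \<le> ln (norm A)" by (rule iffD2[OF ln_le_cancel_iff]) (use m n mnorm_le_norm[of A] in linarith)+
  have "ln (norm A) \<le> ln (2 * mnorm A)" by (rule iffD2[OF ln_le_cancel_iff]) (use m n norm_le_mnorm[of A] in linarith)+
  also have "\<dots> = ln 2 + ln (mnorm A)" using m by (subst ln_mult) auto
  finally show "ln (norm A) - ln 2 \<le> ln (mnorm A)" by simp
qed

text \<open>The factor 2 between operator and Frobenius norm enters once for the whole product and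
  not once per step, so it will be negligible against n \<kappa>.\<close>

lemma lyap_close:
  assumes n: "n > 0"
  shows "\<bar>real n * lyap n \<beta> D - (LINT x|torus_measure. v n x)\<bar> \<le> ln 2"
proof -
  note AE = det_orbit_nonzero_AE[of n]
  have b: "AE x in torus_measure. \<bar>v n x\<bar> \<le> majorant n x"
    by (rule AE_mp[OF AE], rule AE_I2) (use ln_bounds(1)[of n _ 1] n in auto)
  have c: "AE x in torus_measure. ln (mnorm (iterate \<beta> D n x)) \<le> v n x \<and> v n x - ln 2 \<le> ln (mnorm (iterate \<beta> D n x))"
    by (rule AE_mp[OF AE], rule AE_I2) (use ln_mnorm_close ln_norm_iterate_ge(1) in auto)
  have fin: "finite_measure torus_measure" by (rule finite_measureI) (simp add: space_torus emeasure_torus)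
  interpret finite_measure torus_measure by (rule fin)
  have m1: "measure torus_measure (space torus_measure) = 1" by (simp add: measure_def space_torus emeasure_torus)
  have i1: "integrable torus_measure (\<lambda>x. v n x)"
    by (rule Bochner_Integration.integrable_bound[OF majorant_integrable[of n]])
       (use b majorant_nonneg in \<open>auto intro: measurable_torus elim!: eventually_mono\<close>)
  have i0: "integrable torus_measure (\<lambda>x. majorant n x + ln 2)" by (intro Bochner_Integration.integrable_add majorant_integrable) simp
  have i2: "integrable torus_measure (\<lambda>x. ln (mnorm (iterate \<beta> D n x)))"
  proof (rule Bochner_Integration.integrable_bound[OF i0])
    show "AE x in torus_measure. norm (ln (mnorm (iterate \<beta> D n x))) \<le> norm (majorant n x + ln 2)"
    proof (rule AE_mp[OF b], rule AE_mp[OF c], rule AE_I2, intro impI)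
      fix x assume "ln (mnorm (iterate \<beta> D n x)) \<le> v n x \<and> v n x - ln 2 \<le> ln (mnorm (iterate \<beta> D n x))"
        "\<bar>v n x\<bar> \<le> majorant n x"
      moreover have "ln (2::real) \<ge> 0" by simp
      ultimately show "norm (ln (mnorm (iterate \<beta> D n x))) \<le> norm (majorant n x + ln 2)" unfolding real_norm_def by linarith
    qed
  qed (intro measurable_torus ln_mnorm_measurable)
  have "(LINT x|torus_measure. ln (mnorm (iterate \<beta> D n x))) \<le> (LINT x|torus_measure. v n x)"
    by (rule integral_mono_AE[OF i2 i1]) (use c in auto)
  moreover have "(LINT x|torus_measure. v n x - ln 2) \<le> (LINT x|torus_measure. ln (mnorm (iterate \<beta> D n x)))"
    by (rule integral_mono_AE[OF _ i2]) (use c i1 in auto)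
  moreover have "(LINT x|torus_measure. v n x - ln 2) = (LINT x|torus_measure. v n x) - ln 2"
    using i1 by (subst Bochner_Integration.integral_diff) (auto simp: m1)
  moreover have "real n * lyap n \<beta> D = (LINT x|torus_measure. ln (mnorm (iterate \<beta> D n x)))"
    using n by (simp add: lyap_def)
  ultimately show ?thesis by (simp add: abs_le_iff)
qed

end

section \<open>Large deviations\<close>

context cocycle_tail
begin

text \<open>The constant of the orbit estimates per unit of \<open>n\<close>, with T = \<delta>/2
  and the \<open>A1\<close> from \<open>mean_lower\<close>: an orbit average exceeds the mean by at
  most n G / q.\<close>

definition G :: real where "G = (ln (3 * K) + M1 / 2) * (8 / (\<delta> / 2) + 4)"

lemma rate_pos: "ln (3 * K) + M1 / 2 > 0" "G > 0"
proof -
  have "ln (3 * K) > 0" using K1 by simp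
  then show "ln (3 * K) + M1 / 2 > 0" using M1_nonneg by linarith
  moreover have "8 / (\<delta> / 2) + 4 > 0" using dpos by (simp add: add_pos_pos)
  ultimately show "G > 0" unfolding G_def by (rule mult_pos_pos)
qed

text \<open>The allowance n \<kappa> / 2 is halved. One half covers the passage from u(x) to the
  orbit average, off the sets \<open>B\<close> where a determinant is small. The other half
  separates the average from the mean: from above by the hypothesis on G / q, from below off the set
  \<open>F\<close>. The 24 is this 4 times the 6 of Cartan's estimate.\<close>

lemma regularized_deviation:
  assumes n: "n > 0" and e: "0 < \<epsilon>" "\<epsilon> \<le> 1" and q: "q > 0" "8 / real q \<le> \<delta> / 2" "(real q)\<^sup>2 \<le> real Q"
    and cop: "coprime P (int Q)" and approx: "\<bar>\<beta> - of_int P / real Q\<bar> \<le> 1 / (real Q)\<^sup>2"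
    and \<kappa>: "\<kappa> > 0" "G / real q \<le> \<kappa> / 4" and s: "s \<ge> 0" "real Q * (s + 2 * ln K) \<le> real n * \<kappa> / 4"
  shows "emeasure lborel {x\<in>{0..<1}. \<bar>u n \<epsilon> x - u_mean n \<epsilon>\<bar> > real n * \<kappa> / 2}
    \<le> ennreal (2 * real Q * (C1 * exp (- c1 * s)) + 10 * exp 1 * exp (- (\<kappa> * real q / (24 * G))))"
proof -
  interpret p: peaked \<delta> "reg_norm \<beta> D n \<epsilon>" by (rule peaked_reg_norm[OF e(1)])
  define N where "N = reg_norm \<beta> D n \<epsilon>"
  have "real Q > 0" using q by (smt (verit) of_nat_0_less_iff zero_less_power)
  then have Q: "Q > 0" by simp
  define A1 where "A1 = real n * (ln (3 * K) + M1 / 2)"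
  have A1: "A1 > 0" unfolding A1_def using n rate_pos by simp
  have M: "\<And>z. z \<in> ostrip \<delta> \<Longrightarrow> ln (N z) \<le> real n * ln (3 * K)" unfolding N_def by (rule ln_reg_norm_le[OF e n])
  have MA: "real n * ln (3 * K) - p.mean 0 \<le> A1" unfolding A1_def by (rule mean_lower[OF n e])
  have T: "0 < \<delta> / 2" "\<delta> / 2 < \<delta>" using dpos by auto
  note bnd = p.orbit_sum_uniform_bound[OF M[unfolded N_def] T Q cop approx q MA A1]
  note dev = p.orbit_sum_deviation[OF M[unfolded N_def] T Q cop approx q MA A1, of "real n * \<kappa> / 4", folded N_def]
  define S where "S x = (\<Sum>j<Q. ln (N (of_real (x + real j * \<beta>))))" for x
  have up: "S x \<le> real Q * (p.mean 0 + real n * \<kappa> / 4)" for x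
  proof -
    have "S x \<le> real Q * p.mean 0 + real Q / real q * A1 * (8 / (\<delta> / 2) + 4)"
      using bnd[of "of_real x"] unfolding S_def N_def by simp
    also have "real Q / real q * A1 * (8 / (\<delta> / 2) + 4) = real Q * (real n * (G / real q))"
      by (simp add: A1_def G_def mult_ac)
    also have "\<dots> \<le> real Q * (real n * (\<kappa> / 4))" by (intro mult_left_mono \<kappa>(2)) auto
    finally show ?thesis by (simp add: algebra_simps)
  qed
  define B where "B c = {x\<in>{0..<1}. det_at (x + c) \<le> exp (- s)}" for c
  define F where "F = {x\<in>{0..<1}. S x < real Q * (p.mean 0 - real n * \<kappa> / 4)}"
  have Bm: "B c \<in> sets lborel" for c unfolding B_def by measurable
  have "continuous_on UNIV (\<lambda>x. ln (N (of_real (x + c))))" for c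
    unfolding N_def by (rule continuous_on_compose2[OF reg_norm_line_continuous[OF e(1)]])
      (auto intro: continuous_on_add continuous_on_id continuous_on_const)
  then have [measurable]: "(\<lambda>x. ln (N (of_real (x + c)))) \<in> borel_measurable borel" for c by (rule borel_measurable_continuous_onI)
  have Fm: "F \<in> sets lborel" unfolding F_def S_def by measurable
  have "{x\<in>{0..<1}. \<bar>ln (N (of_real x)) - p.mean 0\<bar> > real n * \<kappa> / 2}
    \<subseteq> ((\<Union>i<Q. B (real i * \<beta>)) \<union> (\<Union>i<Q. B (real (n + i) * \<beta>))) \<union> F"
  proof
    fix x assume "x \<in> {x\<in>{0..<1}. \<bar>ln (N (of_real x)) - p.mean 0\<bar> > real n * \<kappa> / 2}"
    then have x: "x \<in> {0..<1}" "\<bar>ln (N (of_real x)) - p.mean 0\<bar> > real n * \<kappa> / 2" by auto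
    show "x \<in> ((\<Union>i<Q. B (real i * \<beta>)) \<union> (\<Union>i<Q. B (real (n + i) * \<beta>))) \<union> F"
    proof (rule ccontr)
      assume nx: "x \<notin> ((\<Union>i<Q. B (real i * \<beta>)) \<union> (\<Union>i<Q. B (real (n + i) * \<beta>))) \<union> F"
      have d1: "exp (- s) \<le> det_at (x + real i * \<beta>)" if "i < Q" for i
      proof -
        have "x \<notin> B (real i * \<beta>)" using nx that by blast
        then show ?thesis using x(1) unfolding B_def by (simp del: of_real_add)
      qed
      have d2: "exp (- s) \<le> det_at (x + real (n + i) * \<beta>)" if "i < Q" for i
      proof -
        have "x \<notin> B (real (n + i) * \<beta>)" using nx that by blast
        then show ?thesis using x(1) unfolding B_def by (simp del: of_real_add)
      qed
      have lnK: "ln K \<ge> 0" using K1 by simp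
      have "\<bar>ln (N (of_real (x + real j * \<beta>))) - ln (N (of_real x))\<bar> \<le> real n * \<kappa> / 4" if "j < Q" for j
      proof -
        have "\<bar>ln (N (of_real (x + real j * \<beta>))) - ln (N (of_real x))\<bar> \<le> real j * (s + 2 * ln K)"
          unfolding N_def by (rule ln_reg_norm_shifts[OF s(1) e(1) d1 d2]) (use that in auto)
        also have "\<dots> \<le> real Q * (s + 2 * ln K)" using that s lnK by (intro mult_right_mono) auto
        finally show ?thesis using s(2) by linarith
      qed
      note close = this
      have "ln (N (of_real x)) - real n * \<kappa> / 4 \<le> ln (N (of_real (x + real j * \<beta>)))" if "j < Q" for j
        using close[OF that] by linarith
      moreover have "ln (N (of_real (x + real j * \<beta>))) \<le> ln (N (of_real x)) + real n * \<kappa> / 4" if "j < Q" for j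
        using close[OF that] by linarith
      ultimately have "(\<Sum>j<Q. ln (N (of_real x)) - real n * \<kappa> / 4) \<le> S x" "S x \<le> (\<Sum>j<Q. ln (N (of_real x)) + real n * \<kappa> / 4)"
        unfolding S_def by (intro sum_mono; simp)+
      then have SQ: "real Q * (ln (N (of_real x)) - real n * \<kappa> / 4) \<le> S x" "S x \<le> real Q * (ln (N (of_real x)) + real n * \<kappa> / 4)" by auto
      have "real Q * (p.mean 0 - real n * \<kappa> / 4) \<le> S x" using nx x(1) unfolding F_def by auto
      then have "real Q * (p.mean 0 - real n * \<kappa> / 4) \<le> real Q * (ln (N (of_real x)) + real n * \<kappa> / 4)" using SQ(2) by linarith
      then have 1: "p.mean 0 - real n * \<kappa> / 4 \<le> ln (N (of_real x)) + real n * \<kappa> / 4" using Q by simp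
      have "real Q * (ln (N (of_real x)) - real n * \<kappa> / 4) \<le> real Q * (p.mean 0 + real n * \<kappa> / 4)" using SQ(1) up[of x] by linarith
      then have 2: "ln (N (of_real x)) - real n * \<kappa> / 4 \<le> p.mean 0 + real n * \<kappa> / 4" using Q by simp
      show False using 1 2 x(2) by linarith
    qed
  qed
  then have "emeasure lborel {x\<in>{0..<1}. \<bar>ln (N (of_real x)) - p.mean 0\<bar> > real n * \<kappa> / 2}
    \<le> emeasure lborel (((\<Union>i<Q. B (real i * \<beta>)) \<union> (\<Union>i<Q. B (real (n + i) * \<beta>))) \<union> F)"
    using Bm Fm by (intro emeasure_mono) auto
  also have "\<dots> \<le> emeasure lborel ((\<Union>i<Q. B (real i * \<beta>)) \<union> (\<Union>i<Q. B (real (n + i) * \<beta>))) + emeasure lborel F"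
    using Bm Fm by (intro emeasure_subadditive) auto
  also have "\<dots> \<le> (emeasure lborel (\<Union>i<Q. B (real i * \<beta>)) + emeasure lborel (\<Union>i<Q. B (real (n + i) * \<beta>))) + emeasure lborel F"
    using Bm by (intro add_right_mono emeasure_subadditive) auto
  also have "\<dots> \<le> (ennreal (real Q * (C1 * exp (- c1 * s))) + ennreal (real Q * (C1 * exp (- c1 * s)))) + ennreal (10 * exp 1 * exp (- (\<kappa> * real q / (24 * G))))"
  proof (intro add_mono)
    have U: "emeasure lborel (\<Union>i<Q. B (c i)) \<le> ennreal (real Q * (C1 * exp (- c1 * s)))" for c :: "nat \<Rightarrow> real"
      unfolding B_def by (intro emeasure_UN_le orbit_sublevel) measurable
    show "emeasure lborel (\<Union>i<Q. B (real i * \<beta>)) \<le> ennreal (real Q * (C1 * exp (- c1 * s)))" by (rule U)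
    show "emeasure lborel (\<Union>i<Q. B (real (n + i) * \<beta>)) \<le> ennreal (real Q * (C1 * exp (- c1 * s)))" by (rule U)
    have "real n * \<kappa> / 4 * real q / (A1 * (8 / (\<delta> / 2) + 4)) / 6 = \<kappa> * real q / (24 * G)"
    proof -
      have "A1 * (8 / (\<delta> / 2) + 4) = real n * G" by (simp add: A1_def G_def)
      then show ?thesis using n rate_pos by (simp add: field_simps)
    qed
    then have "- (real n * \<kappa> / 4 * real q / (A1 * (8 / (\<delta> / 2) + 4))) / 6 = - (\<kappa> * real q / (24 * G))" by simp
    then show "emeasure lborel F \<le> ennreal (10 * exp 1 * exp (- (\<kappa> * real q / (24 * G))))"
      using dev unfolding F_def S_def N_def by simp
  qed
  also have "\<dots> = ennreal (2 * real Q * (C1 * exp (- c1 * s)) + 10 * exp 1 * exp (- (\<kappa> * real q / (24 * G))))"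
    using C1 by (subst ennreal_plus[symmetric], simp, simp)+
  finally show ?thesis unfolding N_def .
qed

text \<open>Passage to \<epsilon> = 0. A strict deviation in the limit is a deviation for all large
  k, so up to a null set the deviation set lies in the lower limit \<open>U\<close> of the sets
  \<open>A k\<close>, which has measure at most \<open>b\<close> by continuity from below.
  Exchanging the norms, in the function and in its mean, costs 2 ln 2, less than n \<kappa> /
  2.\<close>

lemma deviation_measure_le:
  assumes n: "n > 0" and \<kappa>: "4 * ln 2 < real n * \<kappa>" and b: "b \<ge> 0"
    and E: "\<And>\<epsilon>. 0 < \<epsilon> \<Longrightarrow> \<epsilon> \<le> 1 \<Longrightarrow>
      emeasure lborel {x\<in>{0..<1}. \<bar>u n \<epsilon> x - u_mean n \<epsilon>\<bar> > real n * \<kappa> / 2} \<le> ennreal b"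
  shows "measure torus_measure (deviation_set \<beta> D n \<kappa>) \<le> b"
proof -
  define \<epsilon> where "\<epsilon> k = inverse (real (Suc k))" for k
  have e: "0 < \<epsilon> k" "\<epsilon> k \<le> 1" for k by (auto simp: \<epsilon>_def inverse_le_1_iff)
  have e0: "\<epsilon> \<longlonglongrightarrow> 0" unfolding \<epsilon>_def by (rule LIMSEQ_inverse_real_of_nat)
  define L where "L = (LINT x|torus_measure. v n x)"
  define A where "A k = {x\<in>{0..<1}. \<bar>u n (\<epsilon> k) x - u_mean n (\<epsilon> k)\<bar> > real n * \<kappa> / 2}" for k
  have Am: "A k \<in> sets lborel" for k
  proof -
    have [measurable]: "(\<lambda>x. u n (\<epsilon> k) x) \<in> borel_measurable borel"
      by (intro borel_measurable_continuous_onI reg_norm_line_continuous e)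
    show ?thesis unfolding A_def by measurable
  qed
  define U where "U = (\<Union>m. \<Inter>k\<in>{m..}. A k)"
  have Im: "(\<Inter>k\<in>{m..}. A k) \<in> sets lborel" for m using Am by (intro sets.countable_INT) auto
  have U01: "U \<subseteq> {0..<1}" unfolding U_def A_def by force
  have Um: "U \<in> sets lborel" unfolding U_def using Im by auto
  have "emeasure lborel U \<le> ennreal b"
  proof -
    have "incseq (\<lambda>m. \<Inter>k\<in>{m..}. A k)" by (intro monoI INT_anti_mono) auto
    then have "emeasure lborel U = (SUP m. emeasure lborel (\<Inter>k\<in>{m..}. A k))"
      unfolding U_def using Im by (intro SUP_emeasure_incseq[symmetric]) auto
    also have "\<dots> \<le> ennreal b"
    proof (rule SUP_least)
      fix m
      have "emeasure lborel (\<Inter>k\<in>{m..}. A k) \<le> emeasure lborel (A m)" using Am by (intro emeasure_mono) auto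
      also have "\<dots> \<le> ennreal b" unfolding A_def by (rule E[OF e])
      finally show "emeasure lborel (\<Inter>k\<in>{m..}. A k) \<le> ennreal b" .
    qed
    finally show ?thesis .
  qed
  moreover have "emeasure torus_measure (deviation_set \<beta> D n \<kappa>) \<le> emeasure torus_measure U"
  proof (rule emeasure_mono_AE)
    show "U \<in> sets torus_measure" unfolding torus_measure_def using U01 Um by (subst sets_restrict_space_iff) auto
    show "AE x in torus_measure. x \<in> deviation_set \<beta> D n \<kappa> \<longrightarrow> x \<in> U"
    proof (rule AE_mp[OF det_orbit_nonzero_AE[of n]], rule AE_I2, intro impI)
      fix x assume nz: "\<forall>j<n. det (D (of_real (x + real j * \<beta>))) \<noteq> 0" and x: "x \<in> deviation_set \<beta> D n \<kappa>"
      have it: "iterate \<beta> D n x \<noteq> 0" by (rule ln_norm_iterate_ge(1)[OF nz])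
      note mc = ln_mnorm_close[OF it]
      have x01: "x \<in> {0..<1}" using x by (simp add: deviation_set_def space_torus)
      have "\<bar>1 / real n * ln (mnorm (iterate \<beta> D n x)) - lyap n \<beta> D\<bar> > \<kappa>"
        using x mc(1) unfolding deviation_set_def elog_def by simp
      then have "real n * \<kappa> < real n * \<bar>1 / real n * ln (mnorm (iterate \<beta> D n x)) - lyap n \<beta> D\<bar>" using n by simp
      also have "\<dots> = \<bar>real n * (1 / real n * ln (mnorm (iterate \<beta> D n x)) - lyap n \<beta> D)\<bar>" by (simp only: abs_mult abs_of_nat)
      also have "real n * (1 / real n * ln (mnorm (iterate \<beta> D n x)) - lyap n \<beta> D) = ln (mnorm (iterate \<beta> D n x)) - real n * lyap n \<beta> D"
        using n by (simp add: right_diff_distrib)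
      finally have "\<bar>v n x - L\<bar> > real n * \<kappa> / 2"
        using mc lyap_close[OF n] \<kappa> unfolding L_def[symmetric] by linarith
      moreover have "(\<lambda>k. \<bar>u n (\<epsilon> k) x - u_mean n (\<epsilon> k)\<bar>) \<longlonglongrightarrow> \<bar>v n x - L\<bar>"
        unfolding L_def using mean_limit(1)[OF n e e0] mean_limit(2)[OF n e e0 it] by (intro tendsto_rabs tendsto_diff)
      ultimately have "eventually (\<lambda>k. \<bar>u n (\<epsilon> k) x - u_mean n (\<epsilon> k)\<bar> > real n * \<kappa> / 2) sequentially"
        by (intro order_tendstoD(1))
      then show "x \<in> U" unfolding eventually_sequentially U_def A_def using x01 by auto
    qed
  qed
  ultimately have "emeasure torus_measure (deviation_set \<beta> D n \<kappa>) \<le> ennreal b" using emeasure_torus[OF U01] by simp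
  then show ?thesis unfolding measure_def by (intro enn2real_leI b)
qed

end

text \<open>With N = q^(a+1), Dirichlet's theorem gives |Q \<beta> - h| < 1/N, and the Diophantine
  condition turns this into Q^r > b N / (2 pi). If Q were below q^2, then Q^r <= q^(2r) <= q^a, a
  contradiction as b q >= 2 pi: the extra power of q in N absorbs the constant.\<close>

lemma diophantine_denominator:
  fixes \<beta> b r :: real and q :: nat
  assumes b: "b > 0" and r: "r > 1"
    and dio: "\<And>j::int. j \<noteq> 0 \<Longrightarrow> \<bar>sin (2 * pi * of_int j * \<beta>)\<bar> > b / \<bar>of_int j\<bar> powr r"
    and q: "q \<ge> 1" "real q \<ge> 2 * pi / b"
  obtains P :: int and Q :: nat where "coprime P (int Q)" "(real q)\<^sup>2 \<le> real Q" "Q \<le> q ^ (nat \<lceil>2 * r\<rceil> + 1)"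
    "\<bar>\<beta> - of_int P / real Q\<bar> \<le> 1 / (real Q)\<^sup>2"
proof -
  define a where "a = nat \<lceil>2 * r\<rceil>"
  define N where "N = q ^ (a + 1)"
  have N: "N > 0" using q by (simp add: N_def)
  obtain h k where hk: "coprime h k" "0 < k" "k \<le> int N" "\<bar>of_int k * \<beta> - of_int h\<bar> < 1 / real N"
    by (rule Dirichlet_approx_coprime[OF N, of \<beta>]) blast
  define Q where "Q = nat k"
  have kQ: "k = int Q" "Q > 0" using hk(2) by (auto simp: Q_def)
  have "sin (2 * pi * of_int k * \<beta>) = sin (2 * pi * (of_int k * \<beta> - of_int h))"
    using sin_int_2pin[of h] cos_int_2pin[of h] by (simp add: right_diff_distrib sin_diff mult.assoc)
  also have "\<bar>\<dots>\<bar> \<le> \<bar>2 * pi * (of_int k * \<beta> - of_int h)\<bar>" by (rule abs_sin_x_le_abs_x)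
  also have "\<dots> = 2 * pi * \<bar>of_int k * \<beta> - of_int h\<bar>" by (simp add: abs_mult)
  also have "\<dots> < 2 * pi * (1 / real N)" using hk(4) by (intro mult_strict_left_mono) auto
  finally have "b / real Q powr r < 2 * pi / real N" using dio[of k] hk(2) kQ by simp
  then have bN: "b * real N < 2 * pi * real Q powr r" using N kQ by (simp add: field_simps)
  have "(real q)\<^sup>2 \<le> real Q"
  proof (rule ccontr)
    assume "\<not> ?thesis"
    then have "real Q powr r \<le> ((real q)\<^sup>2) powr r" using r by (intro powr_mono2) auto
    also have "\<dots> = real q powr (2 * r)" using q by (simp add: powr_powr flip: powr_numeral)
    also have "\<dots> \<le> real q powr (real a)" using q by (intro powr_mono) (unfold a_def, linarith, simp)
    also have "\<dots> = real q ^ a" using q by (simp add: powr_realpow)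
    finally have "2 * pi * real Q powr r \<le> 2 * pi * real q ^ a" by simp
    also have "\<dots> \<le> (b * real q) * real q ^ a" using q(2) b by (intro mult_right_mono) (auto simp: field_simps)
    also have "\<dots> = b * real N" by (simp add: N_def)
    finally show False using bN by simp
  qed
  moreover have "Q \<le> q ^ (nat \<lceil>2 * r\<rceil> + 1)"
  proof -
    have "int Q \<le> int N" using hk(3) kQ(1) by (simp only:)
    then show ?thesis unfolding of_nat_le_iff N_def a_def .
  qed
  moreover have "\<bar>\<beta> - of_int h / real Q\<bar> \<le> 1 / (real Q)\<^sup>2"
  proof -
    have "real Q * \<bar>\<beta> - of_int h / real Q\<bar> = \<bar>real Q * (\<beta> - of_int h / real Q)\<bar>" by (simp only: abs_mult abs_of_nat)
    also have "real Q * (\<beta> - of_int h / real Q) = of_int k * \<beta> - of_int h" using kQ by (simp add: right_diff_distrib)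
    finally have "real Q * \<bar>\<beta> - of_int h / real Q\<bar> \<le> 1 / real N" using hk(4) by simp
    also have "\<dots> \<le> 1 / real Q" using hk(3) kQ N by (intro divide_left_mono) auto
    finally have "real Q * \<bar>\<beta> - of_int h / real Q\<bar> \<le> 1 / real Q" .
    then show ?thesis using kQ by (simp add: power2_eq_square field_simps)
  qed
  ultimately show thesis using that[of h Q] hk(1) kQ by simp
qed

text \<open>Halving the rate 1/(24 G) leaves a factor exp(-d q) to absorb the constant
  \<open>C\<close>, and the term with q^2 in the exponent absorbs both q^a and exp(d q).\<close>

lemma exponential_tail_eventually:
  fixes C c G \<kappa> :: real and a :: nat
  assumes "C > 0" "c > 0" "G > 0" "\<kappa> > 0"
  shows "eventually (\<lambda>q::nat. 2 * real q ^ a * (C * exp (- c * (\<kappa> * (real q)\<^sup>2 / 8))) + C * exp (- (\<kappa> * real q / (24 * G)))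
     < exp (- (1 / (48 * G)) * \<kappa> * real q)) sequentially"
proof -
  define d where "d = \<kappa> / (48 * G)"
  have d: "d > 0" using assms by (simp add: d_def)
  define c' where "c' = c * \<kappa> / 8"
  have c': "c' > 0" using assms by (simp add: c'_def)
  have "(\<lambda>q::nat. real q ^ a * exp (- c' * (real q)\<^sup>2 + d * real q)) \<longlonglongrightarrow> 0" using c' d by real_asymp
  moreover have "(\<lambda>q::nat. exp (- d * real q)) \<longlonglongrightarrow> 0" using d by real_asymp
  ultimately have "(\<lambda>q::nat. 2 * C * (real q ^ a * exp (- c' * (real q)\<^sup>2 + d * real q)) + C * exp (- d * real q)) \<longlonglongrightarrow> 2 * C * 0 + C * 0"
    by (intro tendsto_intros)
  then have "eventually (\<lambda>q::nat. 2 * C * (real q ^ a * exp (- c' * (real q)\<^sup>2 + d * real q)) + C * exp (- d * real q) < 1) sequentially"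
    by (intro order_tendstoD(2)) auto
  then show ?thesis
  proof (rule eventually_mono)
    fix q :: nat
    assume "2 * C * (real q ^ a * exp (- c' * (real q)\<^sup>2 + d * real q)) + C * exp (- d * real q) < 1"
    then have "(2 * C * (real q ^ a * exp (- c' * (real q)\<^sup>2 + d * real q)) + C * exp (- d * real q)) * exp (- d * real q) < 1 * exp (- d * real q)"
      by (intro mult_strict_right_mono) auto
    moreover have "exp (- c' * (real q)\<^sup>2 + d * real q) * exp (- d * real q) = exp (- c' * (real q)\<^sup>2)"
      by (simp flip: exp_add)
    moreover have "exp (- d * real q) * exp (- d * real q) = exp (- (2 * d * real q))"
      by (simp flip: exp_add)
    ultimately have "2 * C * (real q ^ a * exp (- c' * (real q)\<^sup>2)) + C * exp (- (2 * d * real q)) < exp (- d * real q)"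
      by (simp only: distrib_right mult.assoc mult_1)
    moreover have "2 * d * real q = \<kappa> * real q / (24 * G)" "- d * real q = - (1 / (48 * G)) * \<kappa> * real q"
      "- c' * (real q)\<^sup>2 = - c * (\<kappa> * (real q)\<^sup>2 / 8)"
      using assms by (simp_all add: d_def c'_def field_simps)
    ultimately show "2 * real q ^ a * (C * exp (- c * (\<kappa> * (real q)\<^sup>2 / 8))) + C * exp (- (\<kappa> * real q / (24 * G)))
     < exp (- (1 / (48 * G)) * \<kappa> * real q)" by (simp only: mult_ac)
  qed
qed

context cocycle_tail
begin

lemma large_deviation_bound:
  assumes q: "q \<ge> 1" "8 / real q \<le> \<delta> / 2" "G / real q \<le> \<kappa> / 4" "16 * ln K \<le> (real q)\<^sup>2 * \<kappa>" "4 * ln 2 < (real q)\<^sup>2 * \<kappa>"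
    and \<kappa>: "0 < \<kappa>" and cop: "coprime P (int Q)" and approx: "\<bar>\<beta> - of_int P / real Q\<bar> \<le> 1 / (real Q)\<^sup>2"
    and PQ: "Q \<le> q ^ a" "(real q)\<^sup>2 \<le> real Q" and nq: "real q ^ (a + 2) < real n"
  shows "measure torus_measure (deviation_set \<beta> D n \<kappa>)
    \<le> 2 * real q ^ a * (C1 * exp (- c1 * (\<kappa> * (real q)\<^sup>2 / 8))) + 10 * exp 1 * exp (- (\<kappa> * real q / (24 * G)))" (is "_ \<le> ?b")
proof -
  have q2: "(real q)\<^sup>2 > 0" using q by simp
  have Qpos: "real Q > 0" using PQ(2) q2 by linarith
  have Qa: "real Q \<le> real q ^ a" using PQ(1) by (simp flip: of_nat_power)
  have "real Q * (real q)\<^sup>2 \<le> real q ^ a * (real q)\<^sup>2" using Qa by (intro mult_right_mono) auto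
  also have "\<dots> = real q ^ (a + 2)" by (simp add: power_add power2_eq_square)
  finally have nQ: "real Q * (real q)\<^sup>2 \<le> real n" using nq by linarith
  have "1 * (real q)\<^sup>2 \<le> real Q * (real q)\<^sup>2" using Qpos by (intro mult_right_mono) auto
  then have nq2: "(real q)\<^sup>2 \<le> real n" using nQ by linarith
  then have npos: "n > 0" using q2 by (metis of_nat_0_less_iff order.strict_trans2)
  \<comment> \<open>Half of the allowance n \<kappa> / 4 goes to Q s, the other half to 2 Q ln K;
    the latter is the role of \<open>16 * ln K \<le> (real q)\<^sup>2 * \<kappa>\<close>.\<close>
  define s where "s = real n * \<kappa> / (8 * real Q)"
  have s: "s \<ge> \<kappa> * (real q)\<^sup>2 / 8"
  proof -
    have "\<kappa> * (real q)\<^sup>2 / 8 = (real Q * (real q)\<^sup>2) * \<kappa> / (8 * real Q)" using Qpos by simp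
    also have "\<dots> \<le> real n * \<kappa> / (8 * real Q)" using nQ \<kappa> by (intro divide_right_mono mult_right_mono) auto
    finally show ?thesis by (simp add: s_def)
  qed
  have s0: "s \<ge> 0" using \<kappa> by (simp add: s_def)
  have slow: "real Q * (s + 2 * ln K) \<le> real n * \<kappa> / 4"
  proof -
    have "real Q * (16 * ln K) \<le> real Q * ((real q)\<^sup>2 * \<kappa>)" using q by (intro mult_left_mono) auto
    also have "\<dots> \<le> real n * \<kappa>" using nQ \<kappa> by (subst mult.assoc[symmetric], intro mult_right_mono) auto
    finally have "real Q * ln K \<le> real n * \<kappa> / 16" by simp
    moreover have "real Q * s = real n * \<kappa> / 8" using Qpos by (simp add: s_def)
    ultimately show ?thesis by (simp add: distrib_left)
  qed
  show ?thesis
  proof (rule deviation_measure_le[OF npos])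
    have "(real q)\<^sup>2 * \<kappa> \<le> real n * \<kappa>" using nq2 \<kappa> by (intro mult_right_mono) auto
    then show "4 * ln 2 < real n * \<kappa>" using q by linarith
    show "?b \<ge> 0" using C1 by simp
    fix \<epsilon> :: real assume e: "0 < \<epsilon>" "\<epsilon> \<le> 1"
    have "emeasure lborel {x\<in>{0..<1}. \<bar>u n \<epsilon> x - u_mean n \<epsilon>\<bar> > real n * \<kappa> / 2}
      \<le> ennreal (2 * real Q * (C1 * exp (- c1 * s)) + 10 * exp 1 * exp (- (\<kappa> * real q / (24 * G))))"
      by (rule regularized_deviation[OF npos e _ _ PQ(2) cop approx \<kappa>(1) _ s0 slow]) (use q in auto)
    also have "\<dots> \<le> ennreal ?b"
    proof (rule ennreal_leI)
      have "exp (- c1 * s) \<le> exp (- c1 * (\<kappa> * (real q)\<^sup>2 / 8))"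
        using s c1 by simp
      then have "2 * real Q * (C1 * exp (- c1 * s)) \<le> 2 * real q ^ a * (C1 * exp (- c1 * (\<kappa> * (real q)\<^sup>2 / 8)))"
        using Qa C1 by (intro mult_mono) auto
      then show "2 * real Q * (C1 * exp (- c1 * s)) + 10 * exp 1 * exp (- (\<kappa> * real q / (24 * G))) \<le> ?b"
        by simp
    qed
    finally show "emeasure lborel {x\<in>{0..<1}. \<bar>u n \<epsilon> x - u_mean n \<epsilon>\<bar> > real n * \<kappa> / 2} \<le> ennreal ?b" .
  qed
qed

end

theorem theorem3p1:
  fixes \<beta> :: real
  assumes "diophantine \<beta>"
  shows "\<exists>\<eta>::real. \<eta> > 1 \<and>
    (\<forall>(\<delta>::real) D. \<delta> > 0 \<longrightarrow> D \<in> analytic_cocycles \<delta> \<longrightarrow>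
        (\<exists>x::real. det (D (complex_of_real x)) \<noteq> 0) \<longrightarrow>
      (\<exists>(\<gamma>::real) (c::real) (C::real). \<gamma> > 0 \<and> c > 0 \<and> C > 0 \<and>
        (\<forall>\<kappa>::real. 0 < \<kappa> \<longrightarrow> \<kappa> < 1 \<longrightarrow>
          (\<exists>q\<^sub>0::nat. \<forall>(p::int) (q::nat).
            q > 0 \<longrightarrow> q \<ge> q\<^sub>0 \<longrightarrow> coprime p (int q) \<longrightarrow>
            \<bar>\<beta> - of_int p / real q\<bar> < 1 / (real q)\<^sup>2 \<longrightarrow>
            (\<forall>n::nat. real n > (C * \<kappa> powr (-2) * real q) powr \<eta> \<longrightarrow>
              (\<forall>D'\<in>analytic_cocycles \<delta>. strip_norm \<delta> (\<lambda>z. D' z - D z) < \<gamma> \<longrightarrow>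
                measure torus_measure (deviation_set \<beta> D' n \<kappa>) < exp (- c * \<kappa> * real q)))))))"
proof -
  obtain b r where b: "b > 0" and r: "r > 1"
    and dio: "\<And>j::int. j \<noteq> 0 \<Longrightarrow> \<bar>sin (2 * pi * of_int j * \<beta>)\<bar> > b / \<bar>of_int j\<bar> powr r"
    using assms unfolding diophantine_def by blast
  \<comment> \<open>This is the exponent in Q <= q^a from \<open>diophantine_denominator\<close>.
    Two further powers of q in \<eta> give n >= Q q^2. Both exponents depend on \<beta>
    only.\<close>
  define a where "a = nat \<lceil>2 * r\<rceil> + 1"
  define \<eta> where "\<eta> = real (a + 2)"
  show ?thesis
  proof (rule exI[of _ \<eta>], intro conjI allI impI, goal_cases)
    case 1
    show ?case by (simp add: \<eta>_def)
  next
    case (2 \<delta> D)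
    then obtain x0 where d: "\<delta> > 0" and D: "D \<in> analytic_cocycles \<delta>" and x0: "det (D (complex_of_real x0)) \<noteq> 0" by blast
    obtain \<gamma> c1 where \<gamma>: "\<gamma> > 0" "\<gamma> \<le> 1" and c1: "c1 > 0"
      and tail: "\<And>D' s. D' \<in> analytic_cocycles \<delta> \<Longrightarrow> strip_norm \<delta> (\<lambda>z. D' z - D z) < \<gamma> \<Longrightarrow>
       emeasure lborel {x\<in>{0..<1}. norm (det (D' (of_real x))) \<le> exp (- s)} \<le> ennreal (10 * exp 1 * exp (- c1 * s))"
      by (rule det_sublevel_bound[OF D x0 d]) blast
    obtain K where K: "K \<ge> 1" "\<And>D' z \<gamma>. D' \<in> analytic_cocycles \<delta> \<Longrightarrow> strip_norm \<delta> (\<lambda>z. D' z - D z) < \<gamma> \<Longrightarrow> \<gamma> \<le> 1 \<Longrightarrow> z \<in> strip \<delta> \<Longrightarrow>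
       norm (D' z) \<le> K \<and> norm (det (D' z) - det (D z)) \<le> 8 * K * \<gamma>" by (rule cocycle_neighbourhood[OF D]) blast
    define C1 :: real where "C1 = 10 * exp 1"
    have C1: "C1 > 0" by (simp add: C1_def)
    have cocycle: "cocycle_tail \<delta> K D' C1 c1" if "D' \<in> analytic_cocycles \<delta>" "strip_norm \<delta> (\<lambda>z. D' z - D z) < \<gamma>" for D'
      using that d K(1) K(2)[OF that \<gamma>(2)] c1 C1 tail[OF that] by unfold_locales (auto simp: C1_def)
    \<comment> \<open>One rate for the whole neighbourhood, since no cocycle occurs among the
      arguments. Its positivity is read off at \<open>D\<close> itself, which is at distance 0 <
      \<gamma>.\<close>
    define G where "G = cocycle_tail.G \<delta> K C1 c1"
    have G: "G > 0"
    proof -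
      have "mnorm 0 = 0" using mnorm_le_norm[of 0] norm_le_mnorm[of 0] by simp
      moreover have "strip \<delta> \<noteq> {}" using d by (auto simp: strip_def intro: exI[of _ 0])
      ultimately have "strip_norm \<delta> (\<lambda>z. D z - D z) = 0" unfolding strip_norm_def by auto
      then interpret ct: cocycle_tail \<delta> \<beta> K D C1 c1 using cocycle[OF D] \<gamma>(1) by simp
      show ?thesis unfolding G_def by (rule ct.rate_pos(2))
    qed
    show ?case
    proof (rule exI[of _ \<gamma>], rule exI[of _ "1 / (48 * G)"], rule exI[of _ "1::real"], intro conjI allI impI, goal_cases)
      case (4 \<kappa>)
      note \<kappa> = \<open>0 < \<kappa>\<close> \<open>\<kappa> < 1\<close>
      \<comment> \<open>Every requirement on q involves only \<kappa>, \<delta>, the Diophantine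
        data and the constants of the neighbourhood, so one threshold serves all n and all
        \<open>D'\<close>.\<close>
      have "eventually (\<lambda>q::nat. q \<ge> 1) sequentially" by (rule eventually_ge_at_top)
      moreover have "eventually (\<lambda>q::nat. 8 / real q \<le> \<delta> / 2) sequentially" using d by real_asymp
      moreover have "eventually (\<lambda>q::nat. G / real q \<le> \<kappa> / 4) sequentially" using \<kappa> G by real_asymp
      moreover have "eventually (\<lambda>q::nat. 16 * ln K \<le> (real q)\<^sup>2 * \<kappa>) sequentially" using \<kappa> by real_asymp
      moreover have "eventually (\<lambda>q::nat. 4 * ln 2 < (real q)\<^sup>2 * \<kappa>) sequentially" using \<kappa> by real_asymp
      moreover have "eventually (\<lambda>q::nat. real q \<ge> 2 * pi / b) sequentially" by real_asymp
      moreover note exponential_tail_eventually[OF C1 c1 G \<kappa>(1), of a]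
      ultimately have "eventually (\<lambda>q::nat. q \<ge> 1 \<and> 8 / real q \<le> \<delta> / 2 \<and> G / real q \<le> \<kappa> / 4
        \<and> 16 * ln K \<le> (real q)\<^sup>2 * \<kappa> \<and> 4 * ln 2 < (real q)\<^sup>2 * \<kappa> \<and> real q \<ge> 2 * pi / b
        \<and> 2 * real q ^ a * (C1 * exp (- c1 * (\<kappa> * (real q)\<^sup>2 / 8))) + C1 * exp (- (\<kappa> * real q / (24 * G)))
          < exp (- (1 / (48 * G)) * \<kappa> * real q)) sequentially" (is "eventually ?good _")
        by (intro eventually_conj)
      then obtain q0 where q0: "\<And>q. q \<ge> q0 \<Longrightarrow> ?good q"
        unfolding eventually_sequentially by blast
      show ?case
      proof (rule exI[of _ q0], intro allI impI ballI, goal_cases)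
        case (1 p q n D')
        note q = q0[OF \<open>q \<ge> q0\<close>]
        interpret ct: cocycle_tail \<delta> \<beta> K D' C1 c1 by (rule cocycle) fact+
        \<comment> \<open>As \<kappa> < 1, the factor \<kappa>^(-2) only enlarges the base; with C =
          1 the hypothesis on n yields n > q^(a+2).\<close>
        have "1 * real q \<le> \<kappa> powr (-2) * real q"
          using \<kappa> powr_mono2'[of "-2" \<kappa> 1] by (intro mult_right_mono) auto
        then have "real q powr \<eta> \<le> (1 * \<kappa> powr (-2) * real q) powr \<eta>" by (intro powr_mono2) (auto simp: \<eta>_def)
        moreover have "real q powr \<eta> = real q ^ (a + 2)" using q unfolding \<eta>_def by (intro powr_realpow) auto
        ultimately have nq: "real q ^ (a + 2) < real n" using 1 by linarith
        obtain P Q where PQ: "coprime P (int Q)" "(real q)\<^sup>2 \<le> real Q" "Q \<le> q ^ a" "\<bar>\<beta> - of_int P / real Q\<bar> \<le> 1 / (real Q)\<^sup>2"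
          unfolding a_def by (rule diophantine_denominator[OF b r dio]) (use q in auto)
        have "measure torus_measure (deviation_set \<beta> D' n \<kappa>)
          \<le> 2 * real q ^ a * (C1 * exp (- c1 * (\<kappa> * (real q)\<^sup>2 / 8))) + C1 * exp (- (\<kappa> * real q / (24 * G)))"
          using ct.large_deviation_bound[of q \<kappa> P Q a n] q \<kappa> PQ nq unfolding G_def C1_def by blast
        then show ?case using q by linarith
      qed
    qed (use \<gamma> G in auto)
  qed
qed

end
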